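(* Let $g=C\left(\frac{1}{4F}dz^2+F(\eta^1)^2+(\eta^2)^2+(\eta^3)^2\right)$ with $F=F(z)>0$, $C=C(z)>0$ smooth. Then the following hold. (i) The scalar curvature of $g$ is $$s=-4C^{-1}\left(\frac{\partial^2F}{\partial z^2}+\frac12F-2\right)-24C^{-\frac32}\frac{\partial}{\partial z}\left(F\frac{\partial C^{\frac12}}{\partial z}\right).$$ (ii) The trace-free Ricci tensor $\mathring{\mathrm{Ric}}$ of $g$ is $$\mathring{\mathrm{Ric}}=4FC^{-\frac12}\left(\frac{\partial^2}{\partial z^2}C^{-\frac12}-\frac14C^{-\frac12}\right)\left((\sigma^0)^2-(\sigma^1)^2\right)$$ $$\quad+2\left(C^{-\frac12}\frac{\partial}{\partial z}\left(F\frac{\partial}{\partial z}C^{-\frac12}\right)-C^{-1}\left(\frac12\frac{\partial^2F}{\partial z^2}-\frac34F+1\right)\right)\left((\sigma^0)^2+(\sigma^1)^2-(\sigma^2)^2-(\sigma^3)^2\right).$$ (iii) The self-dual and anti-self-dual Weyl curvatures are $$W^\pm=-\frac1C(\mathcal{L}^\pm(F)-1)\left(\omega^\pm\otimes\omega^\pm-\frac23Id_{\bigwedge^\pm}\right).$$ (iv) Wherever $\mathcal{L}^\pm(F)\neq1$, the divergences of the Weyl tensors are $$\delta W^\pm=W^\pm\left(\nabla\log\left|e^{\pm\frac32z}(\mathcal{L}^\pm(F)-1)\sqrt C\right|,\cdot,\cdot,\cdot\right).$$ (v) The Bach tensor is $$Bach=\frac{16}{3C^2}F\big(\mathcal{L}^-(\mathcal{L}^+(F))-1\big)\Big(-2(\sigma^1)^2+(\sigma^2)^2+(\sigma^3)^2\Big)+\frac{8}{3C^2}\mathcal{B}(F,F)\Big(-(\sigma^0)^2-(\sigma^1)^2+(\sigma^2)^2+(\sigma^3)^2\Big).$$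 (vi) If $g$ is K\"ahler with respect to $J^+$, so that $C=C_0e^{-z}$ for a constant $C_0>0$, then the scalar curvature and Ricci form are $$s=-\frac8C\left(\mathcal{L}^+(F)-1\right),$$ $$\rho=-\frac2C\left(\mathcal{L}^+(F)-1\right)\omega^+-\frac2C\left[\left(-\frac12\frac{\partial}{\partial z}+1\right)\left(\frac{\partial}{\partial z}+1\right)F-1\right]\omega^-.$$
   Context: Let $\eta^1,\eta^2,\eta^3$ be the left-invariant coframe on $\mathbb{S}^3$ with $d\eta^1=-2\eta^2\wedge\eta^3$, $d\eta^2=-2\eta^3\wedge\eta^1$, $d\eta^3=-2\eta^1\wedge\eta^2$, with dual frame $e_1,e_2,e_3$. The metric lives on $I\times\mathbb{S}^3$, $I$ an interval with coordinate $z$. The orthonormal coframe is $\sigma^0=\sqrt{C/(4F)}\,dz$, $\sigma^1=\sqrt{CF}\,\eta^1$, $\sigma^2=\sqrt C\,\eta^2$, $\sigma^3=\sqrt C\,\eta^3$. Complex structures: $J^\pm=\mp2F\frac{\partial}{\partial z}\otimes\eta^1\pm\frac1{2F}e_1\otimes dz-e_2\otimes\eta^3+e_3\otimes\eta^2$; their forms are $\omega^\pm=g(J^\pm\cdot,\cdot)=\pm\frac12C\,dz\wedge\eta^1+C\,\eta^2\wedge\eta^3$. The orientation is the one induced by $J^+$, so $\omega^\pm\in\bigwedge^\pm$ (self-dual/anti-self-dual 2-forms), $|\omega^\pm|^2=2$; $W^\pm$ is regarded as an operator on $\bigwedge^\pm$ (equivalently a $(0,4)$-tensor), with $\omega\otimes\omega$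 acting by $\alpha\mapsto\langle\omega,\alpha\rangle\omega$. $\delta$ denotes the divergence, i.e. $(\delta T)(\cdot,\cdot,\cdot)=\sum_i(\nabla_{f_i}T)(f_i,\cdot,\cdot,\cdot)$ for an orthonormal frame $f_i$. Operators: $\mathcal{L}^+=\left(-\frac12\frac{d}{dz}+1\right)\left(-\frac{d}{dz}+1\right)$, $\mathcal{L}^-=\left(\frac12\frac{d}{dz}+1\right)\left(\frac{d}{dz}+1\right)$, and $$\mathcal{B}(F,F)=\left(-\frac12F_{zz}+\frac32F_z+F-1\right)(\mathcal{L}^+(F)-1)+F_z\big(\mathcal{L}^+(F)\big)_z.$$ The Bach tensor is $Bach_{ij}=W_{sijt}{}^{,st}+\frac12W_{sijt}\mathrm{Ric}^{st}$ (index convention in which $g^{st}\mathrm{Rm}_{sijt}=\mathrm{Ric}_{ij}$). The Ricci form is $\rho=\mathrm{Ric}(J^+\cdot,\cdot)$. *)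

theory Defs
  imports "HOL-Analysis.Analysis"
begin

section \<open>Riemannian geometry on an open subset of a Euclidean space\<close>

text \<open>A tensor field is a function of a point \<open>x\<close> and of tangent vectors at \<open>x\<close>; the tangent
  space of an open subset of \<open>'a\<close> at each point is \<open>'a\<close> itself. Multilinearity is not
  part of the types.\<close>

definition dir_deriv :: "('a::euclidean_space \<Rightarrow> 'b::real_normed_vector) \<Rightarrow> 'a \<Rightarrow> 'a \<Rightarrow> 'b" where
  "dir_deriv f x u = frechet_derivative f (at x) u"

definition ext_deriv1 :: "('a::euclidean_space \<Rightarrow> 'a \<Rightarrow> real) \<Rightarrow> 'a \<Rightarrow> 'a \<Rightarrow> 'a \<Rightarrow> real" where
  "ext_deriv1 \<alpha> x u v = dir_deriv (\<lambda>y. \<alpha> y v) x u - dir_deriv (\<lambda>y. \<alpha> y u) x v"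

text \<open>Raising an index with an inner product \<open>h\<close>.\<close>

definition sharp :: "('a \<Rightarrow> 'a \<Rightarrow> real) \<Rightarrow> ('a \<Rightarrow> real) \<Rightarrow> 'a" where
  "sharp h \<phi> = (THE w. \<forall>v. h w v = \<phi> v)"

text \<open>The trace \<open>h\<^sup>s\<^sup>t b\<^sub>s\<^sub>t\<close>, that is, the trace of the endomorphism \<open>A\<close> with \<open>h (A u) v = b u v\<close>.\<close>

definition mtrace :: "('a::euclidean_space \<Rightarrow> 'a \<Rightarrow> real) \<Rightarrow> ('a \<Rightarrow> 'a \<Rightarrow> real) \<Rightarrow> real" where
  "mtrace h b = (\<Sum>i\<in>Basis. sharp h (b i) \<bullet> i)"

definition grad :: "('a::euclidean_space \<Rightarrow> 'a \<Rightarrow> 'a \<Rightarrow> real) \<Rightarrow> ('a \<Rightarrow> real) \<Rightarrow> 'a \<Rightarrow> 'a" where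
  "grad g f x = sharp (g x) (dir_deriv f x)"

text \<open>The Christoffel symbol of the Levi-Civita connection: \<open>christoffel g x u v = \<nabla>\<^sub>u v\<close> for the
  constant vector fields \<open>u\<close> and \<open>v\<close>, which commute.\<close>

definition christoffel :: "('a::euclidean_space \<Rightarrow> 'a \<Rightarrow> 'a \<Rightarrow> real) \<Rightarrow> 'a \<Rightarrow> 'a \<Rightarrow> 'a \<Rightarrow> 'a" where
  "christoffel g x u v = sharp (g x) (\<lambda>w.
     (dir_deriv (\<lambda>y. g y v w) x u + dir_deriv (\<lambda>y. g y u w) x v
       - dir_deriv (\<lambda>y. g y u v) x w) / 2)"

text \<open>\<open>R(u,v)w = \<nabla>\<^sub>u \<nabla>\<^sub>v w - \<nabla>\<^sub>v \<nabla>\<^sub>u w\<close> for constant vector fields.\<close>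

definition curv_endo :: "('a::euclidean_space \<Rightarrow> 'a \<Rightarrow> 'a \<Rightarrow> real) \<Rightarrow> 'a \<Rightarrow> 'a \<Rightarrow> 'a \<Rightarrow> 'a \<Rightarrow> 'a" where
  "curv_endo g x u v w =
     dir_deriv (\<lambda>y. christoffel g y v w) x u - dir_deriv (\<lambda>y. christoffel g y u w) x v
     + christoffel g x u (christoffel g x v w) - christoffel g x v (christoffel g x u w)"

definition Rm :: "('a::euclidean_space \<Rightarrow> 'a \<Rightarrow> 'a \<Rightarrow> real) \<Rightarrow> 'a \<Rightarrow> 'a \<Rightarrow> 'a \<Rightarrow> 'a \<Rightarrow> 'a \<Rightarrow> real" where
  "Rm g x u v w y = g x (curv_endo g x u v w) y"

text \<open>\<open>Ric\<^sub>i\<^sub>j = g\<^sup>s\<^sup>t Rm\<^sub>s\<^sub>i\<^sub>j\<^sub>t\<close>; with these conventions round spheres have positive Ricci curvature.\<close>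

definition Ric :: "('a::euclidean_space \<Rightarrow> 'a \<Rightarrow> 'a \<Rightarrow> real) \<Rightarrow> 'a \<Rightarrow> 'a \<Rightarrow> 'a \<Rightarrow> real" where
  "Ric g x u v = mtrace (g x) (\<lambda>s t. Rm g x s u v t)"

definition scal :: "('a::euclidean_space \<Rightarrow> 'a \<Rightarrow> 'a \<Rightarrow> real) \<Rightarrow> 'a \<Rightarrow> real" where
  "scal g x = mtrace (g x) (Ric g x)"

definition Ric0 :: "('a::euclidean_space \<Rightarrow> 'a \<Rightarrow> 'a \<Rightarrow> real) \<Rightarrow> 'a \<Rightarrow> 'a \<Rightarrow> 'a \<Rightarrow> real" where
  "Ric0 g x u v = Ric g x u v - scal g x / real DIM('a) * g x u v"

definition Schouten :: "('a::euclidean_space \<Rightarrow> 'a \<Rightarrow> 'a \<Rightarrow> real) \<Rightarrow> 'a \<Rightarrow> 'a \<Rightarrow> 'a \<Rightarrow> real" where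
  "Schouten g x u v =
     (Ric g x u v - scal g x / (2 * (real DIM('a) - 1)) * g x u v) / (real DIM('a) - 2)"

definition Weyl :: "('a::euclidean_space \<Rightarrow> 'a \<Rightarrow> 'a \<Rightarrow> real) \<Rightarrow> 'a \<Rightarrow> 'a \<Rightarrow> 'a \<Rightarrow> 'a \<Rightarrow> 'a \<Rightarrow> real" where
  "Weyl g x u v w y = Rm g x u v w y
     - (Schouten g x u y * g x v w + Schouten g x v w * g x u y
        - Schouten g x u w * g x v y - Schouten g x v y * g x u w)"

text \<open>Covariant derivatives; the new argument \<open>s\<close> comes first.\<close>

definition cov_endo ::
  "('a::euclidean_space \<Rightarrow> 'a \<Rightarrow> 'a \<Rightarrow> real) \<Rightarrow> ('a \<Rightarrow> 'a \<Rightarrow> 'a) \<Rightarrow> 'a \<Rightarrow> 'a \<Rightarrow> 'a \<Rightarrow> 'a" where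
  "cov_endo g J x s u = dir_deriv (\<lambda>y. J y u) x s
     + christoffel g x s (J x u) - J x (christoffel g x s u)"

definition cov4 ::
  "('a::euclidean_space \<Rightarrow> 'a \<Rightarrow> 'a \<Rightarrow> real) \<Rightarrow> ('a \<Rightarrow> 'a \<Rightarrow> 'a \<Rightarrow> 'a \<Rightarrow> 'a \<Rightarrow> real)
    \<Rightarrow> 'a \<Rightarrow> 'a \<Rightarrow> 'a \<Rightarrow> 'a \<Rightarrow> 'a \<Rightarrow> 'a \<Rightarrow> real" where
  "cov4 g T x s a b c d = dir_deriv (\<lambda>y. T y a b c d) x s
     - T x (christoffel g x s a) b c d - T x a (christoffel g x s b) c d
     - T x a b (christoffel g x s c) d - T x a b c (christoffel g x s d)"

definition cov5 ::
  "('a::euclidean_space \<Rightarrow> 'a \<Rightarrow> 'a \<Rightarrow> real) \<Rightarrow> ('a \<Rightarrow> 'a \<Rightarrow> 'a \<Rightarrow> 'a \<Rightarrow> 'a \<Rightarrow> 'a \<Rightarrow> real)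
    \<Rightarrow> 'a \<Rightarrow> 'a \<Rightarrow> 'a \<Rightarrow> 'a \<Rightarrow> 'a \<Rightarrow> 'a \<Rightarrow> 'a \<Rightarrow> real" where
  "cov5 g T x s a b c d e = dir_deriv (\<lambda>y. T y a b c d e) x s
     - T x (christoffel g x s a) b c d e - T x a (christoffel g x s b) c d e
     - T x a b (christoffel g x s c) d e - T x a b c (christoffel g x s d) e
     - T x a b c d (christoffel g x s e)"

definition div4 ::
  "('a::euclidean_space \<Rightarrow> 'a \<Rightarrow> 'a \<Rightarrow> real) \<Rightarrow> ('a \<Rightarrow> 'a \<Rightarrow> 'a \<Rightarrow> 'a \<Rightarrow> 'a \<Rightarrow> real)
    \<Rightarrow> 'a \<Rightarrow> 'a \<Rightarrow> 'a \<Rightarrow> 'a \<Rightarrow> real" where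
  "div4 g T x a b c = mtrace (g x) (\<lambda>s t. cov4 g T x s t a b c)"

text \<open>\<open>W\<^sub>s\<^sub>i\<^sub>j\<^sub>t\<^sup>,\<^sup>s\<^sup>t + 1/2 W\<^sub>s\<^sub>i\<^sub>j\<^sub>t Ric\<^sup>s\<^sup>t\<close>. In the first term \<open>s'\<close> and \<open>t'\<close> are the first and the second
  differentiation index, contracted with \<open>s\<close> and \<open>t\<close>.\<close>

definition Bach :: "('a::euclidean_space \<Rightarrow> 'a \<Rightarrow> 'a \<Rightarrow> real) \<Rightarrow> 'a \<Rightarrow> 'a \<Rightarrow> 'a \<Rightarrow> real" where
  "Bach g x i j =
     mtrace (g x) (\<lambda>t t'. mtrace (g x) (\<lambda>s s'. cov5 g (cov4 g (Weyl g)) x t' s' s i j t))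
     + 1/2 * mtrace (g x) (\<lambda>t t'. mtrace (g x) (\<lambda>s s'. Weyl g x s i j t * Ric g x s' t'))"

section \<open>Two-forms in dimension four\<close>

text \<open>The norm is the one for which \<open>f\<^sub>i \<and> f\<^sub>j\<close>, \<open>i < j\<close>, are orthonormal if the \<open>f\<^sub>i\<close> are.\<close>

definition inner2 :: "('a::euclidean_space \<Rightarrow> 'a \<Rightarrow> real) \<Rightarrow> ('a \<Rightarrow> 'a \<Rightarrow> real) \<Rightarrow> ('a \<Rightarrow> 'a \<Rightarrow> real) \<Rightarrow> real" where
  "inner2 h \<alpha> \<beta> = 1/2 * mtrace h (\<lambda>a a'. mtrace h (\<lambda>b b'. \<alpha> a b * \<beta> a' b'))"

definition fund_form :: "('a \<Rightarrow> 'a \<Rightarrow> 'a \<Rightarrow> real) \<Rightarrow> ('a \<Rightarrow> 'a \<Rightarrow> 'a) \<Rightarrow> 'a \<Rightarrow> 'a \<Rightarrow> 'a \<Rightarrow> real" where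
  "fund_form g J x u v = g x (J x u) v"

text \<open>The volume form of the orientation induced by an almost complex structure with fundamental
  form \<open>\<omega>\<close>, namely \<open>\<omega> \<and> \<omega> / 2\<close>.\<close>

definition vol_of :: "('a \<Rightarrow> 'a \<Rightarrow> real) \<Rightarrow> 'a \<Rightarrow> 'a \<Rightarrow> 'a \<Rightarrow> 'a \<Rightarrow> real" where
  "vol_of \<omega> a b c d = \<omega> a b * \<omega> c d - \<omega> a c * \<omega> b d + \<omega> a d * \<omega> b c"

definition hodge2 ::
  "('a::euclidean_space \<Rightarrow> 'a \<Rightarrow> real) \<Rightarrow> ('a \<Rightarrow> 'a \<Rightarrow> 'a \<Rightarrow> 'a \<Rightarrow> real)
    \<Rightarrow> ('a \<Rightarrow> 'a \<Rightarrow> real) \<Rightarrow> 'a \<Rightarrow> 'a \<Rightarrow> real" where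
  "hodge2 h vol \<alpha> u v = inner2 h \<alpha> (\<lambda>a b. vol a b u v)"

text \<open>Self-dual (\<open>\<epsilon> = 1\<close>) and anti-self-dual (\<open>\<epsilon> = -1\<close>) two-forms, and the projection onto them.\<close>

definition Lambda_pm ::
  "real \<Rightarrow> ('a::euclidean_space \<Rightarrow> 'a \<Rightarrow> real) \<Rightarrow> ('a \<Rightarrow> 'a \<Rightarrow> 'a \<Rightarrow> 'a \<Rightarrow> real)
    \<Rightarrow> ('a \<Rightarrow> 'a \<Rightarrow> real) set" where
  "Lambda_pm \<epsilon> h vol = {\<alpha>. bilinear \<alpha> \<and> (\<forall>u v. \<alpha> u v = - \<alpha> v u)
     \<and> (\<forall>u v. hodge2 h vol \<alpha> u v = \<epsilon> * \<alpha> u v)}"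

definition proj_pm ::
  "real \<Rightarrow> ('a::euclidean_space \<Rightarrow> 'a \<Rightarrow> real) \<Rightarrow> ('a \<Rightarrow> 'a \<Rightarrow> 'a \<Rightarrow> 'a \<Rightarrow> real)
    \<Rightarrow> ('a \<Rightarrow> 'a \<Rightarrow> real) \<Rightarrow> 'a \<Rightarrow> 'a \<Rightarrow> real" where
  "proj_pm \<epsilon> h vol \<alpha> u v = (\<alpha> u v + \<epsilon> * hodge2 h vol \<alpha> u v) / 2"

text \<open>The action of a curvature-like tensor on two-forms, with the sign for which the curvature
  tensor \<^term>\<open>Rm g\<close> of the unit sphere acts as the identity.\<close>

definition curv_op ::
  "('a::euclidean_space \<Rightarrow> 'a \<Rightarrow> real) \<Rightarrow> ('a \<Rightarrow> 'a \<Rightarrow> 'a \<Rightarrow> 'a \<Rightarrow> real)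
    \<Rightarrow> ('a \<Rightarrow> 'a \<Rightarrow> real) \<Rightarrow> 'a \<Rightarrow> 'a \<Rightarrow> real" where
  "curv_op h T \<alpha> u v = inner2 h \<alpha> (\<lambda>a b. T u v b a)"

text \<open>The part of the Weyl tensor in \<open>\<Lambda>\<^sup>\<plusminus> \<otimes> \<Lambda>\<^sup>\<plusminus>\<close>, for the orientation with volume form \<open>vol\<close>.\<close>

definition Weyl_pm ::
  "real \<Rightarrow> ('a::euclidean_space \<Rightarrow> 'a \<Rightarrow> 'a \<Rightarrow> real) \<Rightarrow> ('a \<Rightarrow> 'a \<Rightarrow> 'a \<Rightarrow> 'a \<Rightarrow> 'a \<Rightarrow> real)
    \<Rightarrow> 'a \<Rightarrow> 'a \<Rightarrow> 'a \<Rightarrow> 'a \<Rightarrow> 'a \<Rightarrow> real" where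
  "Weyl_pm \<epsilon> g vol x u v w y =
     proj_pm \<epsilon> (g x) (vol x)
       (\<lambda>a b. proj_pm \<epsilon> (g x) (vol x) (\<lambda>c d. Weyl g x a b c d) w y) u v"

definition Kaehler_on ::
  "'a set \<Rightarrow> ('a::euclidean_space \<Rightarrow> 'a \<Rightarrow> 'a \<Rightarrow> real) \<Rightarrow> ('a \<Rightarrow> 'a \<Rightarrow> 'a) \<Rightarrow> bool" where
  "Kaehler_on U g J \<longleftrightarrow> (\<forall>x\<in>U. \<forall>u v.
      J x (J x u) = - u \<and> g x (J x u) (J x v) = g x u v \<and> cov_endo g J x u v = 0)"

section \<open>The manifold and the metrics\<close>

text \<open>\<open>S\<^sup>3\<close> is the unit sphere of \<open>\<complex>\<^sup>2\<close>, identified with the quaternions by \<open>(a, b) \<mapsto> a + b j\<close>. The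
  manifold \<open>I \<times> S\<^sup>3\<close> is given the single global chart \<open>(z, p) \<mapsto> e\<^sup>z p\<close>, a diffeomorphism onto the
  open set of all \<open>x \<noteq> 0\<close> with \<open>ln |x| \<in> I\<close>. All tensor fields are expressed in this chart.\<close>

definition chart :: "real \<Rightarrow> complex \<times> complex \<Rightarrow> complex \<times> complex" where
  "chart z p = exp z *\<^sub>R p"

definition domM :: "real set \<Rightarrow> (complex \<times> complex) set" where
  "domM I = (\<lambda>(z, p). chart z p) ` (I \<times> sphere 0 1)"

definition zcoord :: "complex \<times> complex \<Rightarrow> real" where
  "zcoord x = ln (norm x)"

text \<open>In the chart, \<open>\<partial>/\<partial>z\<close> is the radial field \<open>x\<close>, and \<open>e\<^sub>1, e\<^sub>2, e\<^sub>3\<close> are the left-invariant fields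
  \<open>x i\<close>, \<open>x j\<close>, \<open>x k\<close> (quaternion products).\<close>

definition Ez :: "complex \<times> complex \<Rightarrow> complex \<times> complex" where "Ez x = x"
definition E1 :: "complex \<times> complex \<Rightarrow> complex \<times> complex" where
  "E1 x = (\<i> * fst x, - \<i> * snd x)"
definition E2 :: "complex \<times> complex \<Rightarrow> complex \<times> complex" where
  "E2 x = (- snd x, fst x)"
definition E3 :: "complex \<times> complex \<Rightarrow> complex \<times> complex" where
  "E3 x = (\<i> * snd x, \<i> * fst x)"

text \<open>The four fields are Euclidean-orthogonal and of Euclidean norm \<open>|x|\<close>, so this is the dual
  coframe \<open>dz, \<eta>\<^sup>1, \<eta>\<^sup>2, \<eta>\<^sup>3\<close>.\<close>

definition dz :: "complex \<times> complex \<Rightarrow> complex \<times> complex \<Rightarrow> real" where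
  "dz x u = (Ez x \<bullet> u) / (norm x)\<^sup>2"
definition eta1 :: "complex \<times> complex \<Rightarrow> complex \<times> complex \<Rightarrow> real" where
  "eta1 x u = (E1 x \<bullet> u) / (norm x)\<^sup>2"
definition eta2 :: "complex \<times> complex \<Rightarrow> complex \<times> complex \<Rightarrow> real" where
  "eta2 x u = (E2 x \<bullet> u) / (norm x)\<^sup>2"
definition eta3 :: "complex \<times> complex \<Rightarrow> complex \<times> complex \<Rightarrow> real" where
  "eta3 x u = (E3 x \<bullet> u) / (norm x)\<^sup>2"

definition bmetric :: "(real \<Rightarrow> real) \<Rightarrow> (real \<Rightarrow> real)
    \<Rightarrow> complex \<times> complex \<Rightarrow> complex \<times> complex \<Rightarrow> complex \<times> complex \<Rightarrow> real" where
  "bmetric F C x u v = C (zcoord x) *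
     (1 / (4 * F (zcoord x)) * (dz x u * dz x v) + F (zcoord x) * (eta1 x u * eta1 x v)
      + eta2 x u * eta2 x v + eta3 x u * eta3 x v)"

definition sigma0 :: "(real \<Rightarrow> real) \<Rightarrow> (real \<Rightarrow> real) \<Rightarrow> complex \<times> complex \<Rightarrow> complex \<times> complex \<Rightarrow> real" where
  "sigma0 F C x u = sqrt (C (zcoord x) / (4 * F (zcoord x))) * dz x u"
definition sigma1 :: "(real \<Rightarrow> real) \<Rightarrow> (real \<Rightarrow> real) \<Rightarrow> complex \<times> complex \<Rightarrow> complex \<times> complex \<Rightarrow> real" where
  "sigma1 F C x u = sqrt (C (zcoord x) * F (zcoord x)) * eta1 x u"
definition sigma2 :: "(real \<Rightarrow> real) \<Rightarrow> complex \<times> complex \<Rightarrow> complex \<times> complex \<Rightarrow> real" where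
  "sigma2 C x u = sqrt (C (zcoord x)) * eta2 x u"
definition sigma3 :: "(real \<Rightarrow> real) \<Rightarrow> complex \<times> complex \<Rightarrow> complex \<times> complex \<Rightarrow> real" where
  "sigma3 C x u = sqrt (C (zcoord x)) * eta3 x u"

text \<open>The complex structures \<open>J\<^sup>\<plusminus>\<close> and their fundamental forms, with \<open>\<epsilon> = \<plusminus>1\<close>.\<close>

definition Jpm :: "real \<Rightarrow> (real \<Rightarrow> real) \<Rightarrow> complex \<times> complex \<Rightarrow> complex \<times> complex \<Rightarrow> complex \<times> complex" where
  "Jpm \<epsilon> F x u =
     (- \<epsilon> * 2 * F (zcoord x) * eta1 x u) *\<^sub>R Ez x
     + (\<epsilon> * (1 / (2 * F (zcoord x))) * dz x u) *\<^sub>R E1 x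
     - eta3 x u *\<^sub>R E2 x + eta2 x u *\<^sub>R E3 x"

definition omega_pm :: "real \<Rightarrow> (real \<Rightarrow> real) \<Rightarrow> (real \<Rightarrow> real)
    \<Rightarrow> complex \<times> complex \<Rightarrow> complex \<times> complex \<Rightarrow> complex \<times> complex \<Rightarrow> real" where
  "omega_pm \<epsilon> F C = fund_form (bmetric F C) (Jpm \<epsilon> F)"

definition vol_form :: "(real \<Rightarrow> real) \<Rightarrow> (real \<Rightarrow> real) \<Rightarrow> complex \<times> complex
    \<Rightarrow> complex \<times> complex \<Rightarrow> complex \<times> complex \<Rightarrow> complex \<times> complex \<Rightarrow> complex \<times> complex \<Rightarrow> real" where
  "vol_form F C x = vol_of (omega_pm 1 F C x)"

definition W_pm :: "real \<Rightarrow> (real \<Rightarrow> real) \<Rightarrow> (real \<Rightarrow> real) \<Rightarrow> complex \<times> complex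
    \<Rightarrow> complex \<times> complex \<Rightarrow> complex \<times> complex \<Rightarrow> complex \<times> complex \<Rightarrow> complex \<times> complex \<Rightarrow> real" where
  "W_pm \<epsilon> F C = Weyl_pm \<epsilon> (bmetric F C) (vol_form F C)"

definition Ricci_form :: "(real \<Rightarrow> real) \<Rightarrow> (real \<Rightarrow> real)
    \<Rightarrow> complex \<times> complex \<Rightarrow> complex \<times> complex \<Rightarrow> complex \<times> complex \<Rightarrow> real" where
  "Ricci_form F C x u v = Ric (bmetric F C) x (Jpm 1 F x u) v"

section \<open>Differential operators in the variable \<open>z\<close>\<close>

definition smooth_fun_on :: "real set \<Rightarrow> (real \<Rightarrow> real) \<Rightarrow> bool" where
  "smooth_fun_on I f \<longleftrightarrow> (\<forall>k. \<forall>z\<in>I. ((deriv ^^ k) f) differentiable (at z))"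

definition first_order_op :: "real \<Rightarrow> (real \<Rightarrow> real) \<Rightarrow> real \<Rightarrow> real" where
  "first_order_op c f z = c * deriv f z + f z"

definition Lop :: "real \<Rightarrow> (real \<Rightarrow> real) \<Rightarrow> real \<Rightarrow> real" where
  "Lop \<epsilon> f = first_order_op (- \<epsilon> / 2) (first_order_op (- \<epsilon>) f)"

definition Bop :: "(real \<Rightarrow> real) \<Rightarrow> real \<Rightarrow> real" where
  "Bop F z = (- 1/2 * deriv (deriv F) z + 3/2 * deriv F z + F z - 1) * (Lop 1 F z - 1)
     + deriv F z * deriv (Lop 1 F) z"

section \<open>Consistency with the usual description of the frame\<close>

lemma zcoord_chart: "p \<in> sphere 0 1 \<Longrightarrow> zcoord (chart z p) = z"
  by (simp add: zcoord_def chart_def)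

lemma domM_eq: "domM I = {x. x \<noteq> 0 \<and> zcoord x \<in> I}"
proof -
  have "x \<in> domM I" if "x \<noteq> 0" "zcoord x \<in> I" for x
  proof -
    have "x = (\<lambda>(z, p). chart z p) (zcoord x, x /\<^sub>R norm x)"
      using that(1) by (simp add: chart_def zcoord_def)
    moreover have "(zcoord x, x /\<^sub>R norm x) \<in> I \<times> sphere 0 1"
      using that by simp
    ultimately show ?thesis
      unfolding domM_def by (rule image_eqI)
  qed
  moreover have "x \<noteq> 0 \<and> zcoord x \<in> I" if "x \<in> domM I" for x
  proof -
    obtain z p where "z \<in> I" "p \<in> sphere 0 1" "x = chart z p"
      using \<open>x \<in> domM I\<close> by (auto simp: domM_def)
    moreover from this have "x \<noteq> 0" by (auto simp: chart_def)
    ultimately show ?thesis by (simp add: zcoord_chart)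
  qed
  ultimately show ?thesis by blast
qed

lemma chart_has_vector_derivative: "((\<lambda>t. chart t p) has_vector_derivative Ez (chart z p)) (at z)"
  unfolding chart_def Ez_def
  by (auto intro!: derivative_eq_intros simp: has_vector_derivative_def)

lemmas frame_simps = Ez_def E1_def E2_def E3_def dz_def eta1_def eta2_def eta3_def

lemma norm_sq_C2: "(norm (x :: complex \<times> complex))\<^sup>2
    = (Re (fst x))\<^sup>2 + (Im (fst x))\<^sup>2 + (Re (snd x))\<^sup>2 + (Im (snd x))\<^sup>2"
  unfolding power2_norm_eq_inner by (simp add: inner_prod_def inner_complex_def power2_eq_square)

lemma dual_frame:
  assumes "x \<noteq> 0"
  shows "dz x (Ez x) = 1" "dz x (E1 x) = 0" "dz x (E2 x) = 0" "dz x (E3 x) = 0"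
    "eta1 x (Ez x) = 0" "eta1 x (E1 x) = 1" "eta1 x (E2 x) = 0" "eta1 x (E3 x) = 0"
    "eta2 x (Ez x) = 0" "eta2 x (E1 x) = 0" "eta2 x (E2 x) = 1" "eta2 x (E3 x) = 0"
    "eta3 x (Ez x) = 0" "eta3 x (E1 x) = 0" "eta3 x (E2 x) = 0" "eta3 x (E3 x) = 1"
proof -
  have "(E1 x \<bullet> E1 x) = (norm x)\<^sup>2" "(E2 x \<bullet> E2 x) = (norm x)\<^sup>2" "(E3 x \<bullet> E3 x) = (norm x)\<^sup>2"
    "(Ez x \<bullet> Ez x) = (norm x)\<^sup>2"
    unfolding norm_sq_C2
    by (simp_all add: frame_simps inner_prod_def inner_complex_def power2_eq_square)
  then show "dz x (Ez x) = 1" "eta1 x (E1 x) = 1" "eta2 x (E2 x) = 1" "eta3 x (E3 x) = 1"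
    using assms by (simp_all add: dz_def eta1_def eta2_def eta3_def)
  have "Ez x \<bullet> E1 x = 0" "Ez x \<bullet> E2 x = 0" "Ez x \<bullet> E3 x = 0"
    "E1 x \<bullet> E2 x = 0" "E1 x \<bullet> E3 x = 0" "E2 x \<bullet> E3 x = 0"
    by (simp_all add: Ez_def E1_def E2_def E3_def inner_prod_def inner_complex_def)
  then show "dz x (E1 x) = 0" "dz x (E2 x) = 0" "dz x (E3 x) = 0"
    "eta1 x (Ez x) = 0" "eta1 x (E2 x) = 0" "eta1 x (E3 x) = 0"
    "eta2 x (Ez x) = 0" "eta2 x (E1 x) = 0" "eta2 x (E3 x) = 0"
    "eta3 x (Ez x) = 0" "eta3 x (E1 x) = 0" "eta3 x (E2 x) = 0"
    by (simp_all add: dz_def eta1_def eta2_def eta3_def inner_commute)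
qed

lemma dir_deriv_coform:
  fixes A :: "complex \<times> complex \<Rightarrow> complex \<times> complex"
  assumes "linear A" "x \<noteq> 0"
  shows "dir_deriv (\<lambda>y. (A y \<bullet> v) / (norm y)\<^sup>2) x u
     = ((A u \<bullet> v) * (norm x)\<^sup>2 - (A x \<bullet> v) * (2 * (x \<bullet> u))) / ((norm x)\<^sup>2)\<^sup>2"
proof -
  have A: "(A has_derivative A) (at x)"
    using assms(1) by (simp add: linear_imp_has_derivative)
  have "((\<lambda>y. (A y \<bullet> v) / (y \<bullet> y)) has_derivative
     (\<lambda>u. ((A u \<bullet> v) * (x \<bullet> x) - (A x \<bullet> v) * (2 * (x \<bullet> u))) / (x \<bullet> x)\<^sup>2)) (at x)"
    using assms(2)
    by (auto intro!: derivative_eq_intros A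
        simp: field_simps inner_commute power2_eq_square fun_eq_iff)
  from frechet_derivative_at[OF this, symmetric] show ?thesis
    unfolding dir_deriv_def power2_norm_eq_inner by simp
qed

lemma linear_E: "linear E1" "linear E2" "linear E3"
  unfolding E1_def E2_def E3_def
  by (rule linearI; simp add: prod_eq_iff complex_eq_iff distrib_left)+

lemma structure_equations:
  assumes "x \<noteq> 0"
  shows "ext_deriv1 eta1 x u v = - 2 * (eta2 x u * eta3 x v - eta2 x v * eta3 x u)"
    and "ext_deriv1 eta2 x u v = - 2 * (eta3 x u * eta1 x v - eta3 x v * eta1 x u)"
    and "ext_deriv1 eta3 x u v = - 2 * (eta1 x u * eta2 x v - eta1 x v * eta2 x u)"
proof -
  define n where "n = (norm x)\<^sup>2"
  have n: "n \<noteq> 0" "n = (Re (fst x))\<^sup>2 + (Im (fst x))\<^sup>2 + (Re (snd x))\<^sup>2 + (Im (snd x))\<^sup>2"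
    using assms by (simp_all add: n_def norm_sq_C2[symmetric])
  have *: "a / n\<^sup>2 - b / n\<^sup>2 = - 2 * (p / n * (q / n) - r / n * (s / n))"
    if "a - b = - 2 * (p * q - r * s)" for a b p q r s :: real
    using n(1) that by (simp add: field_simps power2_eq_square)
  show "ext_deriv1 eta1 x u v = - 2 * (eta2 x u * eta3 x v - eta2 x v * eta3 x u)"
    unfolding ext_deriv1_def eta1_def eta2_def eta3_def dir_deriv_coform[OF linear_E(1) assms]
      n_def[symmetric]
    by (rule *, unfold n(2))
      (simp add: E1_def E2_def E3_def inner_prod_def inner_complex_def power2_eq_square algebra_simps)
  show "ext_deriv1 eta2 x u v = - 2 * (eta3 x u * eta1 x v - eta3 x v * eta1 x u)"
    unfolding ext_deriv1_def eta1_def eta2_def eta3_def dir_deriv_coform[OF linear_E(2) assms]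
      n_def[symmetric]
    by (rule *, unfold n(2))
      (simp add: E1_def E2_def E3_def inner_prod_def inner_complex_def power2_eq_square algebra_simps)
  show "ext_deriv1 eta3 x u v = - 2 * (eta1 x u * eta2 x v - eta1 x v * eta2 x u)"
    unfolding ext_deriv1_def eta1_def eta2_def eta3_def dir_deriv_coform[OF linear_E(3) assms]
      n_def[symmetric]
    by (rule *, unfold n(2))
      (simp add: E1_def E2_def E3_def inner_prod_def inner_complex_def power2_eq_square algebra_simps)
qed

end

theory Submission
  imports Defs
begin

text \<open>Every tensor field in the statement is built from \<open>F\<close>, \<open>C\<close> and the left-invariant frame
  \<open>X\<^sub>0 = \<partial>/\<partial>z, X\<^sub>1, X\<^sub>2, X\<^sub>3\<close>, so its frame components are functions of \<open>z\<close> alone, and each claim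
  reduces to identities between rational functions of \<open>F\<close>, \<open>C\<close> and their derivatives. The work lies in
  passing from the definitions, which differentiate with respect to constant vectors of the chart, to
  the frame.

  In the chart the frame fields are the right multiplications \<open>x \<mapsto> x q\<close> of the quaternions by \<open>1, i, j, k\<close>.
  The Euclidean derivative \<open>D\<close> of one frame field along another is therefore a frame field up to sign, with
  the constant coefficients \<open>flat_coeff\<close>. A tensor field with components \<open>t(z)\<close> is written
  \<open>tensor (t (zcoord x)) x vs\<close>, for arguments \<open>vs\<close> of any number. Differentiating it with respect to
  constant vectors gives the \<open>z\<close>-derivative of the components corrected by \<open>flat_coeff\<close>
  (\<open>dir_deriv_tensor\<close>). The Christoffel symbol of \<open>g\<close> in the chart is the Levi-Civita connection in the
  frame, \<open>conn_coeff\<close>, minus the same \<open>flat_coeff\<close> (\<open>christoffel_eq\<close>), so that the two occurrences of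
  \<open>flat_coeff\<close> cancel and \<open>\<nabla>\<close> acts on components by \<open>z\<close>-derivatives and \<open>conn_coeff\<close> only (\<open>cov_tensor\<close>).
  Metric traces are weighted sums over the orthogonal frame (\<open>mtrace_frame\<close>).

  The curvature components (\<open>Rm_tensor\<close>) give the Ricci tensor and the scalar curvature, hence (i) and (ii).
  Subtracting the Schouten part leaves the Weyl tensor, which is
  \<open>(\<L>\<^sup>+F - 1) T\<^sup>+ + (\<L>\<^sup>-F - 1) T\<^sup>-\<close> for two explicit tensors \<open>T\<^sup>\<plusminus>\<close> of type D (\<open>Weyl_tensor\<close>). As \<open>T\<^sup>\<plusminus>\<close> is a
  combination of squares of (anti-)self-dual forms, the projections of the Weyl tensor can be read off,
  which gives (iii). The divergence of a multiple \<open>u T\<^sup>\<plusminus>\<close> is the contraction of \<open>T\<^sup>\<plusminus>\<close> with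
  \<open>((\<plusminus>3/2 + C'/2C) u + u') \<partial>/\<partial>z\<close>, up to the factor \<open>4F/C\<close> (\<open>divergence_components\<close>); with \<open>u = \<L>\<^sup>\<plusminus>F - 1\<close>
  this is (iv). Since \<open>\<nabla>\<close> commutes with traces, the double divergence in the Bach tensor is the divergence
  of this known 3-tensor, and (v) is the resulting identity of components. Finally, one component of
  \<open>\<nabla>J\<^sup>+ = 0\<close> says \<open>C' = - C\<close>, and (vi) is (i) and the Ricci tensor for such \<open>C\<close>.\<close>

section \<open>The left-invariant frame\<close>

type_synonym point = "complex \<times> complex"

datatype ix = I0 | I1 | I2 | I3

lemma UNIV_ix: "UNIV = {I0, I1, I2, I3}"
  using ix.exhaust by blast

instance ix :: finite
  by standard (simp add: UNIV_ix)

lemma sum_ix: "(\<Sum>i\<in>UNIV. f i) = f I0 + f I1 + f I2 + f I3" for f :: "ix \<Rightarrow> 'a::comm_monoid_add"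
  by (simp add: UNIV_ix ac_simps)

primrec frame :: "ix \<Rightarrow> point \<Rightarrow> point" where
  "frame I0 = Ez" | "frame I1 = E1" | "frame I2 = E2" | "frame I3 = E3"

primrec coframe :: "ix \<Rightarrow> point \<Rightarrow> point \<Rightarrow> real" where
  "coframe I0 = dz" | "coframe I1 = eta1" | "coframe I2 = eta2" | "coframe I3 = eta3"

text \<open>The multiplication table of the quaternions: \<open>D\<^sub>X\<^sub>a X\<^sub>b = \<Sum>\<^sub>c flat_coeff a b c X\<^sub>c\<close> for the Euclidean
  derivative \<open>D\<close>, because \<open>X\<^sub>b\<close> is a right multiplication and \<open>(x a) b = x (a b)\<close>.\<close>

fun flat_coeff :: "ix \<Rightarrow> ix \<Rightarrow> ix \<Rightarrow> real" where
  "flat_coeff I0 b c = (if b = c then 1 else 0)"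
| "flat_coeff a I0 c = (if a = c then 1 else 0)"
| "flat_coeff I2 I3 c = (if c = I1 then 1 else 0)"
| "flat_coeff I3 I2 c = (if c = I1 then - 1 else 0)"
| "flat_coeff I3 I1 c = (if c = I2 then 1 else 0)"
| "flat_coeff I1 I3 c = (if c = I2 then - 1 else 0)"
| "flat_coeff I1 I2 c = (if c = I3 then 1 else 0)"
| "flat_coeff I2 I1 c = (if c = I3 then - 1 else 0)"
| "flat_coeff a b c = (if c = I0 then - 1 else 0)"

lemma coframe_inner: "coframe i x v = (frame i x \<bullet> v) / (norm x)\<^sup>2"
  by (cases i) (simp_all add: dz_def eta1_def eta2_def eta3_def)

lemma linear_frame: "linear (frame i)"
  using linear_E linear_id by (cases i) (simp_all add: Ez_def[abs_def] id_def)

lemma coframe_frame: "x \<noteq> 0 \<Longrightarrow> coframe i x (frame j x) = (if i = j then 1 else 0)"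
  by (cases i; cases j; simp add: dual_frame)

lemma linear_coframe: "linear (coframe i x)"
  by (rule linearI) (simp_all add: coframe_inner inner_add_right add_divide_distrib)

lemmas coframe_linear_simps =
  linear_add[OF linear_coframe] linear_diff[OF linear_coframe]
  linear_neg[OF linear_coframe] linear_scale[OF linear_coframe] linear_sum[OF linear_coframe]

text \<open>The frame fields are orthogonal of the same length for the Euclidean inner product.\<close>

lemma frame_expansion:
  assumes "x \<noteq> 0" shows "v = (\<Sum>i\<in>UNIV. coframe i x v *\<^sub>R frame i x)"
proof -
  obtain a b c d where x: "x = (Complex a b, Complex c d)" by (metis surj_pair complex.exhaust_sel)
  obtain a' b' c' d' where v: "v = (Complex a' b', Complex c' d')" by (metis surj_pair complex.exhaust_sel)
  define n where "n = (norm x)\<^sup>2"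
  have n: "n = a^2 + b^2 + c^2 + d^2" by (simp add: n_def norm_sq_C2 x)
  have "n \<noteq> 0" using assms by (simp add: n_def)
  have "n *\<^sub>R v = (\<Sum>i\<in>UNIV. (frame i x \<bullet> v) *\<^sub>R frame i x)"
    unfolding sum_ix n
    by (simp add: x v frame_simps prod_eq_iff complex_eq_iff inner_prod_def inner_complex_def)
       (simp add: power2_eq_square algebra_simps)
  then have "v = (1/n) *\<^sub>R (\<Sum>i\<in>UNIV. (frame i x \<bullet> v) *\<^sub>R frame i x)"
    using \<open>n \<noteq> 0\<close> by (metis divide_self_if divide_inverse mult.commute mult_1 scaleR_one scaleR_scaleR)
  then show ?thesis unfolding coframe_inner n_def[symmetric] by (simp add: scaleR_sum_right)
qed

lemma coframe_frame_sum: "x \<noteq> 0 \<Longrightarrow> coframe k x (\<Sum>c\<in>UNIV. f c *\<^sub>R frame c x) = f k"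
  by (simp add: coframe_linear_simps coframe_frame if_distrib[of "\<lambda>t. _ * t"] cong: if_cong)

lemma coframe_inject:
  assumes "x \<noteq> 0" "\<And>i. coframe i x u = coframe i x v" shows "u = v"
  by (metis (no_types, lifting) assms frame_expansion sum.cong)

lemma frame_frame: "frame b (frame a x) = (\<Sum>c\<in>UNIV. flat_coeff a b c *\<^sub>R frame c x)"
  by (cases a; cases b; simp add: sum_ix frame_simps prod_eq_iff complex_eq_iff)

text \<open>As \<^term>\<open>frame k\<close> is linear, \<^term>\<open>frame k s\<close> is its derivative in the direction \<open>s\<close>.\<close>

lemma frame_apply:
  assumes "x \<noteq> 0"
  shows "frame k s = (\<Sum>c\<in>UNIV. (\<Sum>a\<in>UNIV. coframe a x s * flat_coeff a k c) *\<^sub>R frame c x)"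
proof -
  have "frame k s = frame k (\<Sum>a\<in>UNIV. coframe a x s *\<^sub>R frame a x)"
    using frame_expansion[OF assms] by simp
  also have "\<dots> = (\<Sum>a\<in>UNIV. coframe a x s *\<^sub>R (\<Sum>c\<in>UNIV. flat_coeff a k c *\<^sub>R frame c x))"
    by (simp add: linear_sum[OF linear_frame] linear_scale[OF linear_frame] frame_frame)
  also have "\<dots> = (\<Sum>c\<in>UNIV. (\<Sum>a\<in>UNIV. coframe a x s * flat_coeff a k c) *\<^sub>R frame c x)"
    by (simp add: scaleR_sum_right scaleR_sum_left) (rule sum.swap)
  finally show ?thesis .
qed

definition bilin :: "(ix \<Rightarrow> ix \<Rightarrow> ix \<Rightarrow> real) \<Rightarrow> point \<Rightarrow> point \<Rightarrow> point \<Rightarrow> point" where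
  "bilin B x u v = (\<Sum>k\<in>UNIV. (\<Sum>a\<in>UNIV. coframe a x u * (\<Sum>b\<in>UNIV. coframe b x v * B a b k)) *\<^sub>R frame k x)"

lemma coframe_bilin:
  "x \<noteq> 0 \<Longrightarrow> coframe k x (bilin B x u v) = (\<Sum>a\<in>UNIV. coframe a x u * (\<Sum>b\<in>UNIV. coframe b x v * B a b k))"
  by (simp add: bilin_def coframe_linear_simps coframe_frame if_distrib[of "\<lambda>t. _ * t"] cong: if_cong)

lemma zcoord_has_derivative:
  assumes "x \<noteq> 0" shows "(zcoord has_derivative dz x) (at x)"
proof -
  have "(norm has_derivative (\<lambda>s. sgn x \<bullet> s)) (at x)"
    using has_derivative_norm[OF assms] by (simp add: inner_commute)
  then have "((\<lambda>y. ln (norm y)) has_derivative (\<lambda>s. (sgn x \<bullet> s) * inverse (norm x))) (at x)"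
    using assms by (auto intro!: derivative_eq_intros)
  then show ?thesis unfolding zcoord_def[abs_def]
    by (rule has_derivative_eq_rhs)
       (simp add: fun_eq_iff dz_def Ez_def sgn_div_norm power2_eq_square divide_inverse)
qed

text \<open>The forms are dual to the frame, hence a derivative that falls on a form is minus the one that falls
  on the frame.\<close>

lemma coframe_has_derivative:
  assumes "x \<noteq> 0"
  shows "((\<lambda>y. coframe i y v) has_derivative (\<lambda>s. - coframe i x (bilin flat_coeff x s v))) (at x)"
proof -
  have A: "(frame i has_derivative frame i) (at x)"
    by (simp add: linear_imp_has_derivative linear_frame)
  have n: "(norm x)\<^sup>2 = x \<bullet> x" "x \<bullet> x \<noteq> 0" using assms by (simp_all add: power2_norm_eq_inner)
  have "((\<lambda>y. (frame i y \<bullet> v) / (y \<bullet> y)) has_derivative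
     (\<lambda>s. (frame i s \<bullet> v) / (x \<bullet> x) - 2 * ((frame i x \<bullet> v) / (x \<bullet> x)) * ((frame I0 x \<bullet> s) / (x \<bullet> x)))) (at x)"
    using assms
    by (auto intro!: derivative_eq_intros A
        simp: field_simps inner_commute power2_eq_square fun_eq_iff Ez_def)
  then have 1: "(f has_derivative (\<lambda>s. (frame i s \<bullet> v) / (x \<bullet> x) - 2 * coframe i x v * coframe I0 x s)) (at x)"
    if "f = (\<lambda>y. (frame i y \<bullet> v) / (y \<bullet> y))" for f
    using that by (simp only: coframe_inner n(1))
  have 2: "(frame i s \<bullet> v) / (x \<bullet> x) = (\<Sum>c\<in>UNIV. (\<Sum>a\<in>UNIV. coframe a x s * flat_coeff a i c) * coframe c x v)" for s
    by (subst frame_apply[OF assms]) (simp add: inner_sum_left sum_divide_distrib coframe_inner n(1))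
  have 3: "(frame i s \<bullet> v) / (x \<bullet> x) - 2 * coframe i x v * coframe I0 x s = - coframe i x (bilin flat_coeff x s v)" for s
    unfolding 2 coframe_bilin[OF assms]
    by (cases i) (simp_all add: sum_ix algebra_simps del: coframe.simps)
  show ?thesis using 1 unfolding 3 by (simp add: coframe_inner[of i _ v] power2_norm_eq_inner)
qed

section \<open>Tensor fields whose components depend on z only\<close>

text \<open>Recursion over the list of arguments treats all ranks at once, so that the rule of differentiation
  is a single induction. The components \<open>t\<close> are indexed by multi-indices of the same length.\<close>

primrec tensor :: "(ix list \<Rightarrow> real) \<Rightarrow> point \<Rightarrow> point list \<Rightarrow> real" where
  "tensor t x [] = t []"
| "tensor t x (v # vs) = (\<Sum>i\<in>UNIV. coframe i x v * tensor (\<lambda>is. t (i # is)) x vs)"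

text \<open>The derivation by which an endomorphism with matrix \<open>A\<close> acts on components.\<close>

primrec slot_action :: "(ix \<Rightarrow> ix \<Rightarrow> real) \<Rightarrow> (ix list \<Rightarrow> real) \<Rightarrow> ix list \<Rightarrow> real" where
  "slot_action A t [] = 0"
| "slot_action A t (i # is) = (\<Sum>m\<in>UNIV. A i m * t (m # is)) + slot_action A (\<lambda>is. t (i # is)) is"

text \<open>The same derivation acting on the arguments. With \<open>L\<close> the Christoffel symbol in a fixed direction this is
  the correction term of a covariant derivative.\<close>

primrec slot_sum :: "('a \<Rightarrow> 'a) \<Rightarrow> ('a list \<Rightarrow> real) \<Rightarrow> 'a list \<Rightarrow> real" where
  "slot_sum L T [] = 0"
| "slot_sum L T (v # vs) = T (L v # vs) + slot_sum L (\<lambda>vs. T (v # vs)) vs"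

text \<open>The components of \<open>\<nabla>t\<close>, with the index of differentiation first, for the connection
  \<open>\<nabla>\<^sub>X\<^sub>a X\<^sub>b = \<Sum>\<^sub>c G a b c X\<^sub>c\<close>; here \<open>t'\<close> is the derivative of \<open>t\<close> with respect to \<open>z\<close>, and only \<open>X\<^sub>0\<close> differentiates
  functions of \<open>z\<close>.\<close>

definition cov_comps :: "(ix \<Rightarrow> ix \<Rightarrow> ix \<Rightarrow> real) \<Rightarrow> (ix list \<Rightarrow> real) \<Rightarrow> (ix list \<Rightarrow> real) \<Rightarrow> ix list \<Rightarrow> real" where
  "cov_comps G t' t is = (if hd is = I0 then t' (tl is) else 0) - slot_action (G (hd is)) t (tl is)"

lemma tensor_cong:
  "(\<And>is. length is = length vs \<Longrightarrow> t is = t' is) \<Longrightarrow> tensor t x vs = tensor t' x vs"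
proof (induction vs arbitrary: t t')
  case (Cons v vs)
  show ?case unfolding tensor.simps
    by (rule sum.cong[OF refl], rule arg_cong[where f = "(*) _"], rule Cons.IH, rule Cons.prems) simp
qed simp

lemma tensor_add: "tensor (\<lambda>is. t is + t' is) x vs = tensor t x vs + tensor t' x vs"
  by (induction vs arbitrary: t t') (simp_all add: distrib_left sum.distrib)

lemma tensor_scale: "tensor (\<lambda>is. c * t is) x vs = c * tensor t x vs"
  by (induction vs arbitrary: t) (simp_all add: sum_distrib_left ac_simps)

lemma tensor_minus: "tensor (\<lambda>is. - t is) x vs = - tensor t x vs"
  using tensor_scale[of "-1"] by simp

lemma tensor_diff: "tensor (\<lambda>is. t is - t' is) x vs = tensor t x vs - tensor t' x vs"
  using tensor_add[of t "\<lambda>is. - t' is"] by (simp add: tensor_minus)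

lemma tensor_zero: "tensor (\<lambda>is. 0) x vs = 0"
  using tensor_scale[of 0 "\<lambda>_. 0" x vs] by simp

lemma tensor_sum: "tensor (\<lambda>is. \<Sum>m\<in>M. t m is) x vs = (\<Sum>m\<in>M. tensor (t m) x vs)"
  by (induction M rule: infinite_finite_induct) (simp_all add: tensor_zero tensor_add)

lemma tensor_frame:
  "x \<noteq> 0 \<Longrightarrow> tensor t x (frame a x # vs) = tensor (\<lambda>is. t (a # is)) x vs"
  by (simp add: coframe_frame if_distrib[of "\<lambda>t. t * _"] cong: if_cong)

lemma slot_action_diff: "slot_action (\<lambda>i m. A i m - B i m) t is = slot_action A t is - slot_action B t is"
  by (induction "is" arbitrary: t) (simp_all add: algebra_simps sum_subtractf)

lemma slot_action_sum: "slot_action (\<lambda>i m. \<Sum>a\<in>UNIV. c a * A a i m) t is = (\<Sum>a\<in>UNIV. c a * slot_action (A a) t is)"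
proof (induction "is" arbitrary: t)
  case (Cons i "is")
  have "(\<Sum>m\<in>UNIV. (\<Sum>a\<in>UNIV. c a * A a i m) * t (m # is))
      = (\<Sum>a\<in>UNIV. c a * (\<Sum>m\<in>UNIV. A a i m * t (m # is)))"
    by (simp add: sum_distrib_left sum_distrib_right mult.assoc) (rule sum.swap)
  then show ?case by (simp add: Cons distrib_left sum.distrib)
qed simp

lemma slot_sum_linear: "slot_sum L (\<lambda>vs. \<Sum>i\<in>M. c i * T i vs) vs = (\<Sum>i\<in>M. c i * slot_sum L (T i) vs)"
  by (induction vs arbitrary: T) (simp_all add: distrib_left sum.distrib)

lemma slot_sum_tensor_endo:
  assumes "\<And>i v. coframe i x (L v) = (\<Sum>m\<in>UNIV. coframe m x v * A m i)"
  shows "slot_sum L (tensor t x) vs = tensor (slot_action A t) x vs"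
proof (induction vs arbitrary: t)
  case (Cons v vs)
  have "tensor t x (L v # vs) = (\<Sum>i\<in>UNIV. coframe i x v * tensor (\<lambda>is. \<Sum>m\<in>UNIV. A i m * t (m # is)) x vs)"
    by (simp add: assms tensor_sum tensor_scale sum_distrib_left sum_distrib_right mult.assoc) (rule sum.swap)
  then show ?case
    by (simp add: slot_sum_linear Cons tensor_add distrib_left sum.distrib)
qed simp

lemma slot_sum_tensor:
  assumes "x \<noteq> 0"
  shows "slot_sum (bilin B x s) (tensor t x) vs = tensor (\<lambda>is. slot_action (B (hd is)) t (tl is)) x (s # vs)"
proof -
  have "slot_sum (bilin B x s) (tensor t x) vs = tensor (slot_action (\<lambda>m i. \<Sum>a\<in>UNIV. coframe a x s * B a m i) t) x vs"
    by (rule slot_sum_tensor_endo, simp add: coframe_bilin[OF assms] sum_distrib_left)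
       (subst sum.swap, simp add: mult.left_commute)
  also have "slot_action (\<lambda>m i. \<Sum>a\<in>UNIV. coframe a x s * B a m i) t
      = (\<lambda>is. \<Sum>a\<in>UNIV. coframe a x s * slot_action (B a) t is)"
    by (rule ext, rule slot_action_sum)
  finally show ?thesis by (simp add: tensor_sum tensor_scale)
qed

text \<open>The arguments \<open>vs\<close> are constant, so the derivative falls on the components, through \<open>z\<close>, and on the
  coframe.\<close>

lemma tensor_has_derivative:
  assumes "x \<noteq> 0"
    and "\<And>is. length is = length vs \<Longrightarrow> ((\<lambda>z. t z is) has_real_derivative t' is) (at (zcoord x))"
  shows "((\<lambda>y. tensor (t (zcoord y)) y vs) has_derivative
     (\<lambda>s. dz x s * tensor t' x vs - slot_sum (bilin flat_coeff x s) (tensor (t (zcoord x)) x) vs)) (at x)"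
  using assms(2)
proof (induction vs arbitrary: t t')
  case Nil
  have "((\<lambda>z. t z []) has_derivative (\<lambda>h. t' [] * h)) (at (zcoord x))"
    using Nil[of "[]"] by (simp add: has_field_derivative_def)
  from has_derivative_compose[OF zcoord_has_derivative[OF assms(1)] this]
  show ?case by (simp add: mult.commute)
next
  case (Cons v vs)
  have IH: "((\<lambda>y. tensor (\<lambda>is. t (zcoord y) (i # is)) y vs) has_derivative
     (\<lambda>s. dz x s * tensor (\<lambda>is. t' (i # is)) x vs
       - slot_sum (bilin flat_coeff x s) (tensor (\<lambda>is. t (zcoord x) (i # is)) x) vs)) (at x)" for i
    using Cons.IH[of "\<lambda>z is. t z (i # is)" "\<lambda>is. t' (i # is)"] Cons.prems by simp
  have "((\<lambda>y. tensor (t (zcoord y)) y (v # vs)) has_derivative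
     (\<lambda>s. \<Sum>i\<in>UNIV. coframe i x v * (dz x s * tensor (\<lambda>is. t' (i # is)) x vs
       - slot_sum (bilin flat_coeff x s) (tensor (\<lambda>is. t (zcoord x) (i # is)) x) vs)
       + - coframe i x (bilin flat_coeff x s v) * tensor (\<lambda>is. t (zcoord x) (i # is)) x vs)) (at x)"
    unfolding tensor.simps
    by (intro has_derivative_sum has_derivative_mult coframe_has_derivative[OF assms(1)] IH)
  then show ?case
    by (rule has_derivative_eq_rhs)
       (simp add: fun_eq_iff slot_sum_linear sum.distrib sum_subtractf sum_negf right_diff_distrib
          sum_distrib_left mult.left_commute)
qed

lemma dir_deriv_eqI: "(f has_derivative f') (at x) \<Longrightarrow> dir_deriv f x s = f' s"
  by (simp add: dir_deriv_def frechet_derivative_at[symmetric])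

lemma tensor_has_derivative_flat:
  assumes "x \<noteq> 0"
    and "\<And>is. length is = length vs \<Longrightarrow> ((\<lambda>z. t z is) has_real_derivative t' is) (at (zcoord x))"
  shows "((\<lambda>y. tensor (t (zcoord y)) y vs) has_derivative
     (\<lambda>s. tensor (cov_comps flat_coeff t' (t (zcoord x))) x (s # vs))) (at x)"
proof -
  have 2: "tensor (\<lambda>is. (if i = I0 then t' is else 0) - slot_action (G i) u is) x vs
     = (if i = I0 then tensor t' x vs else 0) - tensor (slot_action (G i) u) x vs" for G i u
    by (simp add: tensor_diff tensor_zero)
  have "dz x s * tensor t' x vs - slot_sum (bilin flat_coeff x s) (tensor (t (zcoord x)) x) vs
      = tensor (cov_comps flat_coeff t' (t (zcoord x))) x (s # vs)" for s
    unfolding slot_sum_tensor[OF assms(1)] tensor.simps cov_comps_def list.sel 2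
    by (simp add: right_diff_distrib sum_subtractf sum_ix)
  then show ?thesis
    using tensor_has_derivative[of x vs t t', OF assms] by presburger
qed

lemma dir_deriv_tensor:
  assumes x: "x \<in> U" "open U" "x \<noteq> 0"
    and T: "\<And>y. y \<in> U \<Longrightarrow> f y = tensor (t (zcoord y)) y vs"
    and t: "\<And>is. length is = length vs \<Longrightarrow> ((\<lambda>z. t z is) has_real_derivative t' is) (at (zcoord x))"
  shows "dir_deriv f x s = tensor (cov_comps flat_coeff t' (t (zcoord x))) x (s # vs)"
proof -
  have d: "((\<lambda>y. tensor (t (zcoord y)) y vs) has_derivative
     (\<lambda>s. tensor (cov_comps flat_coeff t' (t (zcoord x))) x (s # vs))) (at x)"
    using x(3) t by (rule tensor_has_derivative_flat)
  have "(f has_derivative (\<lambda>s. tensor (cov_comps flat_coeff t' (t (zcoord x))) x (s # vs))) (at x)"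
    using d x(2,1) T[symmetric] by (rule has_derivative_transform_within_open)
  then show ?thesis by (rule dir_deriv_eqI)
qed

text \<open>If the Christoffel symbol of the chart has the components \<open>G - flat_coeff\<close>, its correction terms and
  those of \<open>dir_deriv_tensor\<close> add up to the ones of \<open>G\<close>: the covariant derivative can be computed in the
  frame.\<close>

lemma cov_tensor:
  assumes "x \<in> U" "open U" "x \<noteq> 0"
    and "\<And>y. y \<in> U \<Longrightarrow> f y = tensor (t (zcoord y)) y vs"
    and "\<And>is. length is = length vs \<Longrightarrow> ((\<lambda>z. t z is) has_real_derivative t' is) (at (zcoord x))"
  shows "dir_deriv f x s - slot_sum (bilin (\<lambda>a b c. G a b c - flat_coeff a b c) x s) (tensor (t (zcoord x)) x) vs
    = tensor (cov_comps G t' (t (zcoord x))) x (s # vs)"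
proof -
  have "dir_deriv f x s = tensor (cov_comps flat_coeff t' (t (zcoord x))) x (s # vs)"
    using assms by (rule dir_deriv_tensor)
  then show ?thesis
    unfolding slot_sum_tensor[OF assms(3)] tensor_diff[symmetric]
    by (simp only: tensor_diff[symmetric]) (rule tensor_cong, simp add: cov_comps_def slot_action_diff)
qed

lemma linear_tensor: "linear (\<lambda>s. tensor t x (us @ s # vs))"
proof (induction us arbitrary: t)
  case Nil
  show ?case
    by (rule linearI) (simp_all add: coframe_linear_simps distrib_right sum.distrib sum_distrib_left mult.assoc)
next
  case (Cons u us)
  show ?case unfolding append_Cons tensor.simps
    by (intro linear_compose_sum ballI linear_compose_scale_right[of "\<lambda>s. tensor _ x (us @ s # vs)", unfolded real_scaleR_def] Cons)
qed

lemma tensor_swap: "tensor t x (u # v # ws) = tensor (\<lambda>is. t (hd (tl is) # hd is # tl (tl is))) x (v # u # ws)"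
  by (simp add: sum_distrib_left) (subst sum.swap, simp add: mult.left_commute)

text \<open>Stated for two arbitrary slots, because a trace may pair any two of them.\<close>

lemma bilinear_tensor: "bilinear (\<lambda>s t. tensor \<tau> x (us @ s # vs @ t # ws))"
  unfolding bilinear_def
proof (intro conjI allI)
  show "linear (\<lambda>t. tensor \<tau> x (us @ s # vs @ t # ws))" for s
    using linear_tensor[of \<tau> x "us @ s # vs"] by (simp only: append_assoc append_Cons)
  show "linear (\<lambda>s. tensor \<tau> x (us @ s # vs @ t # ws))" for t
    by (rule linear_tensor)
qed

lemma bilinear_swap: "bilinear b \<Longrightarrow> bilinear (\<lambda>s t. b t s)"
  by (simp add: bilinear_def)

definition comps2 :: "(ix \<Rightarrow> ix \<Rightarrow> real) \<Rightarrow> ix list \<Rightarrow> real" where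
  "comps2 f is = f (is ! 0) (is ! 1)"
definition comps3 :: "(ix \<Rightarrow> ix \<Rightarrow> ix \<Rightarrow> real) \<Rightarrow> ix list \<Rightarrow> real" where
  "comps3 f is = f (is ! 0) (is ! 1) (is ! 2)"
definition comps4 :: "(ix \<Rightarrow> ix \<Rightarrow> ix \<Rightarrow> ix \<Rightarrow> real) \<Rightarrow> ix list \<Rightarrow> real" where
  "comps4 f is = f (is ! 0) (is ! 1) (is ! 2) (is ! 3)"

lemma comps_simps [simp]: "comps2 f [a, b] = f a b" "comps3 f' [a, b, c] = f' a b c" "comps4 f'' [a, b, c, d] = f'' a b c d"
  by (simp_all add: comps2_def comps3_def comps4_def)

lemma tensor_rotate: "tensor t x [w, u, v] = tensor (\<lambda>is. t [is ! 2, is ! 0, is ! 1]) x [u, v, w]"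
proof -
  have "tensor t x [w, u, v] = (\<Sum>a\<in>UNIV. coframe a x u * tensor (\<lambda>is. t (hd is # a # tl is)) x [w, v])"
    by (subst tensor_swap) simp
  also have "\<dots> = (\<Sum>a\<in>UNIV. coframe a x u * tensor (\<lambda>is. t (hd (tl is) # a # [hd is])) x [v, w])"
    by (subst tensor_swap) simp
  finally show ?thesis by simp
qed

lemma tensor_last_slot: "tensor (comps3 f) x [u, v, w] = (\<Sum>c\<in>UNIV. coframe c x w *
    (\<Sum>a\<in>UNIV. coframe a x u * (\<Sum>b\<in>UNIV. coframe b x v * f a b c)))"
  using tensor_rotate[of "comps3 (\<lambda>c a b. f a b c)" x w u v] by (simp add: comps3_def)

section \<open>The metric and its Levi-Civita connection\<close>

fun metric_coeff :: "(real \<Rightarrow> real) \<Rightarrow> (real \<Rightarrow> real) \<Rightarrow> real \<Rightarrow> ix \<Rightarrow> real" where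
  "metric_coeff F C z I0 = C z / (4 * F z)"
| "metric_coeff F C z I1 = C z * F z"
| "metric_coeff F C z I2 = C z"
| "metric_coeff F C z I3 = C z"

text \<open>Here and below, a prime in the name of a function of \<open>z\<close> marks its derivative.\<close>

fun metric_coeff' :: "(real \<Rightarrow> real) \<Rightarrow> (real \<Rightarrow> real) \<Rightarrow> real \<Rightarrow> ix \<Rightarrow> real" where
  "metric_coeff' F C z I0 = deriv C z / (4 * F z) - C z * deriv F z / (4 * (F z)\<^sup>2)"
| "metric_coeff' F C z I1 = deriv C z * F z + C z * deriv F z"
| "metric_coeff' F C z I2 = deriv C z"
| "metric_coeff' F C z I3 = deriv C z"

definition dlog :: "(real \<Rightarrow> real) \<Rightarrow> real \<Rightarrow> real" where
  "dlog f z = deriv f z / f z"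

definition dlog' :: "(real \<Rightarrow> real) \<Rightarrow> real \<Rightarrow> real" where
  "dlog' f z = deriv (deriv f) z / f z - (dlog f z)\<^sup>2"

text \<open>The coefficients \<open>\<nabla>\<^sub>X\<^sub>a X\<^sub>b = \<Sum>\<^sub>c conn_coeff a b c X\<^sub>c\<close> of the Levi-Civita connection, as given by the
  Koszul formula for the diagonal metric \<^const>\<open>metric_coeff\<close> and the brackets \<open>[X\<^sub>1, X\<^sub>2] = 2 X\<^sub>3\<close> and cyclic
  permutations.\<close>

primrec conn_coeff :: "(real \<Rightarrow> real) \<Rightarrow> (real \<Rightarrow> real) \<Rightarrow> real \<Rightarrow> ix \<Rightarrow> ix \<Rightarrow> ix \<Rightarrow> real" where
  "conn_coeff F C z I0 = (\<lambda>b c. if b = c then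
        (case b of I0 \<Rightarrow> (dlog C z - dlog F z) / 2 | I1 \<Rightarrow> (dlog C z + dlog F z) / 2 | _ \<Rightarrow> dlog C z / 2) else 0)"
| "conn_coeff F C z I1 = (\<lambda>b c. case b of
        I0 \<Rightarrow> if c = I1 then (dlog C z + dlog F z) / 2 else 0
      | I1 \<Rightarrow> if c = I0 then - 2 * (F z)\<^sup>2 * dlog C z - 2 * F z * deriv F z else 0
      | I2 \<Rightarrow> if c = I3 then 2 - F z else 0
      | I3 \<Rightarrow> if c = I2 then F z - 2 else 0)"
| "conn_coeff F C z I2 = (\<lambda>b c. case b of
        I0 \<Rightarrow> if c = I2 then dlog C z / 2 else 0
      | I1 \<Rightarrow> if c = I3 then - F z else 0
      | I2 \<Rightarrow> if c = I0 then - 2 * F z * dlog C z else 0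
      | I3 \<Rightarrow> if c = I1 then 1 else 0)"
| "conn_coeff F C z I3 = (\<lambda>b c. case b of
        I0 \<Rightarrow> if c = I3 then dlog C z / 2 else 0
      | I1 \<Rightarrow> if c = I2 then F z else 0
      | I2 \<Rightarrow> if c = I1 then - 1 else 0
      | I3 \<Rightarrow> if c = I0 then - 2 * F z * dlog C z else 0)"

primrec conn_coeff' :: "(real \<Rightarrow> real) \<Rightarrow> (real \<Rightarrow> real) \<Rightarrow> real \<Rightarrow> ix \<Rightarrow> ix \<Rightarrow> ix \<Rightarrow> real" where
  "conn_coeff' F C z I0 = (\<lambda>b c. if b = c then
        (case b of I0 \<Rightarrow> (dlog' C z - dlog' F z) / 2 | I1 \<Rightarrow> (dlog' C z + dlog' F z) / 2 | _ \<Rightarrow> dlog' C z / 2) else 0)"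
| "conn_coeff' F C z I1 = (\<lambda>b c. case b of
        I0 \<Rightarrow> if c = I1 then (dlog' C z + dlog' F z) / 2 else 0
      | I1 \<Rightarrow> if c = I0 then - 2 * (F z)\<^sup>2 * dlog' C z - 4 * F z * deriv F z * dlog C z
           - 2 * (deriv F z)\<^sup>2 - 2 * F z * deriv (deriv F) z else 0
      | I2 \<Rightarrow> if c = I3 then - deriv F z else 0
      | I3 \<Rightarrow> if c = I2 then deriv F z else 0)"
| "conn_coeff' F C z I2 = (\<lambda>b c. case b of
        I0 \<Rightarrow> if c = I2 then dlog' C z / 2 else 0
      | I1 \<Rightarrow> if c = I3 then - deriv F z else 0
      | I2 \<Rightarrow> if c = I0 then - 2 * F z * dlog' C z - 2 * deriv F z * dlog C z else 0
      | I3 \<Rightarrow> 0)"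
| "conn_coeff' F C z I3 = (\<lambda>b c. case b of
        I0 \<Rightarrow> if c = I3 then dlog' C z / 2 else 0
      | I1 \<Rightarrow> if c = I2 then deriv F z else 0
      | I2 \<Rightarrow> 0
      | I3 \<Rightarrow> if c = I0 then - 2 * F z * dlog' C z - 2 * deriv F z * dlog C z else 0)"

lemma smooth_fun_on_deriv: "smooth_fun_on I f \<Longrightarrow> smooth_fun_on I (deriv f)"
  unfolding smooth_fun_on_def by (metis funpow_simps_right(2) o_def)

lemma smooth_fun_on_has_deriv:
  "smooth_fun_on I f \<Longrightarrow> z \<in> I \<Longrightarrow> (f has_real_derivative deriv f z) (at z)"
  unfolding smooth_fun_on_def
  by (metis DERIV_deriv_iff_real_differentiable funpow_0)

text \<open>Biaxial, because \<open>X\<^sub>2\<close> and \<open>X\<^sub>3\<close> have the same length.\<close>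

locale biaxial =
  fixes I :: "real set" and F C :: "real \<Rightarrow> real"
  assumes open_I: "open I" and smooth_F: "smooth_fun_on I F" and smooth_C: "smooth_fun_on I C"
    and pos: "\<And>z. z \<in> I \<Longrightarrow> F z > 0" "\<And>z. z \<in> I \<Longrightarrow> C z > 0"
begin

abbreviation "g \<equiv> bmetric F C"

lemma domM_zcoord: "x \<in> domM I \<Longrightarrow> x \<noteq> 0" "x \<in> domM I \<Longrightarrow> zcoord x \<in> I"
  by (simp_all add: domM_eq)

lemma open_domM: "open (domM I)"
proof -
  have "continuous_on (- {0}) zcoord"
    unfolding zcoord_def[abs_def] by (intro continuous_intros) auto
  then have "open (- {0} \<inter> zcoord -` I)"
    using open_I by (intro continuous_open_preimage) auto
  moreover have "- {0} \<inter> zcoord -` I = domM I" by (auto simp: domM_eq)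
  ultimately show ?thesis by simp
qed

lemmas jets =
  smooth_fun_on_has_deriv[OF smooth_F]
  smooth_fun_on_has_deriv[OF smooth_fun_on_deriv[OF smooth_F]]
  smooth_fun_on_has_deriv[OF smooth_fun_on_deriv[OF smooth_fun_on_deriv[OF smooth_F]]]
  smooth_fun_on_has_deriv[OF smooth_fun_on_deriv[OF smooth_fun_on_deriv[OF smooth_fun_on_deriv[OF smooth_F]]]]
  smooth_fun_on_has_deriv[OF smooth_C]
  smooth_fun_on_has_deriv[OF smooth_fun_on_deriv[OF smooth_C]]

lemma nz: "z \<in> I \<Longrightarrow> F z \<noteq> 0" "z \<in> I \<Longrightarrow> C z \<noteq> 0"
  using pos by (metis less_irrefl)+

lemma metric_coeff_nz: "z \<in> I \<Longrightarrow> metric_coeff F C z a \<noteq> 0"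
  using nz by (cases a) auto

lemma metric_coeff_deriv: "z \<in> I \<Longrightarrow> ((\<lambda>z. metric_coeff F C z a) has_real_derivative metric_coeff' F C z a) (at z)"
  using nz[of z] by (cases a) (auto intro!: derivative_eq_intros jets simp: field_simps power2_eq_square)

lemma dlog_deriv:
  "z \<in> I \<Longrightarrow> (dlog F has_real_derivative dlog' F z) (at z)"
  "z \<in> I \<Longrightarrow> (dlog C has_real_derivative dlog' C z) (at z)"
  unfolding dlog_def[abs_def] dlog'_def
  using nz[of z] by (auto intro!: derivative_eq_intros jets simp: field_simps power2_eq_square)

lemma conn_coeff_deriv: "z \<in> I \<Longrightarrow> ((\<lambda>z. conn_coeff F C z a b c) has_real_derivative conn_coeff' F C z a b c) (at z)"
  by (cases a; cases b; cases c; simp)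
     (auto intro!: derivative_eq_intros jets dlog_deriv simp: power2_eq_square)

lemma bmetric_tensor: "g x u v = tensor (comps2 (\<lambda>i j. if i = j then metric_coeff F C (zcoord x) i else 0)) x [u, v]"
  by (simp add: bmetric_def sum_ix algebra_simps)

lemma bmetric_sum: "g x u v = (\<Sum>i\<in>UNIV. metric_coeff F C (zcoord x) i * (coframe i x u * coframe i x v))"
  by (simp add: bmetric_def sum_ix algebra_simps)

lemma bmetric_frame: "x \<noteq> 0 \<Longrightarrow> g x v (frame i x) = metric_coeff F C (zcoord x) i * coframe i x v"
  by (cases i; simp add: bmetric_sum sum_ix dual_frame)

lemma sharp_eqI:
  assumes "x \<in> domM I" "\<And>v. g x w v = \<phi> v" shows "sharp (g x) \<phi> = w"
  unfolding sharp_def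
proof (rule the_equality)
  show "\<forall>v. g x w v = \<phi> v" using assms by simp
  fix w' assume w': "\<forall>v. g x w' v = \<phi> v"
  show "w' = w"
  proof (rule coframe_inject)
    show "x \<noteq> 0" using assms domM_zcoord by blast
    fix i have "g x w' (frame i x) = g x w (frame i x)" using w' assms by metis
    then show "coframe i x w' = coframe i x w"
      using metric_coeff_nz[OF domM_zcoord(2)[OF assms(1)]] \<open>x \<noteq> 0\<close> by (simp add: bmetric_frame)
  qed
qed

lemma sharp_eq:
  assumes "x \<in> domM I" "linear \<phi>"
  shows "sharp (g x) \<phi> = (\<Sum>a\<in>UNIV. (\<phi> (frame a x) / metric_coeff F C (zcoord x) a) *\<^sub>R frame a x)"
proof (rule sharp_eqI[OF assms(1)])
  fix v
  have x: "x \<noteq> 0" using assms domM_zcoord by blast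
  have gz: "metric_coeff F C (zcoord x) i \<noteq> 0" for i using metric_coeff_nz[OF domM_zcoord(2)[OF assms(1)]] .
  have "\<phi> v = \<phi> (\<Sum>a\<in>UNIV. coframe a x v *\<^sub>R frame a x)" by (simp flip: frame_expansion[OF x])
  also have "\<dots> = (\<Sum>a\<in>UNIV. coframe a x v * \<phi> (frame a x))"
    by (simp add: linear_sum[OF assms(2)] linear_scale[OF assms(2)])
  finally show "g x (\<Sum>a\<in>UNIV. (\<phi> (frame a x) / metric_coeff F C (zcoord x) a) *\<^sub>R frame a x) v = \<phi> v"
    by (simp add: bmetric_sum coframe_linear_simps coframe_frame[OF x] gz mult.commute
         if_distrib[of "\<lambda>t. _ * t"] if_distrib[of "\<lambda>t. t / _"] cong: if_cong)
qed

text \<open>The trace is defined by a Euclidean orthonormal basis; expanding that basis leaves the sum over the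
  \<open>g\<close>-orthogonal frame.\<close>

lemma mtrace_frame:
  assumes "x \<in> domM I" "bilinear b"
  shows "mtrace (g x) b = (\<Sum>a\<in>UNIV. b (frame a x) (frame a x) / metric_coeff F C (zcoord x) a)"
proof -
  have l: "linear (b s)" "linear (\<lambda>s. b s t)" for s t
    using assms(2) unfolding bilinear_def by blast+
  have "mtrace (g x) b = (\<Sum>i\<in>Basis. \<Sum>a\<in>UNIV. b i (frame a x) / metric_coeff F C (zcoord x) a * (frame a x \<bullet> i))"
    unfolding mtrace_def by (simp add: sharp_eq[OF assms(1) l(1)] inner_sum_left)
  also have "\<dots> = (\<Sum>a\<in>UNIV. \<Sum>i\<in>Basis. b i (frame a x) / metric_coeff F C (zcoord x) a * (frame a x \<bullet> i))"
    by (rule sum.swap)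
  also have "\<dots> = (\<Sum>a\<in>UNIV. b (\<Sum>i\<in>Basis. (frame a x \<bullet> i) *\<^sub>R i) (frame a x) / metric_coeff F C (zcoord x) a)"
    by (simp only: linear_sum[OF l(2)] linear_scale[OF l(2)] sum_divide_distrib)
       (simp add: mult.commute)
  finally show ?thesis by (simp only: euclidean_representation)
qed

lemma mtrace_tensor_12:
  assumes "x \<in> domM I"
  shows "mtrace (g x) (\<lambda>s s'. tensor t x (s # s' # vs)) = tensor (\<lambda>is. \<Sum>s\<in>UNIV. t (s # s # is) / metric_coeff F C (zcoord x) s) x vs"
proof -
  have "bilinear (\<lambda>s s'. tensor t x (s # s' # vs))"
    using bilinear_tensor[of t x "[]" "[]" vs] by (simp only: append.simps)
  then have "mtrace (g x) (\<lambda>s s'. tensor t x (s # s' # vs))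
      = (\<Sum>s\<in>UNIV. 1 / metric_coeff F C (zcoord x) s * tensor (\<lambda>is. t (s # s # is)) x vs)"
    by (simp add: mtrace_frame[OF assms] tensor_frame[OF domM_zcoord(1)[OF assms]] del: tensor.simps)
  then show ?thesis unfolding tensor_scale[symmetric] tensor_sum[symmetric] by simp
qed

lemma mtrace_tensor_14:
  assumes "x \<in> domM I"
  shows "mtrace (g x) (\<lambda>s s'. tensor t x [s, u, v, s']) = tensor (comps2 (\<lambda>a b. \<Sum>s\<in>UNIV. t [s, a, b, s] / metric_coeff F C (zcoord x) s)) x [u, v]"
    and "mtrace (g x) (\<lambda>s s'. tensor t x [s', u, v, s]) = tensor (comps2 (\<lambda>a b. \<Sum>s\<in>UNIV. t [s, a, b, s] / metric_coeff F C (zcoord x) s)) x [u, v]"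
proof -
  have x: "x \<noteq> 0" using domM_zcoord[OF assms] by simp
  have b: "bilinear (\<lambda>s s'. tensor t x [s, u, v, s'])"
    using bilinear_tensor[of t x "[]" "[u, v]" "[]"] by (simp only: append.simps)
  have e: "(\<Sum>s\<in>UNIV. tensor t x [frame s x, u, v, frame s x] / metric_coeff F C (zcoord x) s)
      = tensor (comps2 (\<lambda>a b. \<Sum>s\<in>UNIV. t [s, a, b, s] / metric_coeff F C (zcoord x) s)) x [u, v]"
  proof -
    have "tensor t x [frame s x, u, v, frame s x] / metric_coeff F C (zcoord x) s = tensor (\<lambda>is. 1 / metric_coeff F C (zcoord x) s * t [s, is ! 0, is ! 1, s]) x [u, v]" for s
      unfolding tensor_scale tensor_frame[OF x]
      by (simp add: coframe_frame[OF x] if_distrib[of "\<lambda>t. t * _"] cong: if_cong)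
    then have "(\<Sum>s\<in>UNIV. tensor t x [frame s x, u, v, frame s x] / metric_coeff F C (zcoord x) s)
      = tensor (\<lambda>is. \<Sum>s\<in>UNIV. 1 / metric_coeff F C (zcoord x) s * t [s, is ! 0, is ! 1, s]) x [u, v]"
      by (simp only: tensor_sum)
    also have "\<dots> = tensor (comps2 (\<lambda>a b. \<Sum>s\<in>UNIV. t [s, a, b, s] / metric_coeff F C (zcoord x) s)) x [u, v]"
      by (rule tensor_cong) (simp add: comps2_def)
    finally show ?thesis .
  qed
  show "mtrace (g x) (\<lambda>s s'. tensor t x [s, u, v, s']) = tensor (comps2 (\<lambda>a b. \<Sum>s\<in>UNIV. t [s, a, b, s] / metric_coeff F C (zcoord x) s)) x [u, v]"
    by (simp only: mtrace_frame[OF assms b] e)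
  show "mtrace (g x) (\<lambda>s s'. tensor t x [s', u, v, s]) = tensor (comps2 (\<lambda>a b. \<Sum>s\<in>UNIV. t [s, a, b, s] / metric_coeff F C (zcoord x) s)) x [u, v]"
    by (simp only: mtrace_frame[OF assms bilinear_swap[OF b]] e)
qed

text \<open>Metric compatibility, which makes traces commute with \<open>\<nabla>\<close>.\<close>

lemma conn_coeff_metric: "z \<in> I \<Longrightarrow>
    conn_coeff F C z a b c * metric_coeff F C z c + conn_coeff F C z a c b * metric_coeff F C z b
      = (if a = I0 \<and> b = c then metric_coeff' F C z b else 0)"
  using nz[of z]
  by (cases a; cases b; cases c; simp add: dlog_def) (simp_all add: field_simps power2_eq_square)

text \<open>Since \<^const>\<open>sharp\<close> is determined by inner products, it suffices to compare the components of the
  Koszul expression, whose terms are flat derivatives of the metric.\<close>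

lemma christoffel_eq:
  assumes "x \<in> domM I"
  shows "christoffel g x u v = bilin (\<lambda>a b c. conn_coeff F C (zcoord x) a b c - flat_coeff a b c) x u v"
proof -
  define z where "z = zcoord x"
  have x: "x \<noteq> 0" and z: "z \<in> I" using domM_zcoord[OF assms] by (simp_all add: z_def)
  define t where "t z = comps2 (\<lambda>i j. if i = j then metric_coeff F C z i else 0)" for z
  define t' where "t' = comps2 (\<lambda>i j. if i = j then metric_coeff' F C z i else 0)"
  define G where "G = cov_comps flat_coeff t' (t z)"
  have D: "dir_deriv (\<lambda>y. g y a b) x s = tensor G x [s, a, b]" for a b s
    unfolding G_def z_def
    by (rule dir_deriv_tensor[OF assms open_domM x])
       (auto simp: bmetric_tensor t_def t'_def comps2_def intro!: metric_coeff_deriv[OF z] simp flip: z_def)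
  show ?thesis unfolding christoffel_def
  proof (rule sharp_eqI[OF assms])
    fix w
    have E: "G [a, b, c] + G [b, a, c] - G [c, a, b] = 2 * ((conn_coeff F C z a b c - flat_coeff a b c) * metric_coeff F C z c)" for a b c
      using nz[OF z] unfolding G_def cov_comps_def t_def t'_def
      by (cases a; cases b; cases c; simp add: dlog_def sum_ix) (simp_all add: field_simps power2_eq_square)
    have "tensor G x [u, v, w] + tensor G x [v, u, w] - tensor G x [w, u, v]
       = tensor (comps3 (\<lambda>a b c. G [a, b, c] + G [b, a, c] - G [c, a, b])) x [u, v, w]"
      unfolding tensor_swap[of _ x v u] tensor_rotate[of _ x w u v] tensor_add[symmetric] tensor_diff[symmetric]
      by simp
    also have "\<dots> = 2 * tensor (comps3 (\<lambda>a b c. (conn_coeff F C z a b c - flat_coeff a b c) * metric_coeff F C z c)) x [u, v, w]"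
      unfolding E tensor_scale[symmetric] by simp
    also have "\<dots> = 2 * g x (bilin (\<lambda>a b c. conn_coeff F C (zcoord x) a b c - flat_coeff a b c) x u v) w"
      unfolding bmetric_sum coframe_bilin[OF x] z_def[symmetric] tensor_last_slot
      by (simp add: sum_distrib_left sum_distrib_right mult_ac)
    finally show "g x (bilin (\<lambda>a b c. conn_coeff F C (zcoord x) a b c - flat_coeff a b c) x u v) w
      = (dir_deriv (\<lambda>y. g y v w) x u + dir_deriv (\<lambda>y. g y u w) x v - dir_deriv (\<lambda>y. g y u v) x w) / 2"
      unfolding D by simp
  qed
qed

end

section \<open>The curvature tensor\<close>

definition wedge :: "ix \<Rightarrow> ix \<Rightarrow> ix \<Rightarrow> ix \<Rightarrow> real" where
  "wedge i j a b = (if a = i \<and> b = j then 1 else if a = j \<and> b = i then - 1 else 0)"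

text \<open>The curvature as a symmetric form on two-forms, in the basis \<open>\<theta>\<^sup>i \<and> \<theta>\<^sup>j\<close>. It pairs a two-form only with itself
  and with the complementary one. The coefficients of the three mixed terms, \<open>- C F'\<close>, \<open>C F'/2\<close> and \<open>C F'/2\<close>, add
  up to zero, which is the first Bianchi identity.\<close>

definition Rm_comps :: "(real \<Rightarrow> real) \<Rightarrow> (real \<Rightarrow> real) \<Rightarrow> real \<Rightarrow> ix \<Rightarrow> ix \<Rightarrow> ix \<Rightarrow> ix \<Rightarrow> real" where
  "Rm_comps F C z a b c d = (let f = F z; f1 = deriv F z; f2 = deriv (deriv F) z; c0 = C z;
       p = dlog C z; p' = dlog' C z in
     c0 * ((f * p' + f2 + f1 * p) / 2 * (wedge I0 I1 a b * wedge I0 I1 c d)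
      + (2 * f * p' + f1 * p) / (4 * f) * (wedge I0 I2 a b * wedge I0 I2 c d + wedge I0 I3 a b * wedge I0 I3 c d)
      - f * (f - f * p\<^sup>2 - p * f1) * (wedge I1 I2 a b * wedge I1 I2 c d + wedge I3 I1 a b * wedge I3 I1 c d)
      - (4 - 3 * f - f * p\<^sup>2) * (wedge I2 I3 a b * wedge I2 I3 c d)
      - f1 * (wedge I0 I1 a b * wedge I2 I3 c d + wedge I2 I3 a b * wedge I0 I1 c d)
      + f1 / 2 * (wedge I0 I2 a b * wedge I3 I1 c d + wedge I3 I1 a b * wedge I0 I2 c d
          + wedge I0 I3 a b * wedge I1 I2 c d + wedge I1 I2 a b * wedge I0 I3 c d)))"

context biaxial begin

definition chart_coeff :: "real \<Rightarrow> ix \<Rightarrow> ix \<Rightarrow> ix \<Rightarrow> real" where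
  "chart_coeff z a b c = conn_coeff F C z a b c - flat_coeff a b c"

text \<open>The component of \<open>D\<^sub>u(\<Gamma>(v, w)) + \<Gamma>(u, \<Gamma>(v, w))\<close> for the Christoffel symbol \<open>\<Gamma>\<close> of the chart and constant
  \<open>u, v, w\<close>. The curvature is obtained by antisymmetrising in \<open>u\<close> and \<open>v\<close>. The first two terms are the
  derivative of \<open>\<Gamma>\<close>: \<open>\<Gamma>\<close> takes values in vectors, so the derivative falls also on the frame.\<close>

definition curv_term :: "real \<Rightarrow> ix \<Rightarrow> ix \<Rightarrow> ix \<Rightarrow> ix \<Rightarrow> real" where
  "curv_term z a b c d =
     cov_comps flat_coeff (comps2 (\<lambda>b c. conn_coeff' F C z b c d)) (comps2 (\<lambda>b c. chart_coeff z b c d)) [a, b, c]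
     + (\<Sum>k\<in>UNIV. chart_coeff z b c k * flat_coeff a k d) + (\<Sum>e\<in>UNIV. chart_coeff z b c e * chart_coeff z a e d)"

lemma tensor_contract:
  "(\<Sum>e\<in>UNIV. tensor (comps2 (B e)) x [v, w] * H e) = tensor (comps2 (\<lambda>b c. \<Sum>e\<in>UNIV. B e b c * H e)) x [v, w]"
proof -
  have "comps2 (\<lambda>b c. \<Sum>e\<in>UNIV. B e b c * H e) = (\<lambda>is. \<Sum>e\<in>UNIV. H e * comps2 (B e) is)"
    by (simp add: comps2_def fun_eq_iff mult.commute)
  then show ?thesis by (simp only: tensor_sum tensor_scale) (simp add: mult.commute)
qed

lemma christoffel_frame_sum:
  assumes "x \<in> domM I"
  shows "christoffel g x v w = (\<Sum>k\<in>UNIV. tensor (comps2 (\<lambda>b c. chart_coeff (zcoord x) b c k)) x [v, w] *\<^sub>R frame k x)"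
  by (simp add: christoffel_eq[OF assms] bilin_def chart_coeff_def)

lemma chart_coeff_deriv: "z \<in> I \<Longrightarrow> ((\<lambda>z. chart_coeff z a b c) has_real_derivative conn_coeff' F C z a b c) (at z)"
  unfolding chart_coeff_def by (auto intro!: derivative_eq_intros conn_coeff_deriv)

lemma dir_deriv_christoffel:
  assumes "x \<in> domM I"
  shows "coframe d x (dir_deriv (\<lambda>y. christoffel g y v w) x u + christoffel g x u (christoffel g x v w))
     = tensor (comps3 (\<lambda>a b c. curv_term (zcoord x) a b c d)) x [u, v, w]"
proof -
  define z where "z = zcoord x"
  have x: "x \<noteq> 0" and z: "z \<in> I" using domM_zcoord[OF assms] by (simp_all add: z_def)
  define t where "t k z = comps2 (\<lambda>b c. chart_coeff z b c k)" for k z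
  define D where "D k = cov_comps flat_coeff (comps2 (\<lambda>b c. conn_coeff' F C z b c k)) (t k z)" for k
  have "((\<lambda>y. tensor (t k (zcoord y)) y [v, w]) has_derivative (\<lambda>s. tensor (D k) x (s # [v, w]))) (at x)" for k
    unfolding D_def z_def
    by (rule tensor_has_derivative_flat[OF x])
       (auto simp: t_def comps2_def intro!: chart_coeff_deriv[OF z] simp flip: z_def)
  then have "((\<lambda>y. \<Sum>k\<in>UNIV. tensor (t k (zcoord y)) y [v, w] *\<^sub>R frame k y) has_derivative
     (\<lambda>s. \<Sum>k\<in>UNIV. tensor (t k z) x [v, w] *\<^sub>R frame k s + tensor (D k) x (s # [v, w]) *\<^sub>R frame k x)) (at x)"
    unfolding z_def
    by (intro has_derivative_sum has_derivative_scaleR linear_imp_has_derivative linear_frame)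
  then have "((\<lambda>y. christoffel g y v w) has_derivative
     (\<lambda>s. \<Sum>k\<in>UNIV. tensor (t k z) x [v, w] *\<^sub>R frame k s + tensor (D k) x (s # [v, w]) *\<^sub>R frame k x)) (at x)"
    by (rule has_derivative_transform_within_open[OF _ open_domM assms])
       (simp only: christoffel_frame_sum t_def)
  then have 1: "dir_deriv (\<lambda>y. christoffel g y v w) x u =
     (\<Sum>k\<in>UNIV. tensor (t k z) x [v, w] *\<^sub>R frame k u + tensor (D k) x [u, v, w] *\<^sub>R frame k x)"
    by (rule dir_deriv_eqI)
  have 2: "coframe d x (frame k u) = (\<Sum>a\<in>UNIV. coframe a x u * flat_coeff a k d)" for k
    by (subst frame_apply[OF x]) (simp only: coframe_frame_sum[OF x])
  have 3: "(\<Sum>k\<in>UNIV. tensor (t k z) x [v, w] * (\<Sum>a\<in>UNIV. coframe a x u * H a k))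
     = tensor (comps3 (\<lambda>a b c. \<Sum>k\<in>UNIV. chart_coeff z b c k * H a k)) x [u, v, w]" for H
  proof -
    have "(\<Sum>k\<in>UNIV. tensor (t k z) x [v, w] * (\<Sum>a\<in>UNIV. coframe a x u * H a k))
       = (\<Sum>a\<in>UNIV. coframe a x u * (\<Sum>k\<in>UNIV. tensor (t k z) x [v, w] * H a k))"
      by (simp only: sum_distrib_left) (subst sum.swap, simp only: mult.left_commute)
    also have "\<dots> = (\<Sum>a\<in>UNIV. coframe a x u * tensor (comps2 (\<lambda>b c. \<Sum>k\<in>UNIV. chart_coeff z b c k * H a k)) x [v, w])"
      unfolding t_def tensor_contract ..
    finally show ?thesis by simp
  qed
  have 4: "coframe d x (christoffel g x u (christoffel g x v w))
     = (\<Sum>a\<in>UNIV. coframe a x u * (\<Sum>k\<in>UNIV. tensor (t k z) x [v, w] * chart_coeff z a k d))"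
    unfolding christoffel_eq[OF assms, of u] coframe_bilin[OF x]
    by (simp only: christoffel_frame_sum[OF assms] coframe_frame_sum[OF x] chart_coeff_def t_def z_def)
  have 4: "coframe d x (christoffel g x u (christoffel g x v w))
     = tensor (comps3 (\<lambda>a b c. \<Sum>k\<in>UNIV. chart_coeff z b c k * chart_coeff z a k d)) x [u, v, w]"
    unfolding 4 3[symmetric] by (simp only: sum_distrib_left) (subst sum.swap, simp only: mult.left_commute)
  have 5: "coframe d x (dir_deriv (\<lambda>y. christoffel g y v w) x u)
     = tensor (comps3 (\<lambda>a b c. \<Sum>k\<in>UNIV. chart_coeff z b c k * flat_coeff a k d)) x [u, v, w] + tensor (D d) x [u, v, w]"
    unfolding 1 3[symmetric]
    by (simp only: sum.distrib linear_add[OF linear_coframe] coframe_frame_sum[OF x])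
       (simp only: coframe_linear_simps real_scaleR_def 2)
  show ?thesis
    unfolding linear_add[OF linear_coframe] 4 5 tensor_add[symmetric] z_def[symmetric]
    by (rule tensor_cong) (auto simp: length_Suc_conv curv_term_def D_def t_def)
qed

text \<open>The identity is purely algebraic: the constants \<^const>\<open>flat_coeff\<close> drop out because \<open>D\<close> is flat.\<close>

lemma curvature_components: "z \<in> I \<Longrightarrow>
    (curv_term z a b c d - curv_term z b a c d) * metric_coeff F C z d = Rm_comps F C z a b c d"
  using nz[of z]
  by (cases a; cases b; cases c; cases d;
       simp add: curv_term_def chart_coeff_def cov_comps_def sum_ix dlog_def dlog'_def Rm_comps_def wedge_def Let_def)
     (simp_all add: field_simps power2_eq_square)

lemma Rm_tensor:
  assumes "x \<in> domM I"
  shows "Rm g x u v w y = tensor (comps4 (Rm_comps F C (zcoord x))) x [u, v, w, y]"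
proof -
  define z where "z = zcoord x"
  have x: "x \<noteq> 0" and z: "z \<in> I" using domM_zcoord[OF assms] by (simp_all add: z_def)
  have 1: "coframe d x (curv_endo g x u v w)
     = tensor (comps3 (\<lambda>a b c. curv_term z a b c d - curv_term z b a c d)) x [u, v, w]" for d
  proof -
    have "curv_endo g x u v w = (dir_deriv (\<lambda>y. christoffel g y v w) x u + christoffel g x u (christoffel g x v w))
       - (dir_deriv (\<lambda>y. christoffel g y u w) x v + christoffel g x v (christoffel g x u w))"
      by (simp add: curv_endo_def)
    then have "coframe d x (curv_endo g x u v w) = tensor (comps3 (\<lambda>a b c. curv_term z a b c d)) x [u, v, w]
       - tensor (comps3 (\<lambda>a b c. curv_term z a b c d)) x [v, u, w]"
      by (simp only: linear_diff[OF linear_coframe] dir_deriv_christoffel[OF assms] z_def)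
    then show ?thesis
      unfolding tensor_swap[of _ x v u] tensor_diff[symmetric] by simp
  qed
  have "tensor (comps4 (Rm_comps F C z)) x [u, v, w, y] = tensor (comps3 (\<lambda>a b c. (\<Sum>d\<in>UNIV. coframe d x y * Rm_comps F C z a b c d))) x [u, v, w]"
    by simp
  also have "\<dots> = (\<Sum>d\<in>UNIV. coframe d x y * tensor (comps3 (\<lambda>a b c. Rm_comps F C z a b c d)) x [u, v, w])"
    unfolding tensor_scale[symmetric] tensor_sum[symmetric] by (simp add: comps3_def)
  also have "\<dots> = (\<Sum>d\<in>UNIV. coframe d x y * (metric_coeff F C z d * coframe d x (curv_endo g x u v w)))"
    unfolding 1 tensor_scale[symmetric] curvature_components[OF z, symmetric] by (simp add: comps3_def mult.commute)
  finally show ?thesis by (simp add: Rm_def bmetric_sum z_def mult_ac)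
qed

end

section \<open>Ricci, Schouten and Weyl tensors\<close>

definition Ric_coeff :: "(real \<Rightarrow> real) \<Rightarrow> (real \<Rightarrow> real) \<Rightarrow> real \<Rightarrow> ix \<Rightarrow> real" where
  "Ric_coeff F C z i = (let f = F z; f1 = deriv F z; f2 = deriv (deriv F) z;
       p = dlog C z; p' = dlog' C z in
     case i of I0 \<Rightarrow> - (3 * f * p' + f2 + 2 * f1 * p) / (2 * f)
      | I1 \<Rightarrow> - 2 * f * (f * p' + f2 + f1 * p) + 2 * f * (f - f * p\<^sup>2 - p * f1)
      | _ \<Rightarrow> 4 - 2 * f - 2 * f * p' - 2 * p * f1 - 2 * f * p\<^sup>2)"

definition scal_fun :: "(real \<Rightarrow> real) \<Rightarrow> (real \<Rightarrow> real) \<Rightarrow> real \<Rightarrow> real" where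
  "scal_fun F C z = (\<Sum>a\<in>UNIV. Ric_coeff F C z a / metric_coeff F C z a)"

text \<open>Up to the factor \<open>C\<close>, the form \<open>I1\<close> is \<open>\<omega>\<^sup>\<plusminus>\<close>. The other two span its orthogonal complement in \<open>\<Lambda>\<^sup>\<plusminus>\<close>. They are
  not normalised to the length of \<open>\<omega>\<^sup>\<plusminus>\<close>, since this would introduce the square root of \<open>F\<close>. The index \<open>I0\<close>
  stands for the zero form.\<close>

definition sd_form :: "real \<Rightarrow> real \<Rightarrow> ix \<Rightarrow> ix \<Rightarrow> ix \<Rightarrow> real" where
  "sd_form \<epsilon> f k a b = (case k of I1 \<Rightarrow> \<epsilon> / 2 * wedge I0 I1 a b + wedge I2 I3 a b
     | I2 \<Rightarrow> wedge I0 I2 a b + 2 * \<epsilon> * f * wedge I3 I1 a b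
     | I3 \<Rightarrow> wedge I0 I3 a b + 2 * \<epsilon> * f * wedge I1 I2 a b
     | _ \<Rightarrow> 0)"

text \<open>In an orthogonal basis \<open>\<omega>\<^sub>1 = \<omega>\<^sup>\<plusminus>, \<omega>\<^sub>2, \<omega>\<^sub>3\<close> of \<open>\<Lambda>\<^sup>\<plusminus>\<close> with all norms squared \<open>2\<close>, the identity of \<open>\<Lambda>\<^sup>\<plusminus>\<close> is half
  the sum of the \<open>\<omega>\<^sub>k \<otimes> \<omega>\<^sub>k\<close>, so \<open>\<omega> \<otimes> \<omega> - 2/3 Id\<close> has the coefficients \<open>2/3, -1/3, -1/3\<close>. The normalisation
  of \<^const>\<open>sd_form\<close> turns \<open>-1/3\<close> into \<open>-1/(12 F)\<close>.\<close>

definition sd_coeff :: "real \<Rightarrow> ix \<Rightarrow> real" where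
  "sd_coeff f k = (case k of I0 \<Rightarrow> 0 | I1 \<Rightarrow> 2 / 3 | _ \<Rightarrow> - 1 / (12 * f))"

text \<open>The tensor \<open>1/C (\<omega>\<^sup>\<plusminus> \<otimes> \<omega>\<^sup>\<plusminus> - 2/3 Id)\<close>. Its sign is opposite to that of the curvature operator, which
  contracts with the last two arguments exchanged.\<close>

definition typeD :: "real \<Rightarrow> (real \<Rightarrow> real) \<Rightarrow> (real \<Rightarrow> real) \<Rightarrow> real \<Rightarrow> ix \<Rightarrow> ix \<Rightarrow> ix \<Rightarrow> ix \<Rightarrow> real" where
  "typeD \<epsilon> F C z a b c d = C z * (\<Sum>k\<in>UNIV. sd_coeff (F z) k * (sd_form \<epsilon> (F z) k a b * sd_form \<epsilon> (F z) k c d))"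

lemma tensor_mult_12_34: "tensor (comps4 (\<lambda>a b c d. f a b * h c d)) x [u, v, w, y] = tensor (comps2 f) x [u, v] * tensor (comps2 h) x [w, y]"
proof -
  have "tensor (\<lambda>is. k * comps2 h is) x [w, y] = tensor (comps2 (\<lambda>c d. k * h c d)) x [w, y]" for k
    by (rule tensor_cong) (simp add: comps2_def)
  then have k: "tensor (comps2 (\<lambda>c d. k * h c d)) x [w, y] = k * tensor (comps2 h) x [w, y]" for k
    by (simp only: tensor_scale)
  have "tensor (comps4 (\<lambda>a b c d. f a b * h c d)) x [u, v, w, y]
     = (\<Sum>a\<in>UNIV. coframe a x u * (\<Sum>b\<in>UNIV. coframe b x v * tensor (comps2 (\<lambda>c d. f a b * h c d)) x [w, y]))"
    by simp
  moreover define T where "T = tensor (comps2 h) x [w, y]"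
  ultimately show ?thesis unfolding k T_def[symmetric] by (simp add: sum_distrib_right mult.assoc)
qed

lemma tensor_mult_13_24: "tensor (comps4 (\<lambda>a b c d. f a c * h b d)) x [u, v, w, y] = tensor (comps2 f) x [u, w] * tensor (comps2 h) x [v, y]"
proof -
  have "tensor (comps4 (\<lambda>a b c d. f a c * h b d)) x [u, v, w, y]
     = (\<Sum>a\<in>UNIV. coframe a x u * tensor (comps3 (\<lambda>b c d. f a c * h b d)) x [v, w, y])" by simp
  also have "\<dots> = tensor (comps4 (\<lambda>a b c d. f a b * h c d)) x [u, w, v, y]"
    unfolding tensor_swap[of _ x v w] by simp
  finally show ?thesis by (simp only: tensor_mult_12_34)
qed

lemma tensor_mult_14_23: "tensor (comps4 (\<lambda>a b c d. f a d * h b c)) x [u, v, w, y] = tensor (comps2 f) x [u, y] * tensor (comps2 h) x [v, w]"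
proof -
  have "tensor (comps4 (\<lambda>a b c d. f a d * h b c)) x [u, v, w, y]
     = (\<Sum>a\<in>UNIV. coframe a x u * tensor (comps3 (\<lambda>b c d. f a d * h b c)) x [v, w, y])" by simp
  also have "\<dots> = tensor (comps4 (\<lambda>a b c d. f a b * h c d)) x [u, y, v, w]"
    unfolding tensor.simps(2)[of _ x u] tensor_rotate[of _ x y v w] by simp
  finally show ?thesis by (simp only: tensor_mult_12_34)
qed

context biaxial begin

lemma Lop_eq:
  assumes "z \<in> I" "\<epsilon> \<in> {1, -1}"
  shows "Lop \<epsilon> F z = 1/2 * deriv (deriv F) z - 3/2 * \<epsilon> * deriv F z + F z"
proof -
  have "((first_order_op (- \<epsilon>) F) has_real_derivative (- \<epsilon> * deriv (deriv F) z + deriv F z)) (at z)"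
    unfolding first_order_op_def[abs_def]
    using assms(1) by (auto intro!: derivative_eq_intros jets)
  then show ?thesis unfolding Lop_def using assms(2)
    by (auto simp: first_order_op_def[of _ "first_order_op _ _"] DERIV_imp_deriv)
       (auto simp: first_order_op_def field_simps)
qed

lemma Ricci_components: "z \<in> I \<Longrightarrow>
    (\<Sum>s\<in>UNIV. Rm_comps F C z s a b s / metric_coeff F C z s) = (if a = b then Ric_coeff F C z a else 0)"
  using nz[of z]
  by (cases a; cases b; simp add: sum_ix Rm_comps_def Ric_coeff_def wedge_def Let_def)
     (simp_all add: field_simps power2_eq_square)

lemma Ric_tensor:
  assumes "x \<in> domM I"
  shows "Ric g x u v = tensor (comps2 (\<lambda>a b. if a = b then Ric_coeff F C (zcoord x) a else 0)) x [u, v]"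
proof -
  define z where "z = zcoord x"
  have x: "x \<noteq> 0" and z: "z \<in> I" using domM_zcoord[OF assms] by (simp_all add: z_def)
  have "Ric g x u v = tensor (comps2 (\<lambda>a b. \<Sum>s\<in>UNIV. Rm_comps F C z s a b s / metric_coeff F C z s)) x [u, v]"
    unfolding Ric_def Rm_tensor[OF assms] mtrace_tensor_14(1)[OF assms] comps_simps z_def ..
  then show ?thesis by (simp only: Ricci_components[OF z]) (simp only: z_def)
qed

lemma scal_eq:
  assumes "x \<in> domM I" shows "scal g x = scal_fun F C (zcoord x)"
proof -
  have x: "x \<noteq> 0" using domM_zcoord[OF assms] by simp
  have "bilinear (\<lambda>u v. Ric g x u v)"
    unfolding Ric_tensor[OF assms]
    using bilinear_tensor[of _ x "[]" "[]" "[]"] by (simp only: append.simps)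
  then have "scal g x = (\<Sum>a\<in>UNIV. Ric g x (frame a x) (frame a x) / metric_coeff F C (zcoord x) a)"
    unfolding scal_def by (rule mtrace_frame[OF assms])
  then show ?thesis
    by (simp only: scal_fun_def Ric_tensor[OF assms] tensor_frame[OF x]) simp
qed

definition Schouten_comps :: "real \<Rightarrow> ix \<Rightarrow> ix \<Rightarrow> real" where
  "Schouten_comps z a b = (if a = b then (Ric_coeff F C z a - scal_fun F C z / 6 * metric_coeff F C z a) / 2 else 0)"

definition metric_comps :: "real \<Rightarrow> ix \<Rightarrow> ix \<Rightarrow> real" where
  "metric_comps z a b = (if a = b then metric_coeff F C z a else 0)"

lemma Schouten_tensor:
  assumes "x \<in> domM I" shows "Schouten g x u v = tensor (comps2 (Schouten_comps (zcoord x))) x [u, v]"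
proof -
  have "tensor (comps2 (Schouten_comps (zcoord x))) x [u, v] = tensor (\<lambda>is. 1/2 * (comps2 (\<lambda>a b. if a = b then Ric_coeff F C (zcoord x) a else 0) is
       - scal_fun F C (zcoord x) / 6 * comps2 (\<lambda>i j. if i = j then metric_coeff F C (zcoord x) i else 0) is)) x [u, v]"
    by (rule tensor_cong) (simp add: comps2_def Schouten_comps_def)
  also have "\<dots> = Schouten g x u v"
    unfolding tensor_scale tensor_diff
    by (simp only: Schouten_def scal_eq[OF assms] Ric_tensor[OF assms] bmetric_tensor) simp
  finally show ?thesis ..
qed

text \<open>All the dependence on \<open>C'\<close> and \<open>C''\<close> disappears, in accordance with the conformal invariance of the
  Weyl tensor.\<close>

lemma Weyl_components:
  assumes "z \<in> I"
  shows "Rm_comps F C z a b c d - (Schouten_comps z a d * metric_comps z b c + metric_comps z a d * Schouten_comps z b c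
      - Schouten_comps z a c * metric_comps z b d - metric_comps z a c * Schouten_comps z b d)
    = (Lop 1 F z - 1) * typeD 1 F C z a b c d + (Lop (-1) F z - 1) * typeD (-1) F C z a b c d"
  using nz[OF assms] Lop_eq[OF assms, of 1] Lop_eq[OF assms, of "-1"]
  by (cases a; cases b; cases c; cases d;
      simp add: Schouten_comps_def metric_comps_def scal_fun_def Ric_coeff_def Rm_comps_def sum_ix
        typeD_def sd_form_def sd_coeff_def wedge_def Let_def)
     (simp_all add: field_simps power2_eq_square)

lemma Weyl_tensor:
  assumes "x \<in> domM I"
  shows "Weyl g x u v w y = tensor (comps4 (\<lambda>a b c d. (Lop 1 F (zcoord x) - 1) * typeD 1 F C (zcoord x) a b c d
      + (Lop (-1) F (zcoord x) - 1) * typeD (-1) F C (zcoord x) a b c d)) x [u, v, w, y]"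
proof -
  define z where "z = zcoord x"
  have x: "x \<noteq> 0" and z: "z \<in> I" using domM_zcoord[OF assms] by (simp_all add: z_def)
  have m: "g x u v = tensor (comps2 (metric_comps z)) x [u, v]" for u v by (simp add: bmetric_tensor metric_comps_def[abs_def] z_def)
  have "Weyl g x u v w y = tensor (\<lambda>is. comps4 (Rm_comps F C z) is - (comps4 (\<lambda>a b c d. Schouten_comps z a d * metric_comps z b c) is
      + comps4 (\<lambda>a b c d. metric_comps z a d * Schouten_comps z b c) is - comps4 (\<lambda>a b c d. Schouten_comps z a c * metric_comps z b d) is
      - comps4 (\<lambda>a b c d. metric_comps z a c * Schouten_comps z b d) is)) x [u, v, w, y]"
    unfolding tensor_add tensor_diff tensor_mult_13_24 tensor_mult_14_23
    by (simp only: Weyl_def Rm_tensor[OF assms] Schouten_tensor[OF assms] m z_def[symmetric] mult.commute)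
  also have "\<dots> = tensor (comps4 (\<lambda>a b c d. (Lop 1 F z - 1) * typeD 1 F C z a b c d
      + (Lop (-1) F z - 1) * typeD (-1) F C z a b c d)) x [u, v, w, y]"
    by (rule tensor_cong) (simp add: comps4_def flip: Weyl_components[OF z])
  finally show ?thesis by (simp only: z_def)
qed

end

section \<open>Self-dual and anti-self-dual parts of the Weyl tensor\<close>

lemma linear_cmult: "linear f \<Longrightarrow> linear (\<lambda>s. c * f s)" for f :: "'a::real_vector \<Rightarrow> real"
  by (auto intro!: linearI simp: linear_add linear_scale algebra_simps)

lemma bilinear_mult:
  fixes f h :: "'a::real_vector \<Rightarrow> real"
  assumes "linear f" "linear h" shows "bilinear (\<lambda>s t. f s * h t)"
  unfolding bilinear_def
  using assms by (auto intro!: linearI simp: linear_add linear_scale algebra_simps)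

lemma bilinear_sum:
  assumes "\<And>i. i \<in> A \<Longrightarrow> bilinear (B i)" shows "bilinear (\<lambda>s t. \<Sum>i\<in>A. B i s t)"
  using assms unfolding bilinear_def by (auto intro!: linear_compose_sum)

lemma bilinear_add: "bilinear A \<Longrightarrow> bilinear B \<Longrightarrow> bilinear (\<lambda>s t. A s t + B s t)"
  unfolding bilinear_def by (auto intro!: linear_compose_add)

lemma bilinear_cmult:
  fixes B :: "'a::real_vector \<Rightarrow> 'b::real_vector \<Rightarrow> real"
  assumes "bilinear B" shows "bilinear (\<lambda>s t. c * B s t)"
  using assms unfolding bilinear_def by (auto intro: linear_cmult)

definition sd_two_form :: "real \<Rightarrow> (real \<Rightarrow> real) \<Rightarrow> ix \<Rightarrow> point \<Rightarrow> point \<Rightarrow> point \<Rightarrow> real" where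
  "sd_two_form \<epsilon> F k x u v = tensor (comps2 (sd_form \<epsilon> (F (zcoord x)) k)) x [u, v]"

lemma bilinear_sd_two_form: "bilinear (sd_two_form \<epsilon> F k x)"
proof -
  have "bilinear (\<lambda>u v. sd_two_form \<epsilon> F k x u v)"
    unfolding sd_two_form_def using bilinear_tensor[of _ x "[]" "[]" "[]"] by (simp only: append.simps)
  then show ?thesis .
qed

lemma sd_form_antisym: "sd_form \<epsilon> f k b a = - sd_form \<epsilon> f k a b"
  by (cases k; cases a; cases b; simp add: sd_form_def wedge_def)

lemma sd_two_form_antisym: "sd_two_form \<epsilon> F k x v u = - sd_two_form \<epsilon> F k x u v"
proof -
  have "sd_two_form \<epsilon> F k x v u = tensor (\<lambda>is. - comps2 (sd_form \<epsilon> (F (zcoord x)) k) is) x [u, v]"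
    unfolding sd_two_form_def tensor_swap[of _ x v u]
  proof (rule tensor_cong)
    fix "is" :: "ix list" assume "length is = length [u, v]"
    then obtain a b where "is = [a, b]" by (auto simp: length_Suc_conv)
    then show "comps2 (sd_form \<epsilon> (F (zcoord x)) k) (hd (tl is) # hd is # tl (tl is))
        = - comps2 (sd_form \<epsilon> (F (zcoord x)) k) is"
      using sd_form_antisym[of \<epsilon> "F (zcoord x)" k b a] by simp
  qed
  then show ?thesis by (simp only: sd_two_form_def tensor_minus)
qed

lemma sd_two_form_frame:
  assumes "x \<noteq> 0"
  shows "sd_two_form \<epsilon> F k x (frame a x) (frame b x) = sd_form \<epsilon> (F (zcoord x)) k a b"
  unfolding sd_two_form_def by (simp only: tensor_frame[OF assms]) simp

lemma typeD_tensor: "tensor (comps4 (typeD \<epsilon> F C (zcoord x))) x [u, v, w, y]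
   = C (zcoord x) * (\<Sum>k\<in>UNIV. sd_coeff (F (zcoord x)) k * (sd_two_form \<epsilon> F k x u v * sd_two_form \<epsilon> F k x w y))"
proof -
  have "tensor (comps4 (typeD \<epsilon> F C (zcoord x))) x [u, v, w, y]
     = tensor (\<lambda>is. C (zcoord x) * (\<Sum>k\<in>UNIV. sd_coeff (F (zcoord x)) k * comps4 (\<lambda>a b c d. sd_form \<epsilon> (F (zcoord x)) k a b * sd_form \<epsilon> (F (zcoord x)) k c d) is)) x [u, v, w, y]"
    by (rule tensor_cong) (simp add: comps4_def typeD_def)
  then show ?thesis unfolding tensor_scale tensor_sum tensor_mult_12_34 sd_two_form_def .
qed

context biaxial begin

lemma inner2_frame:
  assumes "x \<in> domM I" "bilinear \<alpha>" "bilinear \<beta>"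
  shows "inner2 (g x) \<alpha> \<beta> = 1/2 * (\<Sum>a\<in>UNIV. \<Sum>b\<in>UNIV.
     \<alpha> (frame a x) (frame b x) * \<beta> (frame a x) (frame b x) / (metric_coeff F C (zcoord x) a * metric_coeff F C (zcoord x) b))"
proof -
  have l: "linear (\<alpha> s)" "linear (\<lambda>s. \<alpha> s t)" "linear (\<beta> s)" "linear (\<lambda>s. \<beta> s t)" for s t
    using assms unfolding bilinear_def by blast+
  have "mtrace (g x) (\<lambda>b b'. \<alpha> a b * \<beta> a' b')
     = (\<Sum>b\<in>UNIV. 1 / metric_coeff F C (zcoord x) b * (\<alpha> a (frame b x) * \<beta> a' (frame b x)))" for a a'
    by (subst mtrace_frame[OF assms(1) bilinear_mult[OF l(1,3)]]) simp
  moreover have "bilinear (\<lambda>a a'. \<Sum>b\<in>UNIV. 1 / metric_coeff F C (zcoord x) b * (\<alpha> a (frame b x) * \<beta> a' (frame b x)))"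
    by (intro bilinear_sum bilinear_cmult bilinear_mult l)
  ultimately show ?thesis
    unfolding inner2_def
    by (simp add: mtrace_frame[OF assms(1)] sum_divide_distrib mult.commute)
qed

lemma coframe_Jpm:
  assumes "x \<noteq> 0"
  shows "coframe i x (Jpm \<epsilon> F x u) = (case i of I0 \<Rightarrow> - \<epsilon> * 2 * F (zcoord x) * eta1 x u
     | I1 \<Rightarrow> \<epsilon> * (1 / (2 * F (zcoord x))) * dz x u | I2 \<Rightarrow> - eta3 x u | I3 \<Rightarrow> eta2 x u)"
proof -
  have "Jpm \<epsilon> F x u = (\<Sum>i\<in>UNIV. (case i of I0 \<Rightarrow> - \<epsilon> * 2 * F (zcoord x) * eta1 x u
     | I1 \<Rightarrow> \<epsilon> * (1 / (2 * F (zcoord x))) * dz x u | I2 \<Rightarrow> - eta3 x u | I3 \<Rightarrow> eta2 x u) *\<^sub>R frame i x)"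
    by (simp add: sum_ix Jpm_def)
  then show ?thesis by (simp only: coframe_frame_sum[OF assms])
qed

lemma omega_pm_sd_two_form:
  assumes "x \<in> domM I"
  shows "omega_pm \<epsilon> F C x u v = C (zcoord x) * sd_two_form \<epsilon> F I1 x u v"
proof -
  have x: "x \<noteq> 0" and z: "zcoord x \<in> I" using domM_zcoord[OF assms] by simp_all
  show ?thesis
    unfolding omega_pm_def fund_form_def bmetric_sum coframe_Jpm[OF x]
    using nz[OF z] by (simp add: sum_ix sd_two_form_def sd_form_def wedge_def field_simps)
qed

text \<open>The volume form \<open>\<omega>\<^sup>+ \<and> \<omega>\<^sup>+ / 2\<close> has the value \<open>C\<^sup>2/2\<close> on \<open>(X\<^sub>0, X\<^sub>1, X\<^sub>2, X\<^sub>3)\<close>.\<close>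

definition vol_comps :: "real \<Rightarrow> ix \<Rightarrow> ix \<Rightarrow> ix \<Rightarrow> ix \<Rightarrow> real" where
  "vol_comps z a b c d = (C z)\<^sup>2 / 2 * (wedge I0 I1 a b * wedge I2 I3 c d + wedge I2 I3 a b * wedge I0 I1 c d
     + wedge I0 I2 a b * wedge I3 I1 c d + wedge I3 I1 a b * wedge I0 I2 c d
     + wedge I0 I3 a b * wedge I1 I2 c d + wedge I1 I2 a b * wedge I0 I3 c d)"

lemma vol_form_frame:
  assumes "x \<in> domM I"
  shows "vol_form F C x (frame a x) (frame b x) w y = tensor (comps2 (vol_comps (zcoord x) a b)) x [w, y]"
proof -
  have x: "x \<noteq> 0" and z: "zcoord x \<in> I" using domM_zcoord[OF assms] by simp_all
  have 1: "sd_two_form 1 F I1 x (frame a x) v = (\<Sum>b\<in>UNIV. coframe b x v * sd_form 1 (F (zcoord x)) I1 a b)" for a v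
    by (simp only: sd_two_form_def tensor_frame[OF x]) simp
  show ?thesis
    unfolding vol_form_def vol_of_def omega_pm_sd_two_form[OF assms] sd_two_form_frame[OF x] 1
    by (cases a; cases b; simp add: sum_ix sd_two_form_def sd_form_def vol_comps_def wedge_def)
       (simp_all add: field_simps power2_eq_square)
qed

lemma hodge2_frame:
  assumes "x \<in> domM I" "bilinear \<alpha>"
  shows "hodge2 (g x) (vol_form F C x) \<alpha> w y = 1/2 * (\<Sum>a\<in>UNIV. \<Sum>b\<in>UNIV.
     \<alpha> (frame a x) (frame b x) * tensor (comps2 (vol_comps (zcoord x) a b)) x [w, y] / (metric_coeff F C (zcoord x) a * metric_coeff F C (zcoord x) b))"
proof -
  have b: "bilinear (\<lambda>a b. sd_two_form 1 F I1 x a b)" using bilinear_sd_two_form by simp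
  then have l: "linear (\<lambda>a. sd_two_form 1 F I1 x a b)" "linear (\<lambda>b. sd_two_form 1 F I1 x a b)" for a b
    unfolding bilinear_def by blast+
  have e: "vol_form F C x a b w y = (C (zcoord x))\<^sup>2 * (sd_two_form 1 F I1 x w y * sd_two_form 1 F I1 x a b
      + (- 1 * (sd_two_form 1 F I1 x a w * sd_two_form 1 F I1 x b y) + 1 * (sd_two_form 1 F I1 x a y * sd_two_form 1 F I1 x b w)))" for a b
    by (simp add: vol_form_def vol_of_def omega_pm_sd_two_form[OF assms(1)] algebra_simps power2_eq_square)
  have "bilinear (\<lambda>a b. vol_form F C x a b w y)"
    unfolding e by (intro bilinear_cmult bilinear_add bilinear_mult b l)
  from inner2_frame[OF assms this] show ?thesis
    unfolding hodge2_def vol_form_frame[OF assms(1)] .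
qed

lemma hodge2_sd_two_form:
  assumes "x \<in> domM I" "\<epsilon> \<in> {1, -1}"
  shows "hodge2 (g x) (vol_form F C x) (sd_two_form \<epsilon> F k x) w y = \<epsilon> * sd_two_form \<epsilon> F k x w y"
proof -
  have x: "x \<noteq> 0" and z: "zcoord x \<in> I" using domM_zcoord[OF assms(1)] by simp_all
  show ?thesis
    unfolding hodge2_frame[OF assms(1) bilinear_sd_two_form] sd_two_form_frame[OF x]
    using nz[OF z] assms(2)
    by (cases k; simp add: sum_ix sd_two_form_def sd_form_def vol_comps_def wedge_def)
       (auto simp: field_simps power2_eq_square)
qed

definition sd_comb :: "real \<Rightarrow> point \<Rightarrow> (ix \<Rightarrow> real) \<Rightarrow> point \<Rightarrow> point \<Rightarrow> real" where
  "sd_comb \<epsilon> x m u v = (\<Sum>k\<in>UNIV. m k * sd_two_form \<epsilon> F k x u v)"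

lemma bilinear_sd_comb: "bilinear (sd_comb \<epsilon> x m)"
proof -
  have "bilinear (\<lambda>u v. sd_two_form \<epsilon> F k x u v)" for k using bilinear_sd_two_form by simp
  then have "bilinear (\<lambda>u v. sd_comb \<epsilon> x m u v)"
    unfolding sd_comb_def by (intro bilinear_sum bilinear_cmult)
  then show ?thesis .
qed

lemma hodge2_sd_comb:
  assumes "x \<in> domM I" "\<epsilon> \<in> {1, -1}"
  shows "hodge2 (g x) (vol_form F C x) (sd_comb \<epsilon> x m) w y = \<epsilon> * sd_comb \<epsilon> x m w y"
proof -
  define c where "c a b = tensor (comps2 (vol_comps (zcoord x) a b)) x [w, y] / (metric_coeff F C (zcoord x) a * metric_coeff F C (zcoord x) b)" for a b
  have h: "hodge2 (g x) (vol_form F C x) \<alpha> w y = 1/2 * (\<Sum>a\<in>UNIV. \<Sum>b\<in>UNIV. c a b * \<alpha> (frame a x) (frame b x))"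
    if "bilinear \<alpha>" for \<alpha>
    unfolding hodge2_frame[OF assms(1) that] c_def by (simp add: ac_simps del: tensor.simps)
  have "hodge2 (g x) (vol_form F C x) (sd_comb \<epsilon> x m) w y
      = (\<Sum>k\<in>UNIV. m k * (1/2 * (\<Sum>a\<in>UNIV. \<Sum>b\<in>UNIV. c a b * sd_two_form \<epsilon> F k x (frame a x) (frame b x))))"
    unfolding h[OF bilinear_sd_comb] sd_comb_def
    by (simp only: sum_ix) (simp only: algebra_simps)
  also have "\<dots> = (\<Sum>k\<in>UNIV. m k * (\<epsilon> * sd_two_form \<epsilon> F k x w y))"
    unfolding h[OF bilinear_sd_two_form, symmetric] hodge2_sd_two_form[OF assms] ..
  finally show ?thesis by (simp add: sd_comb_def sum_distrib_left mult.left_commute)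
qed

text \<open>Every form occurring in the Weyl tensor is a sum of a self-dual and an anti-self-dual combination, so
  the projection selects one summand.\<close>

lemma proj_pm_sd_comb:
  assumes "x \<in> domM I" "\<epsilon> \<in> {1, -1}"
  shows "proj_pm \<epsilon> (g x) (vol_form F C x) (\<lambda>c d. sd_comb 1 x m c d + sd_comb (-1) x n c d) w y
     = sd_comb \<epsilon> x (if \<epsilon> = 1 then m else n) w y"
proof -
  have b: "bilinear (\<lambda>c d. sd_comb 1 x m c d + sd_comb (-1) x n c d)"
    using bilinear_add[OF bilinear_sd_comb bilinear_sd_comb] .
  have "hodge2 (g x) (vol_form F C x) (\<lambda>c d. sd_comb 1 x m c d + sd_comb (-1) x n c d) w y
     = hodge2 (g x) (vol_form F C x) (sd_comb 1 x m) w y + hodge2 (g x) (vol_form F C x) (sd_comb (-1) x n) w y"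
    unfolding hodge2_frame[OF assms(1) b] hodge2_frame[OF assms(1) bilinear_sd_comb]
    by (simp add: distrib_left distrib_right sum.distrib add_divide_distrib)
  then show ?thesis
    using assms by (auto simp: proj_pm_def hodge2_sd_comb)
qed

lemma Weyl_sd_comb:
  assumes "x \<in> domM I"
  shows "Weyl g x a b c d
     = sd_comb 1 x (\<lambda>k. (Lop 1 F (zcoord x) - 1) * C (zcoord x) * sd_coeff (F (zcoord x)) k * sd_two_form 1 F k x a b) c d
     + sd_comb (-1) x (\<lambda>k. (Lop (-1) F (zcoord x) - 1) * C (zcoord x) * sd_coeff (F (zcoord x)) k * sd_two_form (-1) F k x a b) c d"
proof -
  have "Weyl g x a b c d = tensor (\<lambda>is. (Lop 1 F (zcoord x) - 1) * comps4 (typeD 1 F C (zcoord x)) is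
     + (Lop (-1) F (zcoord x) - 1) * comps4 (typeD (-1) F C (zcoord x)) is) x [a, b, c, d]"
    unfolding Weyl_tensor[OF assms] by (rule tensor_cong) (simp add: comps4_def)
  then show ?thesis
    unfolding tensor_add tensor_scale typeD_tensor sd_comb_def by (simp only: sum_distrib_left mult.assoc)
qed

lemma W_pm_sum:
  assumes "x \<in> domM I" "\<epsilon> \<in> {1, -1}"
  shows "W_pm \<epsilon> F C x u v w y = (Lop \<epsilon> F (zcoord x) - 1) * (C (zcoord x) *
     (\<Sum>k\<in>UNIV. sd_coeff (F (zcoord x)) k * (sd_two_form \<epsilon> F k x u v * sd_two_form \<epsilon> F k x w y)))"
proof -
  define m where "m \<epsilon> k = (Lop \<epsilon> F (zcoord x) - 1) * C (zcoord x) * sd_coeff (F (zcoord x)) k" for \<epsilon> k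
  have "proj_pm \<epsilon> (g x) (vol_form F C x) (\<lambda>c d. Weyl g x a b c d) w y
     = sd_comb \<epsilon> x (\<lambda>k. m \<epsilon> k * sd_two_form \<epsilon> F k x a b) w y" for a b
    unfolding Weyl_sd_comb[OF assms(1)] proj_pm_sd_comb[OF assms] using assms(2) by (auto simp: m_def)
  also have "sd_comb \<epsilon> x (\<lambda>k. m \<epsilon> k * sd_two_form \<epsilon> F k x a b) w y
     = sd_comb 1 x (if \<epsilon> = 1 then (\<lambda>k. m \<epsilon> k * sd_two_form \<epsilon> F k x w y) else (\<lambda>k. 0)) a b
     + sd_comb (-1) x (if \<epsilon> = 1 then (\<lambda>k. 0) else (\<lambda>k. m \<epsilon> k * sd_two_form \<epsilon> F k x w y)) a b" for a b
    using assms(2) by (auto simp: sd_comb_def mult_ac)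
  finally have "W_pm \<epsilon> F C x u v w y = sd_comb \<epsilon> x (\<lambda>k. m \<epsilon> k * sd_two_form \<epsilon> F k x w y) u v"
    unfolding W_pm_def Weyl_pm_def using assms(2) by (auto simp: proj_pm_sd_comb[OF assms])
  then show ?thesis by (simp add: sd_comb_def m_def sum_distrib_left mult_ac)
qed

lemma W_pm_tensor:
  assumes "x \<in> domM I" "\<epsilon> \<in> {1, -1}"
  shows "W_pm \<epsilon> F C x u v w y
     = tensor (comps4 (\<lambda>a b c d. (Lop \<epsilon> F (zcoord x) - 1) * typeD \<epsilon> F C (zcoord x) a b c d)) x [u, v, w, y]"
proof -
  have "tensor (comps4 (\<lambda>a b c d. (Lop \<epsilon> F (zcoord x) - 1) * typeD \<epsilon> F C (zcoord x) a b c d)) x [u, v, w, y]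
     = tensor (\<lambda>is. (Lop \<epsilon> F (zcoord x) - 1) * comps4 (typeD \<epsilon> F C (zcoord x)) is) x [u, v, w, y]"
    by (rule tensor_cong) (simp add: comps4_def)
  then show ?thesis unfolding tensor_scale typeD_tensor W_pm_sum[OF assms] by simp
qed

text \<open>Antisymmetry and (anti-)self-duality determine \<open>\<alpha>\<close> by its components \<open>01\<close>, \<open>02\<close> and \<open>03\<close>. The
  coefficients are the inverse squared norms of the orthogonal forms \<^const>\<open>sd_two_form\<close>.\<close>

lemma Lambda_pm_expansion:
  assumes "x \<in> domM I" "\<epsilon> \<in> {1, -1}" and \<alpha>: "\<alpha> \<in> Lambda_pm \<epsilon> (g x) (vol_form F C x)"
  defines "s \<equiv> \<lambda>k. inner2 (g x) \<alpha> (sd_two_form \<epsilon> F k x)"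
  shows "\<alpha> u v = (C (zcoord x))\<^sup>2 / 2 * s I1 * sd_two_form \<epsilon> F I1 x u v
     + (C (zcoord x))\<^sup>2 / (8 * F (zcoord x)) * (s I2 * sd_two_form \<epsilon> F I2 x u v + s I3 * sd_two_form \<epsilon> F I3 x u v)"
proof -
  have x: "x \<noteq> 0" and z: "zcoord x \<in> I" using domM_zcoord[OF assms(1)] by simp_all
  have b: "bilinear \<alpha>" and anti: "\<alpha> u v = - \<alpha> v u" and dual: "hodge2 (g x) (vol_form F C x) \<alpha> u v = \<epsilon> * \<alpha> u v" for u v
    using \<alpha> unfolding Lambda_pm_def by blast+
  have l: "linear (\<alpha> s)" "linear (\<lambda>s. \<alpha> s t)" for s t
    using b unfolding bilinear_def by blast+
  define A where "A i j = \<alpha> (frame i x) (frame j x)" for i j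
  have anti': "A i j = - A j i" for i j unfolding A_def by (rule anti)
  have A0: "A i i = 0" for i using anti'[of i i] by simp
  note An = anti'[of I1 I0] anti'[of I2 I0] anti'[of I3 I0] anti'[of I2 I1] anti'[of I1 I3] anti'[of I3 I2]
  have "\<epsilon> * A i j = 1/2 * (\<Sum>a\<in>UNIV. \<Sum>b\<in>UNIV. A a b * vol_comps (zcoord x) a b i j / (metric_coeff F C (zcoord x) a * metric_coeff F C (zcoord x) b))" for i j
    using dual[of "frame i x" "frame j x"]
    unfolding hodge2_frame[OF assms(1) b] tensor_frame[OF x] A_def by simp
  from this[of I0 I1] this[of I0 I2] this[of I0 I3]
  have D: "\<epsilon> * A I0 I1 = A I2 I3 / 2" "\<epsilon> * A I0 I2 = A I3 I1 / (2 * F (zcoord x))" "\<epsilon> * A I0 I3 = A I1 I2 / (2 * F (zcoord x))"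
    using nz[OF z] by (simp_all add: sum_ix vol_comps_def wedge_def An A0 field_simps power2_eq_square)
  have e2: "\<epsilon> * \<epsilon> = 1" using assms(2) by auto
  have D': "A I2 I3 = 2 * \<epsilon> * A I0 I1" "A I3 I1 = 2 * \<epsilon> * F (zcoord x) * A I0 I2" "A I1 I2 = 2 * \<epsilon> * F (zcoord x) * A I0 I3"
    using D nz[OF z] by (simp_all add: field_simps)
  have "\<alpha> u v = \<alpha> (\<Sum>i\<in>UNIV. coframe i x u *\<^sub>R frame i x) (\<Sum>j\<in>UNIV. coframe j x v *\<^sub>R frame j x)"
    by (simp flip: frame_expansion[OF x])
  also have "\<dots> = (\<Sum>i\<in>UNIV. coframe i x u * (\<Sum>j\<in>UNIV. coframe j x v * A i j))"
    unfolding A_def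
    by (simp only: linear_sum[OF l(2)] linear_sum[OF l(1)] linear_scale[OF l(2)] linear_scale[OF l(1)] real_scaleR_def)
       (simp only: sum_distrib_left, subst sum.swap, simp only: mult.left_commute)
  finally have \<alpha>: "\<alpha> u v = (\<Sum>i\<in>UNIV. coframe i x u * (\<Sum>j\<in>UNIV. coframe j x v * A i j))" .
  have s: "s k = 1/2 * (\<Sum>a\<in>UNIV. \<Sum>b\<in>UNIV. A a b * sd_form \<epsilon> (F (zcoord x)) k a b / (metric_coeff F C (zcoord x) a * metric_coeff F C (zcoord x) b))" for k
    unfolding s_def inner2_frame[OF assms(1) b bilinear_sd_two_form] sd_two_form_frame[OF x] A_def ..
  show ?thesis
    unfolding \<alpha> s using assms(2) nz[OF z]
    by (elim insertE emptyE; simp add: sum_ix sd_two_form_def sd_form_def wedge_def An A0 D' )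
       (simp_all add: field_simps power2_eq_square)
qed

lemma curv_op_W_pm:
  assumes "x \<in> domM I" "\<epsilon> \<in> {1, -1}" and \<alpha>: "\<alpha> \<in> Lambda_pm \<epsilon> (g x) (vol_form F C x)"
  shows "curv_op (g x) (W_pm \<epsilon> F C x) \<alpha> u v = - (1 / C (zcoord x)) * (Lop \<epsilon> F (zcoord x) - 1)
           * (inner2 (g x) (omega_pm \<epsilon> F C x) \<alpha> * omega_pm \<epsilon> F C x u v - 2/3 * \<alpha> u v)"
proof -
  have x: "x \<noteq> 0" and z: "zcoord x \<in> I" using domM_zcoord[OF assms(1)] by simp_all
  define s where "s k = inner2 (g x) \<alpha> (sd_two_form \<epsilon> F k x)" for k
  define m where "m k = (Lop \<epsilon> F (zcoord x) - 1) * (C (zcoord x) * (sd_coeff (F (zcoord x)) k * sd_two_form \<epsilon> F k x u v))" for k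
  have b: "bilinear \<alpha>" using \<alpha> unfolding Lambda_pm_def by blast
  have W: "W_pm \<epsilon> F C x u v w y = (\<Sum>k\<in>UNIV. m k * sd_two_form \<epsilon> F k x w y)" for w y
    unfolding W_pm_sum[OF assms(1,2)] m_def by (simp add: sum_distrib_left mult_ac)
  have i: "inner2 (g x) \<alpha> (\<lambda>a b. \<Sum>k\<in>UNIV. n k * sd_two_form \<epsilon> F k x a b) = (\<Sum>k\<in>UNIV. n k * s k)" for n
  proof -
    have b': "bilinear (\<lambda>a b. \<Sum>k\<in>UNIV. n k * sd_two_form \<epsilon> F k x a b)"
      using bilinear_sd_comb[of \<epsilon> x n] unfolding sd_comb_def[abs_def] .
    show ?thesis unfolding s_def inner2_frame[OF assms(1) b b'] inner2_frame[OF assms(1) b bilinear_sd_two_form]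
      by (simp only: sum_ix) (simp only: algebra_simps add_divide_distrib times_divide_eq_right)
  qed
  have "curv_op (g x) (W_pm \<epsilon> F C x) \<alpha> u v = inner2 (g x) \<alpha> (\<lambda>a b. \<Sum>k\<in>UNIV. (- m k) * sd_two_form \<epsilon> F k x a b)"
    unfolding curv_op_def W by (subst sd_two_form_antisym) (simp add: sum_negf)
  then have 1: "curv_op (g x) (W_pm \<epsilon> F C x) \<alpha> u v = (\<Sum>k\<in>UNIV. - m k * s k)" by (simp only: i)
  have \<omega>: "omega_pm \<epsilon> F C x = (\<lambda>a b. \<Sum>k\<in>UNIV. (if k = I1 then C (zcoord x) else 0) * sd_two_form \<epsilon> F k x a b)"
    by (intro ext) (simp add: omega_pm_sd_two_form[OF assms(1)] sum_ix)
  have "bilinear (omega_pm \<epsilon> F C x)"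
    unfolding \<omega> sd_comb_def[symmetric] by (rule bilinear_sd_comb)
  then have "inner2 (g x) (omega_pm \<epsilon> F C x) \<alpha> = inner2 (g x) \<alpha> (omega_pm \<epsilon> F C x)"
    using b by (simp add: inner2_frame[OF assms(1)] mult.commute)
  then have 2: "inner2 (g x) (omega_pm \<epsilon> F C x) \<alpha> = C (zcoord x) * s I1" by (simp only: \<omega> i) (simp add: sum_ix)
  show ?thesis
    unfolding 1 2 omega_pm_sd_two_form[OF assms(1)] Lambda_pm_expansion[OF assms(1,2) \<alpha>, of u v, folded s_def]
    using nz[OF z] by (simp add: sum_ix m_def sd_coeff_def field_simps power2_eq_square)
qed

end

section \<open>Divergence of the self-dual and anti-self-dual parts\<close>

definition sd_form' :: "real \<Rightarrow> real \<Rightarrow> ix \<Rightarrow> ix \<Rightarrow> ix \<Rightarrow> real" where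
  "sd_form' \<epsilon> f1 k a b = (case k of I2 \<Rightarrow> 2 * \<epsilon> * f1 * wedge I3 I1 a b
     | I3 \<Rightarrow> 2 * \<epsilon> * f1 * wedge I1 I2 a b
     | _ \<Rightarrow> 0)"

definition sd_coeff' :: "real \<Rightarrow> real \<Rightarrow> ix \<Rightarrow> real" where
  "sd_coeff' f f1 k = (case k of I0 \<Rightarrow> 0 | I1 \<Rightarrow> 0 | _ \<Rightarrow> f1 / (12 * f\<^sup>2))"

definition typeD' :: "real \<Rightarrow> (real \<Rightarrow> real) \<Rightarrow> (real \<Rightarrow> real) \<Rightarrow> real \<Rightarrow> ix \<Rightarrow> ix \<Rightarrow> ix \<Rightarrow> ix \<Rightarrow> real" where
  "typeD' \<epsilon> F C z a b c d =
     deriv C z * (\<Sum>k\<in>UNIV. sd_coeff (F z) k * (sd_form \<epsilon> (F z) k a b * sd_form \<epsilon> (F z) k c d))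
     + C z * (\<Sum>k\<in>UNIV. sd_coeff' (F z) (deriv F z) k * (sd_form \<epsilon> (F z) k a b * sd_form \<epsilon> (F z) k c d)
        + sd_coeff (F z) k * (sd_form' \<epsilon> (deriv F z) k a b * sd_form \<epsilon> (F z) k c d
            + sd_form \<epsilon> (F z) k a b * sd_form' \<epsilon> (deriv F z) k c d))"

lemma slot_action_has_derivative:
  assumes "\<And>i m. ((\<lambda>z. A z i m) has_real_derivative A' i m) (at z)"
    and "\<And>js. length js = length is \<Longrightarrow> ((\<lambda>z. t z js) has_real_derivative t' js) (at z)"
  shows "((\<lambda>z. slot_action (A z) (t z) is) has_real_derivative slot_action A' (t z) is + slot_action (A z) t' is) (at z)"
  using assms(2)
proof (induction "is" arbitrary: t t')
  case (Cons i "is")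
  have "((\<lambda>z. slot_action (A z) (\<lambda>is. t z (i # is)) is) has_real_derivative
      slot_action A' (\<lambda>is. t z (i # is)) is + slot_action (A z) (\<lambda>is. t' (i # is)) is) (at z)"
    by (rule Cons.IH) (simp add: Cons.prems)
  moreover have "((\<lambda>z. t z (m # is)) has_real_derivative t' (m # is)) (at z)" for m
    by (simp add: Cons.prems)
  ultimately show ?case
    by (auto intro!: derivative_eq_intros assms(1) simp: sum.distrib ac_simps)
qed simp

text \<open>For covariant derivatives of second order.\<close>

lemma cov_comps_has_derivative:
  assumes "\<And>i j k. ((\<lambda>z. G z i j k) has_real_derivative G' i j k) (at z)"
    and "\<And>is. length is = n \<Longrightarrow> ((\<lambda>z. t z is) has_real_derivative t' z is) (at z)"
    and "\<And>is. length is = n \<Longrightarrow> ((\<lambda>z. t' z is) has_real_derivative t'' is) (at z)"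
    and "length is = Suc n"
  shows "((\<lambda>z. cov_comps (G z) (t' z) (t z) is) has_real_derivative
      cov_comps (G z) t'' (t' z) is - slot_action (G' (hd is)) (t z) (tl is)) (at z)"
proof -
  have l: "length (tl is) = n" using assms(4) by simp
  have "((\<lambda>z. slot_action (G z (hd is)) (t z) (tl is)) has_real_derivative
      slot_action (G' (hd is)) (t z) (tl is) + slot_action (G z (hd is)) (t' z) (tl is)) (at z)"
    by (rule slot_action_has_derivative) (simp_all add: assms l)
  moreover have "((\<lambda>z. t' z (tl is)) has_real_derivative t'' (tl is)) (at z)" using assms(3) l by simp
  ultimately show ?thesis unfolding cov_comps_def
    by (auto intro!: derivative_eq_intros)
qed

context biaxial begin

lemma typeD_deriv:
  assumes "z \<in> I"
  shows "((\<lambda>z. typeD \<epsilon> F C z a b c d) has_real_derivative typeD' \<epsilon> F C z a b c d) (at z)"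
proof -
  have 1: "((\<lambda>z. sd_form \<epsilon> (F z) k a b) has_real_derivative sd_form' \<epsilon> (deriv F z) k a b) (at z)" for k a b
    using assms by (cases k) (auto simp: sd_form_def sd_form'_def intro!: derivative_eq_intros jets)
  have 2: "((\<lambda>z. sd_coeff (F z) k) has_real_derivative sd_coeff' (F z) (deriv F z) k) (at z)" for k
    using assms nz[OF assms]
    by (cases k) (auto simp: sd_coeff_def sd_coeff'_def power2_eq_square intro!: derivative_eq_intros jets)
  show ?thesis unfolding typeD_def typeD'_def
    by (rule derivative_eq_intros jets assms 1 2 refl)+
      (simp add: algebra_simps sum.distrib sum_distrib_left)
qed

lemma cov4_tensor:
  assumes x: "x \<in> domM I"
    and T: "\<And>y a b c d. y \<in> domM I \<Longrightarrow> T y a b c d = tensor (t (zcoord y)) y [a, b, c, d]"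
    and t: "\<And>is. length is = 4 \<Longrightarrow> ((\<lambda>z. t z is) has_real_derivative t' is) (at (zcoord x))"
  shows "cov4 g T x s a b c d = tensor (cov_comps (conn_coeff F C (zcoord x)) t' (t (zcoord x))) x [s, a, b, c, d]"
proof -
  have "dir_deriv (\<lambda>y. T y a b c d) x s
      - slot_sum (bilin (\<lambda>a b c. conn_coeff F C (zcoord x) a b c - flat_coeff a b c) x s) (tensor (t (zcoord x)) x) [a, b, c, d]
    = tensor (cov_comps (conn_coeff F C (zcoord x)) t' (t (zcoord x))) x [s, a, b, c, d]"
    using t by (intro cov_tensor[OF x open_domM domM_zcoord(1)[OF x]] T) simp_all
  then show ?thesis
    by (simp add: cov4_def T[OF x] christoffel_eq[OF x] del: tensor.simps)
qed

lemma cov5_tensor: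
  assumes x: "x \<in> domM I"
    and T: "\<And>y a b c d e. y \<in> domM I \<Longrightarrow> T y a b c d e = tensor (t (zcoord y)) y [a, b, c, d, e]"
    and t: "\<And>is. length is = 5 \<Longrightarrow> ((\<lambda>z. t z is) has_real_derivative t' is) (at (zcoord x))"
  shows "cov5 g T x s a b c d e = tensor (cov_comps (conn_coeff F C (zcoord x)) t' (t (zcoord x))) x [s, a, b, c, d, e]"
proof -
  have "dir_deriv (\<lambda>y. T y a b c d e) x s
      - slot_sum (bilin (\<lambda>a b c. conn_coeff F C (zcoord x) a b c - flat_coeff a b c) x s) (tensor (t (zcoord x)) x) [a, b, c, d, e]
    = tensor (cov_comps (conn_coeff F C (zcoord x)) t' (t (zcoord x))) x [s, a, b, c, d, e]"
    using t by (intro cov_tensor[OF x open_domM domM_zcoord(1)[OF x]] T) simp_all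
  then show ?thesis
    by (simp add: cov5_def T[OF x] christoffel_eq[OF x] del: tensor.simps)
qed

text \<open>This is the formula for \<open>\<delta>W\<^sup>\<plusminus>\<close> without the division by \<open>\<L>\<^sup>\<plusminus>F - 1\<close>; it holds for every multiple \<open>u\<close> of
  the type D tensor. The factor \<open>4F/C\<close> raises the index of \<open>dz\<close>.\<close>

lemma divergence_components:
  assumes "z \<in> I" "\<epsilon> \<in> {1, -1}"
  shows "(\<Sum>s\<in>UNIV. cov_comps (conn_coeff F C z) (comps4 (\<lambda>a b c d. u' * typeD \<epsilon> F C z a b c d + u * typeD' \<epsilon> F C z a b c d))
         (comps4 (\<lambda>a b c d. u * typeD \<epsilon> F C z a b c d)) [s, s, i, j, k] / metric_coeff F C z s)
     = 4 * F z / C z * ((3/2 * \<epsilon> + dlog C z / 2) * u + u') * typeD \<epsilon> F C z I0 i j k"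
proof -
  note defs = typeD_def typeD'_def sd_form_def sd_form'_def sd_coeff_def sd_coeff'_def wedge_def dlog_def
  show ?thesis
    using assms(2) nz[OF assms(1)]
    \<comment> \<open>The vanishing connection coefficients are eliminated before the components of the type D
      tensor are expanded, which keeps the remaining rational identities short.\<close>
    by (elim insertE emptyE)
       (cases i; cases j; cases k; hypsubst; simp add: cov_comps_def sum_ix;
        (simp add: sum_ix defs; (simp add: field_simps power2_eq_square)?)?)+
qed

end

section \<open>The double divergence of the Weyl tensor\<close>

definition trace_comps :: "(ix list \<Rightarrow> real) \<Rightarrow> (ix \<Rightarrow> real) \<Rightarrow> ix list \<Rightarrow> real" where
  "trace_comps t h is = (\<Sum>s\<in>UNIV. t (s # s # is) / h s)"

lemma slot_action_cong:
  assumes "\<And>js. length js = length is \<Longrightarrow> t js = t' js" shows "slot_action A t is = slot_action A t' is"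
  using assms
proof (induction "is" arbitrary: t t')
  case (Cons i "is")
  have "slot_action A (\<lambda>is. t (i # is)) is = slot_action A (\<lambda>is. t' (i # is)) is"
    by (rule Cons.IH) (simp add: Cons.prems)
  then show ?case by (simp add: Cons.prems)
qed simp

lemma cov_comps_cong:
  assumes "\<And>js. length js = n \<Longrightarrow> t js = u js" "\<And>js. length js = n \<Longrightarrow> t' js = u' js" "length is = Suc n"
  shows "cov_comps G t' t is = cov_comps G u' u is"
  using assms slot_action_cong[of "tl is" t u "G (hd is)"] by (simp add: cov_comps_def)

lemma slot_action_sum_div: "slot_action A (\<lambda>js. \<Sum>s\<in>UNIV. t s js / h s) is = (\<Sum>s\<in>UNIV. slot_action A (t s) is / h s)"
proof (induction "is" arbitrary: t)
  case (Cons i "is")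
  have "(\<Sum>m\<in>UNIV. A i m * (\<Sum>s\<in>UNIV. t s (m # is) / h s)) = (\<Sum>s\<in>UNIV. (\<Sum>m\<in>UNIV. A i m * t s (m # is)) / h s)"
    by (simp add: sum_distrib_left sum_divide_distrib) (rule sum.swap)
  then show ?case by (simp add: Cons sum.distrib add_divide_distrib)
qed simp

lemma cov_comps_add: "cov_comps G (\<lambda>is. t' is + u' is) (\<lambda>is. t is + u is) is = cov_comps G t' t is + cov_comps G u' u is"
proof -
  have "slot_action A (\<lambda>is. t is + u is) js = slot_action A t js + slot_action A u js" for A js
    by (induction js arbitrary: t u) (simp_all add: distrib_left sum.distrib)
  then show ?thesis by (simp add: cov_comps_def)
qed

context biaxial begin

text \<open>Traces commute with the covariant derivative of a metric connection. Hence the double divergence of the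
  Weyl tensor is the divergence of its divergence, for which the explicit formula is known. The \<open>z\<close>-derivative of the
  trace includes the one of the inverse metric coefficients.\<close>

lemma cov_comps_trace:
  assumes z: "z \<in> I"
  shows "(\<Sum>s\<in>UNIV. cov_comps (conn_coeff F C z) t' t (a # s # s # is) / metric_coeff F C z s)
    = cov_comps (conn_coeff F C z) (\<lambda>is. \<Sum>s\<in>UNIV. t' (s # s # is) / metric_coeff F C z s - t (s # s # is) * metric_coeff' F C z s / (metric_coeff F C z s)\<^sup>2)
        (trace_comps t (metric_coeff F C z)) (a # is)"
proof -
  have gz: "metric_coeff F C z s \<noteq> 0" for s using metric_coeff_nz[OF z] .
  define X where "X s m = t (s # m # is)" for s m
  define G where "G = conn_coeff F C z a"
  have "(\<Sum>s\<in>UNIV. (\<Sum>m\<in>UNIV. G s m * X m s) / metric_coeff F C z s) + (\<Sum>s\<in>UNIV. (\<Sum>m\<in>UNIV. G s m * X s m) / metric_coeff F C z s)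
      = (\<Sum>s\<in>UNIV. \<Sum>m\<in>UNIV. G m s * X s m / metric_coeff F C z m) + (\<Sum>s\<in>UNIV. \<Sum>m\<in>UNIV. G s m * X s m / metric_coeff F C z s)"
    by (subst sum.swap) (simp add: sum_divide_distrib)
  also have "\<dots> = (\<Sum>s\<in>UNIV. \<Sum>m\<in>UNIV. X s m * ((G s m * metric_coeff F C z m + G m s * metric_coeff F C z s) / (metric_coeff F C z s * metric_coeff F C z m)))"
    unfolding sum.distrib[symmetric] using gz by (intro sum.cong refl) (simp add: field_simps)
  also have "\<dots> = (\<Sum>s\<in>UNIV. if a = I0 then X s s * metric_coeff' F C z s / (metric_coeff F C z s)\<^sup>2 else 0)"
    unfolding G_def conn_coeff_metric[OF z]
    by (cases "a = I0")
       (simp_all add: power2_eq_square if_distrib[of "\<lambda>t. _ * t"] if_distrib[of "\<lambda>t. t / _"] cong: if_cong)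
  finally have 1: "(\<Sum>s\<in>UNIV. (\<Sum>m\<in>UNIV. G s m * X m s) / metric_coeff F C z s) + (\<Sum>s\<in>UNIV. (\<Sum>m\<in>UNIV. G s m * X s m) / metric_coeff F C z s)
      = (\<Sum>s\<in>UNIV. if a = I0 then X s s * metric_coeff' F C z s / (metric_coeff F C z s)\<^sup>2 else 0)" .
  have 2: "slot_action G (\<lambda>is. \<Sum>s\<in>UNIV. t (s # s # is) / metric_coeff F C z s) is = (\<Sum>s\<in>UNIV. slot_action G (\<lambda>is. t (s # s # is)) is / metric_coeff F C z s)"
    by (rule slot_action_sum_div)
  show ?thesis
    unfolding cov_comps_def trace_comps_def[abs_def] list.sel slot_action.simps G_def[symmetric] X_def[symmetric] 2
    using 1 by (cases "a = I0") (simp_all add: sum_subtractf sum_negf sum.distrib diff_divide_distrib add_divide_distrib)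
qed

text \<open>The factors of the type D tensors in the Weyl tensor, together with two derivatives.\<close>

definition lop_factor :: "real \<Rightarrow> real \<Rightarrow> real" where "lop_factor \<epsilon> z = Lop \<epsilon> F z - 1"
definition lop_factor' :: "real \<Rightarrow> real \<Rightarrow> real" where
  "lop_factor' \<epsilon> z = 1/2 * deriv (deriv (deriv F)) z - 3/2 * \<epsilon> * deriv (deriv F) z + deriv F z"
definition lop_factor'' :: "real \<Rightarrow> real \<Rightarrow> real" where
  "lop_factor'' \<epsilon> z = 1/2 * deriv (deriv (deriv (deriv F))) z - 3/2 * \<epsilon> * deriv (deriv (deriv F)) z + deriv (deriv F) z"

lemma lop_factor_deriv:
  assumes "z \<in> I" "\<epsilon> \<in> {1, -1}"
  shows "(lop_factor \<epsilon> has_real_derivative lop_factor' \<epsilon> z) (at z)" "(lop_factor' \<epsilon> has_real_derivative lop_factor'' \<epsilon> z) (at z)"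
proof -
  have "((\<lambda>z. 1/2 * deriv (deriv F) z - 3/2 * \<epsilon> * deriv F z + F z - 1) has_real_derivative lop_factor' \<epsilon> z) (at z)"
    unfolding lop_factor'_def using assms(1) by (auto intro!: derivative_eq_intros jets)
  then show "(lop_factor \<epsilon> has_real_derivative lop_factor' \<epsilon> z) (at z)"
    by (rule has_field_derivative_transform_within_open[OF _ open_I assms(1)]) (simp add: lop_factor_def Lop_eq[OF _ assms(2)])
  show "(lop_factor' \<epsilon> has_real_derivative lop_factor'' \<epsilon> z) (at z)"
    unfolding lop_factor'_def[abs_def] lop_factor''_def using assms(1) by (auto intro!: derivative_eq_intros jets)
qed

definition Weyl_comps :: "real \<Rightarrow> ix list \<Rightarrow> real" where
  "Weyl_comps z = comps4 (\<lambda>a b c d. lop_factor 1 z * typeD 1 F C z a b c d + lop_factor (-1) z * typeD (-1) F C z a b c d)"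
definition Weyl_comps' :: "real \<Rightarrow> ix list \<Rightarrow> real" where
  "Weyl_comps' z = comps4 (\<lambda>a b c d. (lop_factor' 1 z * typeD 1 F C z a b c d + lop_factor 1 z * typeD' 1 F C z a b c d)
     + (lop_factor' (-1) z * typeD (-1) F C z a b c d + lop_factor (-1) z * typeD' (-1) F C z a b c d))"

text \<open>Only the existence of second derivatives of the Weyl tensor matters: by \<open>cov_comps_trace\<close>, its double
  divergence depends on them only through the derivative of the explicit divergence.\<close>

definition Weyl_comps'' :: "real \<Rightarrow> ix list \<Rightarrow> real" where
  "Weyl_comps'' z is = deriv (\<lambda>z. Weyl_comps' z is) z"

lemma typeD'_differentiable:
  assumes "z \<in> I" shows "(\<lambda>z. typeD' \<epsilon> F C z a b c d) differentiable (at z)"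
proof -
  have j: "F differentiable (at z)" "deriv F differentiable (at z)" "C differentiable (at z)" "deriv C differentiable (at z)"
    using jets[OF assms] real_differentiable_def by blast+
  have 1: "(\<lambda>z. sd_form \<epsilon> (F z) k a b) differentiable (at z)" for k a b
    using j by (cases k) (simp_all add: sd_form_def)
  have 2: "(\<lambda>z. sd_form' \<epsilon> (deriv F z) k a b) differentiable (at z)" for k a b
    using j by (cases k) (simp_all add: sd_form'_def)
  have 3: "(\<lambda>z. sd_coeff (F z) k) differentiable (at z)" for k
    using j nz[OF assms] by (cases k) (simp_all add: sd_coeff_def)
  have 4: "(\<lambda>z. sd_coeff' (F z) (deriv F z) k) differentiable (at z)" for k
    using j nz[OF assms] by (cases k) (simp_all add: sd_coeff'_def)
  show ?thesis unfolding typeD'_def sum_ix by (intro derivative_intros j 1 2 3 4)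
qed

lemma Weyl_comps_deriv:
  assumes "z \<in> I"
  shows "((\<lambda>z. Weyl_comps z is) has_real_derivative Weyl_comps' z is) (at z)"
    and "((\<lambda>z. Weyl_comps' z is) has_real_derivative Weyl_comps'' z is) (at z)"
proof -
  show "((\<lambda>z. Weyl_comps z is) has_real_derivative Weyl_comps' z is) (at z)"
    unfolding Weyl_comps_def Weyl_comps'_def comps4_def
    using assms by (auto intro!: derivative_eq_intros lop_factor_deriv typeD_deriv)
  have u: "lop_factor \<epsilon> differentiable (at z)" "lop_factor' \<epsilon> differentiable (at z)" if "\<epsilon> \<in> {1, -1}" for \<epsilon>
    using lop_factor_deriv[OF assms that] real_differentiable_def by blast+
  have w: "(\<lambda>z. typeD \<epsilon> F C z a b c d) differentiable (at z)" for \<epsilon> a b c d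
    using typeD_deriv[OF assms] real_differentiable_def by blast
  have "(\<lambda>z. Weyl_comps' z is) differentiable (at z)"
    unfolding Weyl_comps'_def comps4_def by (intro derivative_intros u w typeD'_differentiable assms) simp_all
  then show "((\<lambda>z. Weyl_comps' z is) has_real_derivative Weyl_comps'' z is) (at z)"
    unfolding Weyl_comps''_def by (simp add: DERIV_deriv_iff_real_differentiable)
qed

lemma Weyl_tensor_comps: "x \<in> domM I \<Longrightarrow> Weyl g x u v w y = tensor (Weyl_comps (zcoord x)) x [u, v, w, y]"
  by (simp only: Weyl_tensor Weyl_comps_def lop_factor_def)

definition nabla_Weyl :: "real \<Rightarrow> ix list \<Rightarrow> real" where
  "nabla_Weyl z = cov_comps (conn_coeff F C z) (Weyl_comps' z) (Weyl_comps z)"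
definition nabla_Weyl' :: "real \<Rightarrow> ix list \<Rightarrow> real" where
  "nabla_Weyl' z is = cov_comps (conn_coeff F C z) (Weyl_comps'' z) (Weyl_comps' z) is - slot_action (conn_coeff' F C z (hd is)) (Weyl_comps z) (tl is)"

lemma nabla_Weyl_deriv:
  "z \<in> I \<Longrightarrow> length is = 5 \<Longrightarrow> ((\<lambda>z. nabla_Weyl z is) has_real_derivative nabla_Weyl' z is) (at z)"
  unfolding nabla_Weyl_def nabla_Weyl'_def
  by (rule cov_comps_has_derivative[where n = 4]) (auto intro: conn_coeff_deriv Weyl_comps_deriv)

lemma cov4_Weyl: "x \<in> domM I \<Longrightarrow> cov4 g (Weyl g) x s a b c d = tensor (nabla_Weyl (zcoord x)) x [s, a, b, c, d]"
  unfolding nabla_Weyl_def by (rule cov4_tensor) (auto simp: Weyl_tensor_comps domM_zcoord intro: Weyl_comps_deriv simp del: tensor.simps)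

lemma cov5_Weyl:
  "x \<in> domM I \<Longrightarrow> cov5 g (cov4 g (Weyl g)) x r s a b c d
     = tensor (cov_comps (conn_coeff F C (zcoord x)) (nabla_Weyl' (zcoord x)) (nabla_Weyl (zcoord x))) x [r, s, a, b, c, d]"
  by (rule cov5_tensor) (auto simp: cov4_Weyl domM_zcoord intro: nabla_Weyl_deriv simp del: tensor.simps)

definition div_factor :: "real \<Rightarrow> real \<Rightarrow> real" where
  "div_factor \<epsilon> z = 4 * F z / C z * ((3/2 * \<epsilon> + dlog C z / 2) * lop_factor \<epsilon> z + lop_factor' \<epsilon> z)"
definition div_factor' :: "real \<Rightarrow> real \<Rightarrow> real" where
  "div_factor' \<epsilon> z = 4 * (deriv F z - F z * dlog C z) / C z * ((3/2 * \<epsilon> + dlog C z / 2) * lop_factor \<epsilon> z + lop_factor' \<epsilon> z)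
     + 4 * F z / C z * (dlog' C z / 2 * lop_factor \<epsilon> z + (3/2 * \<epsilon> + dlog C z / 2) * lop_factor' \<epsilon> z + lop_factor'' \<epsilon> z)"

lemma div_factor_deriv:
  assumes "z \<in> I" "\<epsilon> \<in> {1, -1}"
  shows "(div_factor \<epsilon> has_real_derivative div_factor' \<epsilon> z) (at z)"
proof -
  have 1: "((\<lambda>z. 4 * F z / C z) has_real_derivative 4 * (deriv F z - F z * dlog C z) / C z) (at z)"
    using assms(1) nz[OF assms(1)] unfolding dlog_def
    by (auto intro!: derivative_eq_intros jets simp: field_simps)
  have 2: "((\<lambda>z. (3/2 * \<epsilon> + dlog C z / 2) * lop_factor \<epsilon> z + lop_factor' \<epsilon> z) has_real_derivative
      dlog' C z / 2 * lop_factor \<epsilon> z + (3/2 * \<epsilon> + dlog C z / 2) * lop_factor' \<epsilon> z + lop_factor'' \<epsilon> z) (at z)"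
    by (auto intro!: derivative_eq_intros lop_factor_deriv dlog_deriv assms)
  show ?thesis unfolding div_factor_def[abs_def] div_factor'_def
    by (rule DERIV_cong[OF DERIV_mult[OF 1 2]]) (simp only: mult.commute)
qed

definition div_Weyl :: "real \<Rightarrow> ix list \<Rightarrow> real" where
  "div_Weyl z = comps3 (\<lambda>i j k. div_factor 1 z * typeD 1 F C z I0 i j k + div_factor (-1) z * typeD (-1) F C z I0 i j k)"
definition div_Weyl' :: "real \<Rightarrow> ix list \<Rightarrow> real" where
  "div_Weyl' z = comps3 (\<lambda>i j k. (div_factor' 1 z * typeD 1 F C z I0 i j k + div_factor 1 z * typeD' 1 F C z I0 i j k)
     + (div_factor' (-1) z * typeD (-1) F C z I0 i j k + div_factor (-1) z * typeD' (-1) F C z I0 i j k))"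

lemma div_Weyl_deriv: "z \<in> I \<Longrightarrow> ((\<lambda>z. div_Weyl z is) has_real_derivative div_Weyl' z is) (at z)"
  unfolding div_Weyl_def div_Weyl'_def comps3_def
  by (auto intro!: derivative_eq_intros div_factor_deriv typeD_deriv)

lemma trace_nabla_Weyl:
  assumes "z \<in> I" "length is = 3" shows "trace_comps (nabla_Weyl z) (metric_coeff F C z) is = div_Weyl z is"
proof -
  obtain i j k where "is": "is = [i, j, k]" using assms(2) by (auto simp: numeral_3_eq_3 length_Suc_conv)
  have "nabla_Weyl z (s # s # is) =
      cov_comps (conn_coeff F C z) (comps4 (\<lambda>a b c d. lop_factor' 1 z * typeD 1 F C z a b c d + lop_factor 1 z * typeD' 1 F C z a b c d))
         (comps4 (\<lambda>a b c d. lop_factor 1 z * typeD 1 F C z a b c d)) (s # s # is)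
    + cov_comps (conn_coeff F C z) (comps4 (\<lambda>a b c d. lop_factor' (-1) z * typeD (-1) F C z a b c d + lop_factor (-1) z * typeD' (-1) F C z a b c d))
         (comps4 (\<lambda>a b c d. lop_factor (-1) z * typeD (-1) F C z a b c d)) (s # s # is)" for s
    unfolding nabla_Weyl_def cov_comps_add[symmetric]
    by (rule cov_comps_cong[of 4]) (simp_all add: Weyl_comps_def Weyl_comps'_def comps4_def assms(2))
  then show ?thesis
    unfolding trace_comps_def "is"
    by (simp only: add_divide_distrib sum.distrib divergence_components[OF assms(1)] insertI1 insertI2)
       (simp add: div_Weyl_def div_factor_def)
qed

text \<open>The trace of \<open>\<nabla>W\<close> agrees with the explicit divergence on all of \<open>I\<close>, so its derivative does as well.\<close>

lemma trace_nabla_Weyl':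
  assumes "z \<in> I" "length is = 3"
  shows "(\<Sum>s\<in>UNIV. nabla_Weyl' z (s # s # is) / metric_coeff F C z s - nabla_Weyl z (s # s # is) * metric_coeff' F C z s / (metric_coeff F C z s)\<^sup>2) = div_Weyl' z is"
proof -
  have "((\<lambda>z. trace_comps (nabla_Weyl z) (metric_coeff F C z) is) has_real_derivative
     (\<Sum>s\<in>UNIV. nabla_Weyl' z (s # s # is) / metric_coeff F C z s - nabla_Weyl z (s # s # is) * metric_coeff' F C z s / (metric_coeff F C z s)\<^sup>2)) (at z)"
    unfolding trace_comps_def
    by (rule DERIV_sum, rule DERIV_cong[OF DERIV_divide[OF nabla_Weyl_deriv[OF assms(1)] metric_coeff_deriv[OF assms(1)]]])
       (use assms metric_coeff_nz[OF assms(1)] in \<open>simp_all add: field_simps power2_eq_square\<close>)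
  moreover have "((\<lambda>z. trace_comps (nabla_Weyl z) (metric_coeff F C z) is) has_real_derivative div_Weyl' z is) (at z)"
    by (rule has_field_derivative_transform_within_open[OF div_Weyl_deriv[OF assms(1)] open_I assms(1)])
       (simp add: trace_nabla_Weyl assms(2))
  ultimately show ?thesis by (rule DERIV_unique)
qed

lemma double_divergence:
  assumes "x \<in> domM I"
  shows "mtrace (g x) (\<lambda>t t'. mtrace (g x) (\<lambda>s s'. cov5 g (cov4 g (Weyl g)) x t' s' s i j t))
    = tensor (comps2 (\<lambda>a b. \<Sum>t\<in>UNIV. cov_comps (conn_coeff F C (zcoord x)) (div_Weyl' (zcoord x)) (div_Weyl (zcoord x)) [t, a, b, t]
         / metric_coeff F C (zcoord x) t)) x [i, j]"
proof -
  define z where "z = zcoord x"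
  have x: "x \<noteq> 0" and z: "z \<in> I" using domM_zcoord[OF assms] by (simp_all add: z_def)
  define N where "N = cov_comps (conn_coeff F C z) (nabla_Weyl' z) (nabla_Weyl z)"
  have "mtrace (g x) (\<lambda>s s'. cov5 g (cov4 g (Weyl g)) x t' s' s i j t)
     = tensor (cov_comps (conn_coeff F C z) (div_Weyl' z) (div_Weyl z)) x [t', i, j, t]" for t t'
  proof -
    have "bilinear (\<lambda>s s'. tensor N x [t', s', s, i, j, t])"
      using bilinear_swap[OF bilinear_tensor[of N x "[t']" "[]" "[i, j, t]"]] by (simp only: append.simps)
    then have "mtrace (g x) (\<lambda>s s'. cov5 g (cov4 g (Weyl g)) x t' s' s i j t)
       = (\<Sum>s\<in>UNIV. 1 / metric_coeff F C z s * tensor N x [t', frame s x, frame s x, i, j, t])"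
      unfolding cov5_Weyl[OF assms] N_def[symmetric] z_def[symmetric]
      by (simp add: mtrace_frame[OF assms] z_def del: tensor.simps)
    also have "\<dots> = tensor (\<lambda>is. \<Sum>s\<in>UNIV. 1 / metric_coeff F C z s * N (hd is # s # s # tl is)) x [t', i, j, t]"
      unfolding tensor_sum tensor_scale tensor.simps(2)[of _ x t'] tensor_frame[OF x] by (simp only: list.sel)
    also have "\<dots> = tensor (cov_comps (conn_coeff F C z) (div_Weyl' z) (div_Weyl z)) x [t', i, j, t]"
    proof (rule tensor_cong)
      fix "is" :: "ix list" assume l: "length is = length [t', i, j, t]"
      then have 1: "is = hd is # tl is" by (cases "is") auto
      have "(\<Sum>s\<in>UNIV. 1 / metric_coeff F C z s * N (hd is # s # s # tl is))
          = (\<Sum>s\<in>UNIV. cov_comps (conn_coeff F C z) (nabla_Weyl' z) (nabla_Weyl z) (hd is # s # s # tl is) / metric_coeff F C z s)"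
        by (simp add: N_def)
      also have "\<dots> = cov_comps (conn_coeff F C z) (div_Weyl' z) (div_Weyl z) (hd is # tl is)"
        unfolding cov_comps_trace[OF z]
        by (rule cov_comps_cong[of 3]) (use l in \<open>simp_all add: trace_nabla_Weyl[OF z] trace_nabla_Weyl'[OF z]\<close>)
      finally show "(\<Sum>s\<in>UNIV. 1 / metric_coeff F C z s * N (hd is # s # s # tl is)) = cov_comps (conn_coeff F C z) (div_Weyl' z) (div_Weyl z) is"
        using 1 by simp
    qed
    finally show ?thesis .
  qed
  then show ?thesis by (simp only: mtrace_tensor_14[OF assms] z_def)
qed

text \<open>The Ricci tensor is diagonal in the frame, so only the diagonal terms of the double trace survive.\<close>

lemma Weyl_Ric_trace:
  assumes "x \<in> domM I"
  shows "mtrace (g x) (\<lambda>t t'. mtrace (g x) (\<lambda>s s'. Weyl g x s i j t * Ric g x s' t'))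
    = tensor (comps2 (\<lambda>a b. \<Sum>s\<in>UNIV. Weyl_comps (zcoord x) [s, a, b, s] * Ric_coeff F C (zcoord x) s / (metric_coeff F C (zcoord x) s)\<^sup>2)) x [i, j]"
proof -
  define z where "z = zcoord x"
  have x: "x \<noteq> 0" and z: "z \<in> I" using domM_zcoord[OF assms] by (simp_all add: z_def)
  have W: "linear (\<lambda>s. Weyl g x s i j t)" "linear (\<lambda>t. Weyl g x s i j t)" for s t
    unfolding Weyl_tensor_comps[OF assms]
    using linear_tensor[of _ x "[]" "[i, j, t]"] linear_tensor[of _ x "[s, i, j]" "[]"] by (simp_all only: append.simps)
  have R: "linear (\<lambda>s. Ric g x s t)" "linear (\<lambda>t. Ric g x s t)" for s t
    unfolding Ric_tensor[OF assms]
    using linear_tensor[of _ x "[]" "[t]"] linear_tensor[of _ x "[s]" "[]"] by (simp_all only: append.simps)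
  have RF: "Ric g x (frame s x) (frame t x) = (if s = t then Ric_coeff F C z s else 0)" for s t
    unfolding Ric_tensor[OF assms] tensor_frame[OF x] by (simp add: z_def)
  have "mtrace (g x) (\<lambda>s s'. Weyl g x s i j t * Ric g x s' t')
     = (\<Sum>s\<in>UNIV. 1 / metric_coeff F C z s * (Weyl g x (frame s x) i j t * Ric g x (frame s x) t'))" for t t'
    by (subst mtrace_frame[OF assms bilinear_mult[OF W(1) R(1)]]) (simp add: z_def)
  moreover have "bilinear (\<lambda>t t'. \<Sum>s\<in>UNIV. 1 / metric_coeff F C z s * (Weyl g x (frame s x) i j t * Ric g x (frame s x) t'))"
    by (intro bilinear_sum bilinear_cmult bilinear_mult W R)
  ultimately have "mtrace (g x) (\<lambda>t t'. mtrace (g x) (\<lambda>s s'. Weyl g x s i j t * Ric g x s' t'))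
    = (\<Sum>s\<in>UNIV. Weyl g x (frame s x) i j (frame s x) * Ric_coeff F C z s / (metric_coeff F C z s)\<^sup>2)"
    by (simp add: mtrace_frame[OF assms] RF power2_eq_square z_def[symmetric]
       if_distrib[of "\<lambda>t. _ * t"] if_distrib[of "\<lambda>t. t / _"] cong: if_cong)
  also have "\<dots> = (\<Sum>s\<in>UNIV. Ric_coeff F C z s / (metric_coeff F C z s)\<^sup>2 * tensor (\<lambda>is. Weyl_comps z [s, is ! 0, is ! 1, s]) x [i, j])"
    unfolding Weyl_tensor_comps[OF assms] tensor_frame[OF x] z_def[symmetric]
    by (simp add: coframe_frame[OF x] if_distrib[of "\<lambda>t. t * _"] mult.commute[of "Ric_coeff F C z _"] cong: if_cong)
  also have "\<dots> = tensor (comps2 (\<lambda>a b. \<Sum>s\<in>UNIV. Weyl_comps z [s, a, b, s] * Ric_coeff F C z s / (metric_coeff F C z s)\<^sup>2)) x [i, j]"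
    unfolding tensor_scale[symmetric] tensor_sum[symmetric] by (rule tensor_cong) (simp add: comps2_def mult.commute)
  finally show ?thesis by (simp only: z_def)
qed

end

section \<open>The divergence and Bach formulas\<close>

lemma ln_abs_deriv:
  assumes "(h has_real_derivative h') (at z)" "h z \<noteq> 0"
  shows "((\<lambda>z. ln \<bar>h z\<bar>) has_real_derivative h' / h z) (at z)"
proof -
  have sq: "0 < h z * h z" by (metis assms(2) not_real_square_gt_zero)
  \<comment> \<open>For \<open>r = 0\<close> this holds because \<^term>\<open>ln 0 = (0::real)\<close>.\<close>
  have "ln \<bar>r\<bar> = ln (r\<^sup>2) / 2" for r :: real
    using ln_realpow[of "\<bar>r\<bar>" 2] by (cases "r = 0") auto
  then have "(\<lambda>z. ln \<bar>h z\<bar>) = (\<lambda>z. ln ((h z)\<^sup>2) / 2)" by (intro ext)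
  moreover have "((\<lambda>z. ln ((h z)\<^sup>2) / 2) has_real_derivative h' / h z) (at z)"
    using assms sq
    by (auto intro!: derivative_eq_intros simp: power2_eq_square)
  ultimately show ?thesis by simp
qed

context biaxial begin

text \<open>Used to make the component identities polynomial in the logarithmic derivative of \<open>C\<close>.\<close>

lemma deriv_C: "z \<in> I \<Longrightarrow> deriv C z = C z * dlog C z"
  using nz[of z] by (simp add: dlog_def)

lemma Bach_components:
  assumes "z \<in> I"
  shows "(\<Sum>t\<in>UNIV. cov_comps (conn_coeff F C z) (div_Weyl' z) (div_Weyl z) [t, a, b, t] / metric_coeff F C z t)
      + 1/2 * (\<Sum>s\<in>UNIV. Weyl_comps z [s, a, b, s] * Ric_coeff F C z s / (metric_coeff F C z s)\<^sup>2)
    = (if a = b then metric_coeff F C z a *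
         (16 / (3 * (C z)\<^sup>2) * F z * (1/2 * lop_factor'' 1 z + 3/2 * lop_factor' 1 z + lop_factor 1 z) * (case a of I0 \<Rightarrow> 0 | I1 \<Rightarrow> - 2 | _ \<Rightarrow> 1)
        + 8 / (3 * (C z)\<^sup>2) * ((- 1/2 * deriv (deriv F) z + 3/2 * deriv F z + F z - 1) * lop_factor 1 z + deriv F z * lop_factor' 1 z)
            * (case a of I0 \<Rightarrow> - 1 | I1 \<Rightarrow> - 1 | _ \<Rightarrow> 1)) else 0)"
proof -
  note defs = typeD_def typeD'_def sd_form_def sd_form'_def sd_coeff_def sd_coeff'_def wedge_def dlog_def[of F]
    deriv_C[OF assms] div_factor_def div_factor'_def Ric_coeff_def
    lop_factor_def lop_factor'_def lop_factor''_def Lop_eq[OF assms, of 1, simplified] Lop_eq[OF assms, of "-1", simplified]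
  show ?thesis
    using nz[OF assms]
    by (cases a; cases b; hypsubst; simp add: cov_comps_def sum_ix div_Weyl_def div_Weyl'_def Weyl_comps_def;
        (simp add: sum_ix defs Let_def; (simp add: field_simps power2_eq_square)?)?)
qed

lemma Lop_deriv: "z \<in> I \<Longrightarrow> (Lop 1 F has_real_derivative lop_factor' 1 z) (at z)"
proof -
  assume z: "z \<in> I"
  have "((\<lambda>z. lop_factor 1 z + 1) has_real_derivative lop_factor' 1 z) (at z)"
    using lop_factor_deriv(1)[OF z, of 1] by (auto intro!: derivative_eq_intros)
  then show ?thesis by (simp add: lop_factor_def)
qed

lemma Lop_Lop: "z \<in> I \<Longrightarrow> Lop (-1) (Lop 1 F) z - 1 = 1/2 * lop_factor'' 1 z + 3/2 * lop_factor' 1 z + lop_factor 1 z"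
proof -
  assume z: "z \<in> I"
  have d: "deriv (Lop 1 F) z = lop_factor' 1 z" if "z \<in> I" for z using Lop_deriv[OF that] by (rule DERIV_imp_deriv)
  have "((\<lambda>z. lop_factor' 1 z + Lop 1 F z) has_real_derivative lop_factor'' 1 z + lop_factor' 1 z) (at z)"
    by (auto intro!: derivative_eq_intros lop_factor_deriv Lop_deriv z)
  then have "(first_order_op 1 (Lop 1 F) has_real_derivative lop_factor'' 1 z + lop_factor' 1 z) (at z)"
    by (rule has_field_derivative_transform_within_open[OF _ open_I z]) (simp add: first_order_op_def d)
  then have "deriv (first_order_op 1 (Lop 1 F)) z = lop_factor'' 1 z + lop_factor' 1 z" by (rule DERIV_imp_deriv)
  then show ?thesis
    unfolding Lop_def[of "-1"] by (simp add: first_order_op_def[of "1/2"]) (simp add: first_order_op_def d[OF z] lop_factor_def field_simps)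
qed

lemma sigma_squares:
  assumes "x \<in> domM I"
  shows "sigma0 F C x u * sigma0 F C x v = metric_coeff F C (zcoord x) I0 * (dz x u * dz x v)"
    "sigma1 F C x u * sigma1 F C x v = metric_coeff F C (zcoord x) I1 * (eta1 x u * eta1 x v)"
    "sigma2 C x u * sigma2 C x v = metric_coeff F C (zcoord x) I2 * (eta2 x u * eta2 x v)"
    "sigma3 C x u * sigma3 C x v = metric_coeff F C (zcoord x) I3 * (eta3 x u * eta3 x v)"
proof -
  have z: "zcoord x \<in> I" using domM_zcoord[OF assms] by simp
  have s: "sqrt r * a * (sqrt r * b) = r * (a * b)" if "r \<ge> 0" for r a b :: real
    using that by (metis mult.assoc mult.left_commute real_sqrt_mult_self abs_of_nonneg)
  show "sigma0 F C x u * sigma0 F C x v = metric_coeff F C (zcoord x) I0 * (dz x u * dz x v)"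
    "sigma1 F C x u * sigma1 F C x v = metric_coeff F C (zcoord x) I1 * (eta1 x u * eta1 x v)"
    "sigma2 C x u * sigma2 C x v = metric_coeff F C (zcoord x) I2 * (eta2 x u * eta2 x v)"
    "sigma3 C x u * sigma3 C x v = metric_coeff F C (zcoord x) I3 * (eta3 x u * eta3 x v)"
    using pos[OF z] by (simp_all add: sigma0_def sigma1_def sigma2_def sigma3_def s)
qed

lemma diagonal_tensor: "tensor (comps2 (\<lambda>a b. if a = b then h a else 0)) x [u, v]
    = h I0 * (dz x u * dz x v) + h I1 * (eta1 x u * eta1 x v) + h I2 * (eta2 x u * eta2 x v) + h I3 * (eta3 x u * eta3 x v)"
  by (simp add: sum_ix)

lemma Bach_formula:
  assumes "x \<in> domM I" and z: "zcoord x = z"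
  shows "Bach g x u v =
         16 / (3 * (C z)\<^sup>2) * F z * (Lop (-1) (Lop 1 F) z - 1)
           * (- 2 * (sigma1 F C x u * sigma1 F C x v)
              + sigma2 C x u * sigma2 C x v + sigma3 C x u * sigma3 C x v)
         + 8 / (3 * (C z)\<^sup>2) * Bop F z
           * (- (sigma0 F C x u * sigma0 F C x v) - sigma1 F C x u * sigma1 F C x v
              + sigma2 C x u * sigma2 C x v + sigma3 C x u * sigma3 C x v)"
proof -
  have zI: "z \<in> I" using domM_zcoord[OF assms(1)] z by simp
  define P where "P = 16 / (3 * (C z)\<^sup>2) * F z * (Lop (- 1) (Lop 1 F) z - 1)"
  define Q where "Q = 8 / (3 * (C z)\<^sup>2) * Bop F z"
  have B: "Bop F z = (- 1/2 * deriv (deriv F) z + 3/2 * deriv F z + F z - 1) * lop_factor 1 z + deriv F z * lop_factor' 1 z"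
    unfolding Bop_def lop_factor_def DERIV_imp_deriv[OF Lop_deriv[OF zI]] ..
  have "Bach g x u v = tensor (\<lambda>is. comps2 (\<lambda>a b. \<Sum>t\<in>UNIV. cov_comps (conn_coeff F C z) (div_Weyl' z) (div_Weyl z) [t, a, b, t] / metric_coeff F C z t) is
      + 1/2 * comps2 (\<lambda>a b. \<Sum>s\<in>UNIV. Weyl_comps z [s, a, b, s] * Ric_coeff F C z s / (metric_coeff F C z s)\<^sup>2) is) x [u, v]"
    unfolding Bach_def double_divergence[OF assms(1)] Weyl_Ric_trace[OF assms(1)] tensor_add tensor_scale z ..
  also have "\<dots> = tensor (comps2 (\<lambda>a b. if a = b then metric_coeff F C z a *
         (16 / (3 * (C z)\<^sup>2) * F z * (Lop (-1) (Lop 1 F) z - 1) * (case a of I0 \<Rightarrow> 0 | I1 \<Rightarrow> - 2 | _ \<Rightarrow> 1)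
        + 8 / (3 * (C z)\<^sup>2) * Bop F z * (case a of I0 \<Rightarrow> - 1 | I1 \<Rightarrow> - 1 | _ \<Rightarrow> 1)) else 0)) x [u, v]"
    unfolding Lop_Lop[OF zI] B
    by (rule tensor_cong) (simp only: comps2_def Bach_components[OF zI])
  finally show ?thesis
    unfolding diagonal_tensor sigma_squares[OF assms(1)] z P_def[symmetric] Q_def[symmetric]
    by (simp add: algebra_simps del: metric_coeff.simps)
qed

lemma grad_zcoord:
  assumes "x \<in> domM I" "(\<phi> has_real_derivative \<phi>') (at (zcoord x))"
  shows "grad g (\<lambda>y. \<phi> (zcoord y)) x = (\<phi>' / metric_coeff F C (zcoord x) I0) *\<^sub>R frame I0 x"
proof -
  have x: "x \<noteq> 0" using domM_zcoord[OF assms(1)] by simp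
  have "((\<lambda>y. \<phi> (zcoord y)) has_derivative (\<lambda>s. \<phi>' * dz x s)) (at x)"
    using has_derivative_compose[OF zcoord_has_derivative[OF x]] assms(2)
    unfolding has_field_derivative_def by blast
  then have "dir_deriv (\<lambda>y. \<phi> (zcoord y)) x = (\<lambda>s. \<phi>' * coframe I0 x s)"
    by (auto intro!: ext dir_deriv_eqI)
  moreover have "linear (\<lambda>s. \<phi>' * coframe I0 x s)"
    by (intro linear_cmult linear_coframe)
  ultimately show ?thesis
    unfolding grad_def
    by (simp add: sharp_eq[OF assms(1)] sum_ix coframe_frame[OF x] dual_frame[OF x] del: coframe.simps)
qed

lemma div_W_pm:
  assumes "x \<in> domM I" "\<epsilon> \<in> {1, -1}"
  shows "div4 g (W_pm \<epsilon> F C) x u v w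
    = tensor (comps3 (\<lambda>i j k. div_factor \<epsilon> (zcoord x) * typeD \<epsilon> F C (zcoord x) I0 i j k)) x [u, v, w]"
proof -
  define z where "z = zcoord x"
  have x: "x \<noteq> 0" and z: "z \<in> I" using domM_zcoord[OF assms(1)] by (simp_all add: z_def)
  define t where "t z = comps4 (\<lambda>a b c d. lop_factor \<epsilon> z * typeD \<epsilon> F C z a b c d)" for z
  define t' where "t' = comps4 (\<lambda>a b c d. lop_factor' \<epsilon> z * typeD \<epsilon> F C z a b c d + lop_factor \<epsilon> z * typeD' \<epsilon> F C z a b c d)"
  have d: "((\<lambda>z. t z is) has_real_derivative t' is) (at z)" for "is"
    unfolding t_def t'_def comps4_def by (auto intro!: derivative_eq_intros lop_factor_deriv typeD_deriv z assms(2))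
  have "cov4 g (W_pm \<epsilon> F C) x s a b c d = tensor (cov_comps (conn_coeff F C z) t' (t z)) x [s, a, b, c, d]" for s a b c d
    unfolding z_def using d
    by (intro cov4_tensor[OF assms(1)]) (simp_all only: W_pm_tensor assms(2) t_def lop_factor_def z_def)
  then have "div4 g (W_pm \<epsilon> F C) x u v w
     = tensor (\<lambda>is. \<Sum>s\<in>UNIV. cov_comps (conn_coeff F C z) t' (t z) (s # s # is) / metric_coeff F C z s) x [u, v, w]"
    by (simp only: div4_def mtrace_tensor_12[OF assms(1)] z_def)
  also have "\<dots> = tensor (comps3 (\<lambda>i j k. div_factor \<epsilon> z * typeD \<epsilon> F C z I0 i j k)) x [u, v, w]"
    by (rule tensor_cong)
       (auto simp: length_Suc_conv t_def t'_def divergence_components[OF z assms(2)] div_factor_def)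
  finally show ?thesis by (simp only: z_def)
qed

text \<open>The gradient of a function of \<open>z\<close> is a multiple of \<open>X\<^sub>0\<close>. The logarithmic derivative of
  \<open>exp (\<plusminus>3z/2) (\<L>\<^sup>\<plusminus>F - 1) \<surd>C\<close>, multiplied by \<open>\<L>\<^sup>\<plusminus>F - 1\<close>, is the coefficient found in
  \<open>divergence_components\<close>.\<close>

lemma div_W_pm_formula:
  assumes "x \<in> domM I" "\<epsilon> \<in> {1, -1}" "Lop \<epsilon> F (zcoord x) \<noteq> 1"
  shows "div4 g (W_pm \<epsilon> F C) x u v w = W_pm \<epsilon> F C x
     (grad g (\<lambda>y. ln \<bar>exp (\<epsilon> * (3/2) * zcoord y) * (Lop \<epsilon> F (zcoord y) - 1) * sqrt (C (zcoord y))\<bar>) x) u v w"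
proof -
  define z where "z = zcoord x"
  have x: "x \<noteq> 0" and z: "z \<in> I" using domM_zcoord[OF assms(1)] by (simp_all add: z_def)
  have u: "lop_factor \<epsilon> z \<noteq> 0" using assms(3) by (simp add: lop_factor_def z_def)
  define \<phi>' where "\<phi>' = 3/2 * \<epsilon> + lop_factor' \<epsilon> z / lop_factor \<epsilon> z + dlog C z / 2"
  have s: "((\<lambda>z. sqrt (C z)) has_real_derivative sqrt (C z) * (dlog C z / 2)) (at z)"
  proof -
    have "((\<lambda>z. sqrt (C z)) has_real_derivative inverse (sqrt (C z)) / 2 * deriv C z) (at z)"
      using pos(2)[OF z] by (auto intro!: derivative_eq_intros jets z)
    moreover have "inverse (sqrt (C z)) / 2 * deriv C z = sqrt (C z) * (dlog C z / 2)"
      using pos(2)[OF z] by (simp add: dlog_def field_simps)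
    ultimately show ?thesis by simp
  qed
  have "((\<lambda>z. exp (\<epsilon> * (3/2) * z) * lop_factor \<epsilon> z * sqrt (C z)) has_real_derivative
     exp (\<epsilon> * (3/2) * z) * lop_factor \<epsilon> z * sqrt (C z) * \<phi>') (at z)"
  proof (rule DERIV_cong[OF DERIV_mult[OF DERIV_mult[OF _ lop_factor_deriv(1)[OF z assms(2)]] s]])
    show "((\<lambda>z. exp (\<epsilon> * (3/2) * z)) has_real_derivative exp (\<epsilon> * (3/2) * z) * (3/2 * \<epsilon>)) (at z)"
      by (auto intro!: derivative_eq_intros)
  qed (use u in \<open>simp add: \<phi>'_def field_simps\<close>)
  from ln_abs_deriv[OF this] have "((\<lambda>z. ln \<bar>exp (\<epsilon> * (3/2) * z) * lop_factor \<epsilon> z * sqrt (C z)\<bar>) has_real_derivative \<phi>') (at z)"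
    using u pos(2)[OF z] by simp
  then have g: "grad g (\<lambda>y. ln \<bar>exp (\<epsilon> * (3/2) * zcoord y) * (Lop \<epsilon> F (zcoord y) - 1) * sqrt (C (zcoord y))\<bar>) x
      = (\<phi>' / metric_coeff F C z I0) *\<^sub>R frame I0 x"
    unfolding lop_factor_def[symmetric] z_def by (rule grad_zcoord[OF assms(1)])
  define t where "t = comps4 (\<lambda>a b c d. lop_factor \<epsilon> z * typeD \<epsilon> F C z a b c d)"
  have l: "linear (\<lambda>s. tensor t x [s, u, v, w])" using linear_tensor[of t x "[]"] by (simp only: append.simps)
  have "W_pm \<epsilon> F C x s u v w = tensor t x [s, u, v, w]" for s
    unfolding W_pm_tensor[OF assms(1,2)] t_def lop_factor_def z_def ..
  then have "W_pm \<epsilon> F C x ((\<phi>' / metric_coeff F C z I0) *\<^sub>R frame I0 x) u v w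
     = \<phi>' / metric_coeff F C z I0 * tensor t x [frame I0 x, u, v, w]"
    using linear_scale[OF l, of "\<phi>' / metric_coeff F C z I0" "frame I0 x"] by (simp only: real_scaleR_def)
  also have "\<dots> = tensor (\<lambda>is. \<phi>' / metric_coeff F C z I0 * t (I0 # is)) x [u, v, w]"
    unfolding tensor_frame[OF x] tensor_scale ..
  also have "\<dots> = tensor (comps3 (\<lambda>i j k. div_factor \<epsilon> z * typeD \<epsilon> F C z I0 i j k)) x [u, v, w]"
    using u nz[OF z]
    by (intro tensor_cong) (auto simp: length_Suc_conv t_def div_factor_def \<phi>'_def field_simps)
  finally show ?thesis
    unfolding g by (simp only: div_W_pm[OF assms(1,2)] z_def)
qed

end

section \<open>Scalar curvature, trace-free Ricci tensor and the Kaehler case\<close>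

text \<open>\<open>J\<^sup>+\<close> sends \<open>X\<^sub>i\<close> with \<open>i = J_ix k\<close> to \<open>J_coeff k X\<^sub>k\<close>.\<close>

definition J_coeff :: "(real \<Rightarrow> real) \<Rightarrow> real \<Rightarrow> ix \<Rightarrow> real" where
  "J_coeff F z k = (case k of I0 \<Rightarrow> - 2 * F z | I1 \<Rightarrow> 1 / (2 * F z) | I2 \<Rightarrow> - 1 | I3 \<Rightarrow> 1)"

definition J_ix :: "ix \<Rightarrow> ix" where
  "J_ix k = (case k of I0 \<Rightarrow> I1 | I1 \<Rightarrow> I0 | I2 \<Rightarrow> I3 | I3 \<Rightarrow> I2)"

lemma Jpm_frame_sum:
  "Jpm 1 F y u = (\<Sum>k\<in>UNIV. (J_coeff F (zcoord y) k * coframe (J_ix k) y u) *\<^sub>R frame k y)"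
  by (simp add: sum_ix Jpm_def J_coeff_def J_ix_def)

context biaxial begin

text \<open>Expressed by logarithmic derivatives of \<open>C\<close>, so that the powers of \<open>C\<close> factor out.\<close>

lemma powr_derivs:
  assumes "z \<in> I"
  shows "deriv (\<lambda>r. C r powr a) z = a * C z powr a * dlog C z"
    and "deriv (deriv (\<lambda>r. C r powr a)) z = a * C z powr a * (a * (dlog C z)\<^sup>2 + dlog' C z)"
    and "deriv (\<lambda>t. F t * deriv (\<lambda>r. C r powr a) t) z
      = a * C z powr a * (deriv F z * dlog C z + F z * (a * (dlog C z)\<^sup>2 + dlog' C z))"
proof -
  have P: "((\<lambda>r. C r powr a) has_real_derivative a * C z powr a * dlog C z) (at z)" if "z \<in> I" for z
  proof -
    have "((\<lambda>r. C r powr a) has_real_derivative a * C z powr (a - 1) * deriv C z) (at z)"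
      using pos(2)[OF that] by (auto intro!: derivative_eq_intros jets that)
    then show ?thesis
      using pos(2)[OF that] by (simp add: dlog_def powr_diff)
  qed
  have 1: "deriv (\<lambda>r. C r powr a) z = a * C z powr a * dlog C z" if "z \<in> I" for z
    using P[OF that] by (rule DERIV_imp_deriv)
  show "deriv (\<lambda>r. C r powr a) z = a * C z powr a * dlog C z" by (rule 1[OF assms])
  have 2: "((deriv (\<lambda>r. C r powr a)) has_real_derivative a * C z powr a * (a * (dlog C z)\<^sup>2 + dlog' C z)) (at z)"
  proof (rule has_field_derivative_transform_within_open[OF _ open_I assms])
    show "((\<lambda>z. a * C z powr a * dlog C z) has_real_derivative a * C z powr a * (a * (dlog C z)\<^sup>2 + dlog' C z)) (at z)"
      by (rule DERIV_cong[OF DERIV_mult[OF DERIV_cmult[OF P[OF assms]] dlog_deriv(2)[OF assms]]])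
         (simp add: algebra_simps power2_eq_square)
  qed (simp add: 1)
  then show "deriv (deriv (\<lambda>r. C r powr a)) z = a * C z powr a * (a * (dlog C z)\<^sup>2 + dlog' C z)"
    by (rule DERIV_imp_deriv)
  have "((\<lambda>t. F t * deriv (\<lambda>r. C r powr a) t) has_real_derivative
     a * C z powr a * (deriv F z * dlog C z + F z * (a * (dlog C z)\<^sup>2 + dlog' C z))) (at z)"
    by (rule DERIV_cong[OF DERIV_mult[OF jets(1)[OF assms] 2]]) (simp add: 1[OF assms] algebra_simps)
  then show "deriv (\<lambda>t. F t * deriv (\<lambda>r. C r powr a) t) z
      = a * C z powr a * (deriv F z * dlog C z + F z * (a * (dlog C z)\<^sup>2 + dlog' C z))"
    by (rule DERIV_imp_deriv)
qed

lemma powr_products: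
  assumes "z \<in> I"
  shows "C z powr (-3/2) * C z powr (1/2) = 1 / C z" "C z powr (-1/2) * C z powr (-1/2) = 1 / C z"
proof -
  have "C z powr a * C z powr b = 1 / C z" if "a + b = - 1" for a b
    unfolding powr_add[symmetric] that using pos(2)[OF assms] by (simp add: powr_minus_divide)
  then show "C z powr (-3/2) * C z powr (1/2) = 1 / C z" "C z powr (-1/2) * C z powr (-1/2) = 1 / C z"
    by simp_all
qed

lemma scal_fun_eq:
  assumes "z \<in> I"
  shows "scal_fun F C z = - 4 / C z * (deriv (deriv F) z + 1/2 * F z - 2)
     - 12 / C z * (deriv F z * dlog C z + F z * (1/2 * (dlog C z)\<^sup>2 + dlog' C z))"
  using nz[OF assms]
  by (simp add: scal_fun_def sum_ix Ric_coeff_def Let_def field_simps power2_eq_square)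

lemma scal_formula:
  assumes "x \<in> domM I" and z: "zcoord x = z"
  shows "scal g x = - 4 * inverse (C z) * (deriv (deriv F) z + 1/2 * F z - 2)
         - 24 * C z powr (-3/2) * deriv (\<lambda>t. F t * deriv (\<lambda>r. C r powr (1/2)) t) z"
proof -
  have zI: "z \<in> I" using domM_zcoord[OF assms(1)] z by simp
  have r: "24 * C z powr (-3/2) * (1/2 * C z powr (1/2) * h) = 12 / C z * h" for h
  proof -
    have "24 * C z powr (-3/2) * (1/2 * C z powr (1/2) * h) = 12 * (C z powr (-3/2) * C z powr (1/2)) * h"
      by simp
    then show ?thesis unfolding powr_products(1)[OF zI] by simp
  qed
  show ?thesis
    unfolding scal_eq[OF assms(1)] z scal_fun_eq[OF zI] powr_derivs(3)[OF zI] r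
    by (simp only: divide_inverse)
qed

lemma Ric0_formula:
  assumes "x \<in> domM I" and z: "zcoord x = z"
  shows "Ric0 g x u v = 4 * F z * C z powr (-1/2)
           * (deriv (deriv (\<lambda>r. C r powr (-1/2))) z - 1/4 * C z powr (-1/2))
           * (sigma0 F C x u * sigma0 F C x v - sigma1 F C x u * sigma1 F C x v)
         + 2 * (C z powr (-1/2) * deriv (\<lambda>t. F t * deriv (\<lambda>r. C r powr (-1/2)) t) z
                - inverse (C z) * (1/2 * deriv (deriv F) z - 3/4 * F z + 1))
           * (sigma0 F C x u * sigma0 F C x v + sigma1 F C x u * sigma1 F C x v
              - sigma2 C x u * sigma2 C x v - sigma3 C x u * sigma3 C x v)"
proof -
  have zI: "z \<in> I" using domM_zcoord[OF assms(1)] z by simp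
  define q where "q = C z powr (-1/2)"
  have qq: "q * q = 1 / C z" unfolding q_def by (rule powr_products(2)[OF zI])
  define p where "p = dlog C z"
  define p' where "p' = dlog' C z"
  \<comment> \<open>The coefficients of the two trace-free diagonal tensors in the claim.\<close>
  define A where "A = 4 * F z * q * ((-1/2) * q * ((-1/2) * p\<^sup>2 + p') - 1/4 * q)"
  define B where "B = 2 * (q * ((-1/2) * q * (deriv F z * p + F z * ((-1/2) * p\<^sup>2 + p')))
                - inverse (C z) * (1/2 * deriv (deriv F) z - 3/4 * F z + 1))"
  have "A = 4 * F z * (q * q) * ((-1/2) * ((-1/2) * p\<^sup>2 + p') - 1/4)"
    unfolding A_def by (simp add: algebra_simps)
  then have A: "A = F z / C z * (p\<^sup>2 - 2 * p' - 1)"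
    unfolding qq using nz[OF zI] by (simp add: field_simps)
  have "B = 2 * ((q * q) * ((-1/2) * (deriv F z * p + F z * ((-1/2) * p\<^sup>2 + p')))
                - inverse (C z) * (1/2 * deriv (deriv F) z - 3/4 * F z + 1))"
    unfolding B_def by (simp add: algebra_simps)
  also have "\<dots> = - (deriv F z * p + F z * (p' - p\<^sup>2 / 2) + deriv (deriv F) z - 3/2 * F z + 2) / C z"
    unfolding qq using nz[OF zI] by (simp add: field_simps)
  finally have B: "B = - (deriv F z * p + F z * (p' - p\<^sup>2 / 2) + deriv (deriv F) z - 3/2 * F z + 2) / C z" .
  have d: "Ric_coeff F C z a - scal_fun F C z / 4 * metric_coeff F C z a =
     metric_coeff F C z a * (case a of I0 \<Rightarrow> B + A | I1 \<Rightarrow> B - A | _ \<Rightarrow> - B)" for a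
    using nz[OF zI] unfolding scal_fun_eq[OF zI] p_def[symmetric] p'_def[symmetric] A B
    by (cases a) (simp_all add: Ric_coeff_def Let_def p_def[symmetric] p'_def[symmetric] field_simps power2_eq_square)
  have d': "(if a = b then Ric_coeff F C z a else 0) - scal_fun F C z / 4 * (if a = b then metric_coeff F C z a else 0) =
     (if a = b then metric_coeff F C z a * (case a of I0 \<Rightarrow> B + A | I1 \<Rightarrow> B - A | _ \<Rightarrow> - B) else 0)" for a b
    using d[of a] by (simp only: if_True if_False split: if_split) simp
  have "Ric0 g x u v = tensor (\<lambda>is. comps2 (\<lambda>a b. if a = b then Ric_coeff F C z a else 0) is
      - scal_fun F C z / 4 * comps2 (\<lambda>a b. if a = b then metric_coeff F C z a else 0) is) x [u, v]"
    unfolding Ric0_def Ric_tensor[OF assms(1)] scal_eq[OF assms(1)] bmetric_tensor tensor_diff tensor_scale z by simp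
  also have "\<dots> = tensor (comps2 (\<lambda>a b. if a = b then metric_coeff F C z a * (case a of I0 \<Rightarrow> B + A | I1 \<Rightarrow> B - A | _ \<Rightarrow> - B) else 0)) x [u, v]"
    by (rule tensor_cong) (simp only: comps2_def d')
  finally have R: "Ric0 g x u v = \<dots>" .
  show ?thesis
    unfolding powr_derivs[OF zI] q_def[symmetric] p_def[symmetric] p'_def[symmetric] A_def[symmetric] B_def[symmetric]
    unfolding R diagonal_tensor sigma_squares[OF assms(1)] z
    by (simp add: algebra_simps del: metric_coeff.simps)
qed

text \<open>The component of \<open>(\<nabla>J\<^sup>+)(X\<^sub>2, X\<^sub>0)\<close> along \<open>X\<^sub>3\<close> is \<open>- (1 + C'/C)/2\<close>. It is evaluated at one point of
  the sphere, which suffices as \<open>C\<close> depends on \<open>z\<close> only.\<close>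

lemma Kaehler_dlog:
  assumes K: "Kaehler_on (domM I) g (Jpm 1 F)" and z: "z \<in> I"
  shows "dlog C z = - 1"
proof -
  define x where "x = chart z (1, 0)"
  have p: "(1, 0) \<in> (sphere 0 1 :: point set)" by (simp add: norm_Pair)
  have zx: "zcoord x = z" unfolding x_def by (rule zcoord_chart[OF p])
  have xM: "x \<in> domM I" unfolding domM_def x_def using z p by force
  have x: "x \<noteq> 0" using domM_zcoord[OF xM] by simp
  define s where "s = frame I2 x"
  define u where "u = frame I0 x"
  have "\<exists>c'. ((\<lambda>z. J_coeff F z k) has_real_derivative c') (at z)" for k
    using nz[OF z] by (cases k) (auto simp: J_coeff_def intro!: exI derivative_eq_intros jets z)
  then obtain c' where c': "((\<lambda>z. J_coeff F z k) has_real_derivative c' k) (at z)" for k by metis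
  have c: "((\<lambda>y. J_coeff F (zcoord y) k) has_derivative (\<lambda>s. c' k * dz x s)) (at x)" for k
    using has_derivative_compose[OF zcoord_has_derivative[OF x]] c'[of k]
    unfolding has_field_derivative_def zx[symmetric] by blast
  have "((\<lambda>y. Jpm 1 F y u) has_derivative
     (\<lambda>s. \<Sum>k\<in>UNIV. (J_coeff F (zcoord x) k * coframe (J_ix k) x u) *\<^sub>R frame k s
       + (J_coeff F (zcoord x) k * - coframe (J_ix k) x (bilin flat_coeff x s u) + c' k * dz x s * coframe (J_ix k) x u) *\<^sub>R frame k x)) (at x)"
    unfolding Jpm_frame_sum
    by (intro has_derivative_sum has_derivative_scaleR has_derivative_mult c coframe_has_derivative x
         linear_imp_has_derivative linear_frame)
  then have D: "dir_deriv (\<lambda>y. Jpm 1 F y u) x s =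
     (\<Sum>k\<in>UNIV. (J_coeff F z k * coframe (J_ix k) x u) *\<^sub>R frame k s
       + (J_coeff F z k * - coframe (J_ix k) x (bilin flat_coeff x s u) + c' k * dz x s * coframe (J_ix k) x u) *\<^sub>R frame k x)"
    unfolding zx by (rule dir_deriv_eqI)
  have "cov_endo g (Jpm 1 F) x s u = 0"
    using K xM unfolding Kaehler_on_def by blast
  then have "coframe I3 x (cov_endo g (Jpm 1 F) x s u) = 0"
    by (simp only: linear_0[OF linear_coframe])
  moreover have "coframe I3 x (cov_endo g (Jpm 1 F) x s u) = - 1/2 - dlog C z / 2"
    unfolding cov_endo_def D
    unfolding linear_diff[OF linear_coframe] linear_add[OF linear_coframe] linear_sum[OF linear_coframe]
      linear_scale[OF linear_coframe] s_def u_def frame_frame christoffel_eq[OF xM] zx coframe_bilin[OF x] coframe_Jpm[OF x]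
    using nz[OF z]
    by (simp add: sum_ix coframe_frame[OF x] dual_frame[OF x] J_coeff_def J_ix_def
         coframe_bilin[OF x, of I2, unfolded coframe.simps] field_simps)
  ultimately show ?thesis by simp
qed

lemma Kaehler_formulas:
  assumes K: "Kaehler_on (domM I) g (Jpm 1 F)" and x: "x \<in> domM I" and z: "zcoord x = z"
  shows "scal g x = - (8 / C z) * (Lop 1 F z - 1)"
    and "Ricci_form F C x u v =
             - (2 / C z) * (Lop 1 F z - 1) * omega_pm 1 F C x u v
             - 2 / C z * (first_order_op (-1/2) (first_order_op 1 F) z - 1) * omega_pm (-1) F C x u v"
proof -
  have zI: "z \<in> I" and x0: "x \<noteq> 0" using domM_zcoord[OF x] z by simp_all
  have p: "dlog C z = - 1" if "z \<in> I" for z using Kaehler_dlog[OF K that] .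
  have "(dlog C has_real_derivative 0) (at z)"
    by (rule has_field_derivative_transform_within_open[OF DERIV_const[of "-1"] open_I zI]) (simp add: p)
  then have p': "dlog' C z = 0" using DERIV_unique dlog_deriv(2)[OF zI] by blast
  note L = Lop_eq[OF zI, of 1, simplified]
  show "scal g x = - (8 / C z) * (Lop 1 F z - 1)"
    unfolding scal_eq[OF x] z scal_fun_eq[OF zI] p[OF zI] p' L using nz[OF zI] by (simp add: field_simps)
  have "(first_order_op 1 F has_real_derivative (deriv (deriv F) z + deriv F z)) (at z)"
    unfolding first_order_op_def[abs_def] by (auto intro!: derivative_eq_intros jets zI)
  then have "deriv (first_order_op 1 F) z = deriv (deriv F) z + deriv F z" by (rule DERIV_imp_deriv)
  then have M: "first_order_op (-1/2) (first_order_op 1 F) z = - 1/2 * (deriv (deriv F) z + deriv F z) + deriv F z + F z"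
    by (simp add: first_order_op_def)
  have R: "Ricci_form F C x u v = (\<Sum>a\<in>UNIV. coframe a x (Jpm 1 F x u) * (coframe a x v * Ric_coeff F C z a))"
    unfolding Ricci_form_def Ric_tensor[OF x] z by (simp add: if_distrib[of "\<lambda>t. _ * t"] cong: if_cong)
  show "Ricci_form F C x u v =
             - (2 / C z) * (Lop 1 F z - 1) * omega_pm 1 F C x u v
             - 2 / C z * (first_order_op (-1/2) (first_order_op 1 F) z - 1) * omega_pm (-1) F C x u v"
    unfolding R M L omega_pm_sd_two_form[OF x] sd_two_form_def z coframe_Jpm[OF x0] using nz[OF zI]
    by (simp add: sum_ix Ric_coeff_def Let_def p[OF zI] p' sd_form_def wedge_def) (simp add: field_simps power2_eq_square)
qed

lemma Kaehler_exp:
  assumes K: "Kaehler_on (domM I) g (Jpm 1 F)" and "is_interval I"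
  shows "\<exists>C0>0. \<forall>z\<in>I. C z = C0 * exp (- z)"
proof (cases "I = {}")
  case False
  have "((\<lambda>z. C z * exp z) has_real_derivative 0) (at z within I)" if "z \<in> I" for z
  proof -
    have "deriv C z = - C z" using Kaehler_dlog[OF K that] nz[OF that] by (simp add: dlog_def field_simps)
    then show ?thesis
      by (auto intro!: derivative_eq_intros DERIV_subset[OF jets(5)[OF that]])
  qed
  then obtain c where c: "\<And>z. z \<in> I \<Longrightarrow> C z * exp z = c"
    using has_field_derivative_zero_constant[OF is_interval_convex[OF assms(2)], of "\<lambda>z. C z * exp z"] by blast
  obtain z0 where "z0 \<in> I" using False by blast
  then have "c > 0" using c[of z0] pos(2)[of z0] by (metis exp_gt_zero mult_pos_pos)
  moreover have "C z = c * exp (- z)" if "z \<in> I" for z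
    unfolding c[OF that, symmetric] by (simp add: exp_minus)
  ultimately show ?thesis by blast
qed (auto intro: exI[of _ 1])

end

theorem proposition1p1:
  fixes I :: "real set" and F C :: "real \<Rightarrow> real"
  assumes "is_interval I" and "open I"
    and "smooth_fun_on I F" and "\<forall>z\<in>I. F z > 0"
    and "smooth_fun_on I C" and "\<forall>z\<in>I. C z > 0"
  shows
    "(\<forall>z\<in>I. \<forall>p\<in>sphere 0 1. \<forall>x. x = chart z p \<longrightarrow>
       scal (bmetric F C) x =
         - 4 * inverse (C z) * (deriv (deriv F) z + 1/2 * F z - 2)
         - 24 * C z powr (-3/2) * deriv (\<lambda>t. F t * deriv (\<lambda>r. C r powr (1/2)) t) z)
   \<and> (\<forall>z\<in>I. \<forall>p\<in>sphere 0 1. \<forall>x. x = chart z p \<longrightarrow> (\<forall>u v.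
       Ric0 (bmetric F C) x u v =
         4 * F z * C z powr (-1/2)
           * (deriv (deriv (\<lambda>r. C r powr (-1/2))) z - 1/4 * C z powr (-1/2))
           * (sigma0 F C x u * sigma0 F C x v - sigma1 F C x u * sigma1 F C x v)
         + 2 * (C z powr (-1/2) * deriv (\<lambda>t. F t * deriv (\<lambda>r. C r powr (-1/2)) t) z
                - inverse (C z) * (1/2 * deriv (deriv F) z - 3/4 * F z + 1))
           * (sigma0 F C x u * sigma0 F C x v + sigma1 F C x u * sigma1 F C x v
              - sigma2 C x u * sigma2 C x v - sigma3 C x u * sigma3 C x v)))
   \<and> (\<forall>\<epsilon>\<in>{1, -1}. \<forall>z\<in>I. \<forall>p\<in>sphere 0 1. \<forall>x. x = chart z p \<longrightarrow>
       (\<forall>\<alpha>\<in>Lambda_pm \<epsilon> (bmetric F C x) (vol_form F C x). \<forall>u v.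
       curv_op (bmetric F C x) (W_pm \<epsilon> F C x) \<alpha> u v =
         - (1 / C z) * (Lop \<epsilon> F z - 1)
           * (inner2 (bmetric F C x) (omega_pm \<epsilon> F C x) \<alpha> * omega_pm \<epsilon> F C x u v
              - 2/3 * \<alpha> u v)))
   \<and> (\<forall>\<epsilon>\<in>{1, -1}. \<forall>z\<in>I. \<forall>p\<in>sphere 0 1. \<forall>x. x = chart z p \<and> Lop \<epsilon> F z \<noteq> 1 \<longrightarrow>
       (\<forall>u v w.
       div4 (bmetric F C) (W_pm \<epsilon> F C) x u v w =
         W_pm \<epsilon> F C x
           (grad (bmetric F C)
              (\<lambda>y. ln \<bar>exp (\<epsilon> * (3/2) * zcoord y) * (Lop \<epsilon> F (zcoord y) - 1)
                       * sqrt (C (zcoord y))\<bar>) x) u v w))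
   \<and> (\<forall>z\<in>I. \<forall>p\<in>sphere 0 1. \<forall>x. x = chart z p \<longrightarrow> (\<forall>u v.
       Bach (bmetric F C) x u v =
         16 / (3 * (C z)\<^sup>2) * F z * (Lop (-1) (Lop 1 F) z - 1)
           * (- 2 * (sigma1 F C x u * sigma1 F C x v)
              + sigma2 C x u * sigma2 C x v + sigma3 C x u * sigma3 C x v)
         + 8 / (3 * (C z)\<^sup>2) * Bop F z
           * (- (sigma0 F C x u * sigma0 F C x v) - sigma1 F C x u * sigma1 F C x v
              + sigma2 C x u * sigma2 C x v + sigma3 C x u * sigma3 C x v)))
   \<and> (Kaehler_on (domM I) (bmetric F C) (Jpm 1 F) \<longrightarrow>
       (\<exists>C0>0. \<forall>z\<in>I. C z = C0 * exp (- z)) \<and>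
       (\<forall>z\<in>I. \<forall>p\<in>sphere 0 1. \<forall>x. x = chart z p \<longrightarrow>
          scal (bmetric F C) x = - (8 / C z) * (Lop 1 F z - 1) \<and>
          (\<forall>u v. Ricci_form F C x u v =
             - (2 / C z) * (Lop 1 F z - 1) * omega_pm 1 F C x u v
             - 2 / C z * (first_order_op (-1/2) (first_order_op 1 F) z - 1)
               * omega_pm (-1) F C x u v)))"
proof -
  interpret biaxial I F C using assms by unfold_locales auto
  have xM: "x \<in> domM I \<and> zcoord x = z" if "z \<in> I" "p \<in> sphere 0 1" "x = chart z p" for x z p
    using that zcoord_chart[of p z] unfolding domM_def by (auto intro: image_eqI[of _ _ "(z, p)"])
  show ?thesis
  proof (intro conjI ballI allI impI, goal_cases)
    case (1 z p x)
    then show ?case using xM[of z p x] by (intro scal_formula) auto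
  next
    case (2 z p x u v)
    then show ?case using xM[of z p x] by (intro Ric0_formula) auto
  next
    case (3 \<epsilon> z p x \<alpha> u v)
    then show ?case using xM[of z p x] curv_op_W_pm[of x \<epsilon> \<alpha> u v] by simp
  next
    case (4 \<epsilon> z p x u v w)
    then show ?case using xM[of z p x] by (intro div_W_pm_formula) auto
  next
    case (5 z p x u v)
    then show ?case using xM[of z p x] by (intro Bach_formula) auto
  next
    case 6
    then show ?case using assms(1) by (rule Kaehler_exp)
  next
    case (7 z p x)
    then show ?case using xM[of z p x] by (intro Kaehler_formulas(1)) auto
  next
    case (8 z p x u v)
    then show ?case using xM[of z p x] by (intro Kaehler_formulas(2)) auto
  qed
qed

end
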